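(* Assume condition (A): there exist $C_A,\gamma_A>0$ such that, for all $x,y\in E$, there exists a Markovian coupling $\mathbb{P}_{(x,y)}$ between $\mathbb{P}_x$ and $\mathbb{P}_y$ such that for all $t\in I$, $$\mathbb{E}_{(x,y)}\left[G^X_t\, d(X_t,Y_t)\right]\le C_A e^{-\gamma_A t}d(x,y).$$ Then there exist constants $C_1>0$ and $\alpha>0$ such that, for all probability measures $\mu$ and $\nu$ on $E$ and all $t\in I$, $$\mathcal{W}_d\left(\frac{\mu P_t}{\mu P_t\mathbf 1},\frac{\nu P_t}{\nu P_t\mathbf 1}\right)\le C_1e^{-\alpha t}\,\mathcal{W}_d(\mu,\nu).$$ In addition, the penalized semigroup $(P_t)_{t\in I}$ admits a unique quasi-stationary distribution $\nu_{QS}$, and for all probability measures $\mu$ on $E$ and all $t\in I$, $$\mathcal{W}_d\left(\frac{\mu P_t}{\mu P_t\mathbf 1},\nu_{QS}\right)\le C_1e^{-\alpha t}\,\mathcal{W}_d(\mu,\nu_{QS}).$$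
   Context: Setting. $(E,d)$ is a Polish space whose distance $d$ is bounded on $E\times E$ by a finite constant $\bar d$. For probability measures $\mu,\nu$ on $E$, $\mathcal{W}_d(\mu,\nu)=\inf_{\pi}\iint_{E^2} d(x,y)\,\pi(dx,dy)$ is the $L^1$-Wasserstein distance, where the infimum is over probability measures $\pi$ on $E^2$ with first marginal $\mu$ and second marginal $\nu$. The time set $I$ is either $[0,+\infty)$ or $\mathbb{Z}_+$. $(\Omega,(\mathcal F_t)_{t\in I},(\mathbb{P}_x)_{x\in E},(X_t)_{t\in I})$ is a (time-homogeneous) Markov process evolving in $E$, with $X_0=x$ under $\mathbb{P}_x$; $\mathbb{E}_x$ is the expectation under $\mathbb{P}_x$. The function $\rho:E\to\mathbb{R}_+$ is $d$-Lipschitz. The penalization is $Z_t=Z_t(X)=e^{-\int_0^t\rho(X_s)ds}$ if $I=[0,+\infty)$, and $Z_t=Z_t(X)=p(X_0)p(X_1)\cdots p(X_{t-1})$ with $p=e^{-\rho}$ (and $Z_0=1$) if $I=\mathbb{Z}_+$. The penalized semigroup is $P_tf(x)=\mathbb{E}_x[Z_tf(X_t)]$ for bounded measurable $f$, and $\mu P_tf=\int_E P_tf(x)\,\mu(dx)$ for a probability measure $\mu$ on $E$; $\mathbf 1$ is the constant function equal to $1$, so that $\mu P_t/\mu P_t\mathbf 1$ is a probability measure. Couplings. For $x,y\in E$, a coupling measure between $\mathbb{P}_x$ and $\mathbb{P}_y$ is a probability measure $\mathbb{P}_{(x,y)}$ (with expectation $\mathbb{E}_{(x,y)}$) on a probability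 space where $(X_t,Y_t)_{t\in I}$ is defined, such that $(X_t)_{t\in I}$ (resp. $(Y_t)_{t\in I}$) has the same distribution as $(X_t)_{t\in I}$ under $\mathbb{P}_x$ (resp. under $\mathbb{P}_y$). It is called Markovian if the coupled process $(X_t,Y_t)_{t\in I}$ is Markov with respect to its natural filtration. Write $Z^X_t=Z_t(X)$ and $G^X_t=Z^X_t/\mathbb{E}_xZ_t$. A quasi-stationary distribution is a probability measure $\nu$ on $E$ with $\frac{\nu P_t}{\nu P_t\mathbf 1}=\nu$ for all $t\in I$. *)

theory Defs
  imports "HOL-Probability.Probability"
begin

text \<open>
  The time set \<open>I\<close> is a set of reals, either \<open>{0..}\<close> or \<open>\<nat>\<close> (the set of naturals inside the
  reals); processes are indexed by reals and only their values at times in \<open>I\<close> matter.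
  Probability measures on the state space are the elements of \<open>space (prob_algebra borel)\<close>.
\<close>

text \<open>
  A time-homogeneous Markov process \<open>(\<Omega>, (F t), (P x), (X t))\<close>.  Progressive measurability
  contains adaptedness, and is equivalent to it when \<open>I = \<nat>\<close>; for \<open>I = {0..}\<close> it is what makes
  \<open>\<integral>\<^sub>0\<^sup>t \<rho>(X\<^sub>s) ds\<close> a random variable.
\<close>

locale markov_process =
  fixes I :: "real set"
    and \<Omega> :: "'w measure"
    and F :: "real \<Rightarrow> 'w measure"
    and P :: "'a::polish_space \<Rightarrow> 'w measure"
    and X :: "real \<Rightarrow> 'w \<Rightarrow> 'a"
  assumes time_set: "I = {0..} \<or> I = \<nat>"
    and filtration_subalgebra: "\<And>t. t \<in> I \<Longrightarrow> subalgebra \<Omega> (F t)"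
    and filtration_mono: "\<And>s t. s \<in> I \<Longrightarrow> t \<in> I \<Longrightarrow> s \<le> t \<Longrightarrow> subalgebra (F t) (F s)"
    and kernel: "P \<in> borel \<rightarrow>\<^sub>M prob_algebra \<Omega>"
    and progressive: "\<And>t. t \<in> I \<Longrightarrow>
      (\<lambda>(s, \<omega>). X s \<omega>) \<in> restrict_space borel (I \<inter> {..t}) \<Otimes>\<^sub>M F t \<rightarrow>\<^sub>M borel"
    and initial: "\<And>x. AE \<omega> in P x. X 0 \<omega> = x"
    and markov: "\<And>x s t f. s \<in> I \<Longrightarrow> t \<in> I \<Longrightarrow> f \<in> borel_measurable borel \<Longrightarrow> bounded (range f) \<Longrightarrow>
      AE \<omega> in P x. real_cond_exp (P x) (F s) (\<lambda>\<omega>'. f (X (s + t) \<omega>')) \<omega>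
        = (\<integral>\<omega>'. f (X t \<omega>') \<partial>P (X s \<omega>))"

definition penalization ::
  "real set \<Rightarrow> ('a \<Rightarrow> real) \<Rightarrow> (real \<Rightarrow> 'w \<Rightarrow> 'a) \<Rightarrow> real \<Rightarrow> 'w \<Rightarrow> real" where
  "penalization I \<rho> X t \<omega> =
     (if I = {0..} then exp (- (LBINT s:{0..t}. \<rho> (X s \<omega>)))
      else (\<Prod>k<nat \<lfloor>t\<rfloor>. exp (- \<rho> (X (real k) \<omega>))))"

definition penalized_semigroup ::
  "real set \<Rightarrow> ('a \<Rightarrow> real) \<Rightarrow> ('a \<Rightarrow> 'w measure) \<Rightarrow> (real \<Rightarrow> 'w \<Rightarrow> 'a)
    \<Rightarrow> real \<Rightarrow> ('a \<Rightarrow> real) \<Rightarrow> 'a \<Rightarrow> real" where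
  "penalized_semigroup I \<rho> P X t f x = (\<integral>\<omega>. penalization I \<rho> X t \<omega> * f (X t \<omega>) \<partial>P x)"

text \<open>The probability measure \<open>\<mu>P\<^sub>t / \<mu>P\<^sub>t\<one>\<close>.\<close>

definition conditional_law ::
  "real set \<Rightarrow> ('a::topological_space \<Rightarrow> real) \<Rightarrow> ('a \<Rightarrow> 'w measure) \<Rightarrow> (real \<Rightarrow> 'w \<Rightarrow> 'a)
    \<Rightarrow> real \<Rightarrow> 'a measure \<Rightarrow> 'a measure" where
  "conditional_law I \<rho> P X t \<mu> = measure_of UNIV (sets borel)
     (\<lambda>B. ennreal ((\<integral>x. penalized_semigroup I \<rho> P X t (indicator B) x \<partial>\<mu>) /
                   (\<integral>x. penalized_semigroup I \<rho> P X t (\<lambda>_. 1) x \<partial>\<mu>)))"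

definition quasi_stationary ::
  "real set \<Rightarrow> ('a::topological_space \<Rightarrow> real) \<Rightarrow> ('a \<Rightarrow> 'w measure) \<Rightarrow> (real \<Rightarrow> 'w \<Rightarrow> 'a)
    \<Rightarrow> 'a measure \<Rightarrow> bool" where
  "quasi_stationary I \<rho> P X \<nu> \<longleftrightarrow>
     \<nu> \<in> space (prob_algebra borel) \<and> (\<forall>t\<in>I. conditional_law I \<rho> P X t \<nu> = \<nu>)"

definition measure_couplings ::
  "'a::topological_space measure \<Rightarrow> 'a measure \<Rightarrow> ('a \<times> 'a) measure set" where
  "measure_couplings \<mu> \<nu> =
     {\<pi> \<in> space (prob_algebra (borel \<Otimes>\<^sub>M borel)). distr \<pi> borel fst = \<mu> \<and> distr \<pi> borel snd = \<nu>}"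

text \<open>Only used for bounded distances, so a real-valued infimum is adequate.\<close>

definition wasserstein :: "'a::metric_space measure \<Rightarrow> 'a measure \<Rightarrow> real" where
  "wasserstein \<mu> \<nu> = (INF \<pi>\<in>measure_couplings \<mu> \<nu>. \<integral>p. dist (fst p) (snd p) \<partial>\<pi>)"

definition natural_filtration ::
  "real set \<Rightarrow> 'c measure \<Rightarrow> (real \<Rightarrow> 'c \<Rightarrow> 'b::topological_space) \<Rightarrow> real \<Rightarrow> 'c measure" where
  "natural_filtration I Q W t =
     sigma (space Q) {W s -` B \<inter> space Q | s B. s \<in> I \<and> s \<le> t \<and> B \<in> sets borel}"

text \<open>The Markov property under a single measure; no time-homogeneity is required.\<close>

definition markov_wrt_natural_filtration ::
  "real set \<Rightarrow> 'c measure \<Rightarrow> (real \<Rightarrow> 'c \<Rightarrow> 'b::topological_space) \<Rightarrow> bool" where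
  "markov_wrt_natural_filtration I Q W \<longleftrightarrow>
     (\<forall>s\<in>I. \<forall>t\<in>I. \<forall>f::'b \<Rightarrow> real. s \<le> t \<longrightarrow> f \<in> borel_measurable borel \<longrightarrow> bounded (range f) \<longrightarrow>
       (AE \<omega> in Q. real_cond_exp Q (natural_filtration I Q W s) (\<lambda>\<omega>'. f (W t \<omega>')) \<omega>
          = real_cond_exp Q (vimage_algebra (space Q) (W s) borel) (\<lambda>\<omega>'. f (W t \<omega>')) \<omega>))"

definition path_law ::
  "real set \<Rightarrow> 'c measure \<Rightarrow> (real \<Rightarrow> 'c \<Rightarrow> 'a::topological_space) \<Rightarrow> (real \<Rightarrow> 'a) measure" where
  "path_law I Q X = distr Q (PiM I (\<lambda>_. borel)) (\<lambda>\<omega>. \<lambda>t\<in>I. X t \<omega>)"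

text \<open>
  Joint measurability of the two components guarantees that their penalizations are random
  variables on the coupling space; for \<open>I = \<nat>\<close> it says that each \<open>X' t\<close> and \<open>Y' t\<close> is one.
\<close>

definition markovian_coupling ::
  "real set \<Rightarrow> ('a::polish_space \<Rightarrow> 'w measure) \<Rightarrow> (real \<Rightarrow> 'w \<Rightarrow> 'a) \<Rightarrow> 'a \<Rightarrow> 'a
    \<Rightarrow> 'c measure \<Rightarrow> (real \<Rightarrow> 'c \<Rightarrow> 'a) \<Rightarrow> (real \<Rightarrow> 'c \<Rightarrow> 'a) \<Rightarrow> bool" where
  "markovian_coupling I P X x y Q X' Y' \<longleftrightarrow>
     prob_space Q \<and>
     (\<lambda>(s, \<omega>). X' s \<omega>) \<in> restrict_space borel I \<Otimes>\<^sub>M Q \<rightarrow>\<^sub>M borel \<and>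
     (\<lambda>(s, \<omega>). Y' s \<omega>) \<in> restrict_space borel I \<Otimes>\<^sub>M Q \<rightarrow>\<^sub>M borel \<and>
     path_law I Q X' = path_law I (P x) X \<and>
     path_law I Q Y' = path_law I (P y) X \<and>
     markov_wrt_natural_filtration I Q (\<lambda>t \<omega>. (X' t \<omega>, Y' t \<omega>))"

text \<open>
  The coupling space is carried by the type \<open>'c\<close>, which is arbitrary; the space itself may
  depend on \<open>x\<close> and \<open>y\<close>.
\<close>

definition condition_A ::
  "'c itself \<Rightarrow> real set \<Rightarrow> ('a::polish_space \<Rightarrow> real) \<Rightarrow> ('a \<Rightarrow> 'w measure) \<Rightarrow> (real \<Rightarrow> 'w \<Rightarrow> 'a)
    \<Rightarrow> bool" where
  "condition_A _ I \<rho> P X \<longleftrightarrow>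
     (\<exists>C>0. \<exists>\<gamma>>0. \<forall>x y. \<exists>(Q :: 'c measure) X' Y'.
        markovian_coupling I P X x y Q X' Y' \<and>
        (\<forall>t\<in>I. (\<integral>\<omega>. penalization I \<rho> X' t \<omega> / penalized_semigroup I \<rho> P X t (\<lambda>_. 1) x
                       * dist (X' t \<omega>) (Y' t \<omega>) \<partial>Q)
                \<le> C * exp (- \<gamma> * t) * dist x y))"

end

theory Submission
  imports Defs
begin

text \<open>
The penalized semigroup \<open>P\<^sub>t\<close> is studied through its action on Lipschitz functions, which are
bounded because \<open>d\<close> is; in particular \<open>\<rho>\<close> is bounded, by a constant \<open>c\<close> say, so that \<open>e\<^sup>-\<^sup>c\<^sup>t \<le> Z\<^sub>t \<le>
1\<close>. Write \<open>h\<^sub>t = P\<^sub>t\<one>\<close>, \<open>M\<^sub>t = sup h\<^sub>t\<close>, and \<open>Lip\<close> for the best Lipschitz constant.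

Condition (A) is used at each time through two inequalities. The first is of Lasota--Yorke type,
\<open>\<bar>P\<^sub>tf(x) - P\<^sub>tf(y)\<bar> \<le> (C e\<^sup>-\<^sup>\<gamma>\<^sup>t h\<^sub>t(x) Lip f + K\<^sub>t sup\<bar>f\<bar>) d(x,y)\<close>: the first term moves \<open>f\<close> from \<open>X\<^sub>t\<close>
to \<open>Y\<^sub>t\<close> under the weight \<open>Z\<^sub>t(X)\<close>, the second replaces this weight by \<open>Z\<^sub>t(Y)\<close>, at a price which may
grow with \<open>t\<close> but is proportional to \<open>d(x,y)\<close>. The second inequality compares two arbitrary
starting points: for \<open>f \<ge> 0\<close>, \<open>P\<^sub>tf(y) \<ge> e\<^sup>-\<^sup>c\<^sup>t (P\<^sub>tf(x) - C e\<^sup>-\<^sup>\<gamma>\<^sup>t h\<^sub>t(x) diam(E) Lip f)\<close>. Everything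
that concerns the semigroup is then deduced from these two (\<open>coupling_estimates\<close>) and from
linearity, positivity and the semigroup property, in the locale \<open>penalized_operators\<close>.

The crucial point is a Harnack inequality: \<open>h\<^sub>t(x) \<le> R h\<^sub>t(y)\<close> and \<open>Lip h\<^sub>t \<le> R inf h\<^sub>t\<close> with \<open>R\<close>
independent of \<open>t\<close> (\<open>harnack\<close>). Iterating the first inequality bounds \<open>Lip h\<^sub>t\<close> by a multiple of
\<open>M\<^sub>t\<close> and the second one then bounds \<open>inf h\<^sub>t\<close> from below by a multiple of \<open>M\<^sub>t\<close>, provided that \<open>M\<^sub>s
M\<^sub>t\<^sub>-\<^sub>s / M\<^sub>t\<close> grows in \<open>s\<close> more slowly than \<open>e\<^sup>\<gamma>\<^sup>s\<close>. Since \<open>M\<close> is submultiplicative, it decays at a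
definite rate \<open>\<Lambda>\<close>, and this growth condition holds at least at the record times of \<open>M\<^sub>t (\<eta>/\<Lambda>)\<^sup>t\<close>,
\<open>\<eta>\<close> slightly above 1. At one large record time \<open>s\<close> the resulting lower bound on \<open>h\<^sub>s\<close> makes \<open>M\<close>
almost supermultiplicative along the multiples of \<open>s\<close>, so that all of these are record times as
well.

Given the Harnack inequality, the Markov kernels \<open>f \<mapsto> P\<^sub>t(h\<^sub>u f) / h\<^sub>t\<^sub>+\<^sub>u\<close>, the transition kernels of
the process conditioned to survive until a fixed horizon, satisfy a Lasota--Yorke inequality and
shrink oscillations, with constants that do not depend on the horizon; hence they contract a
mixture of the oscillation and of the Lipschitz constant (\<open>contraction_step\<close>). Taking the horizon
equal to the final time gives \<open>Lip (P\<^sub>tf / P\<^sub>t\<one>) \<le> C e\<^sup>-\<^sup>\<alpha>\<^sup>t Lip f\<close>, and Kantorovich duality turns this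
into the contraction of \<open>\<mu> \<mapsto> \<mu>P\<^sub>t / \<mu>P\<^sub>t\<one>\<close> in the Wasserstein distance (\<open>wasserstein_contraction\<close>).

Duality (\<open>wasserstein_le\<close>) is reduced to finitely many points by quantization, and proved there by
minimizing a penalized cost: the first order conditions produce the dual potentials. The transport
plans obtained in this way have a density with respect to \<open>\<mu> \<otimes> \<nu>\<close>, hence explicit disintegrations.
These can be chained by the Ionescu-Tulcea theorem, which shows that Wasserstein-Cauchy sequences
converge (\<open>wasserstein_complete\<close>). The quasi-stationary distribution is the limit of the
conditional laws at integer times, and it is unique because two of them are at distance 0.
\<close>

section \<open>Transport between finitely many points\<close>

text \<open>
The constraint on the row sums is kept in \<open>K\<close>, the one on the column sums is replaced by a
quadratic penalty. At a minimizer \<open>p\<close>, the vector \<open>v j = (b j - (\<Sum>i<n. p (i, j))) / \<delta>\<close> is the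
potential of the columns: moving mass within a row cannot lower the penalized cost, so \<open>p\<close> charges
only the indices \<open>j\<close> that minimize \<open>c i j - v j\<close>. The cost of \<open>p\<close> is therefore the dual value at
\<open>v\<close>, minus the penalty counted twice.
\<close>
lemma penalized_transport:
  fixes a b :: "nat \<Rightarrow> real" and c :: "nat \<Rightarrow> nat \<Rightarrow> real"
  assumes n: "0 < n" and \<delta>: "0 < \<delta>"
    and K: "compact K" "K \<noteq> {}"
    and K_def: "K = {p. (\<forall>i j. 0 \<le> p (i, j)) \<and> (\<forall>i j. i < n \<and> j < n \<or> p (i, j) = 0)
        \<and> (\<forall>i<n. (\<Sum>j<n. p (i, j)) = a i)}"
    and dual: "\<And>v. (\<Sum>i<n. a i * (MIN j\<in>{..<n}. c i j - v j)) + (\<Sum>j<n. b j * v j) \<le> B"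
  shows "\<exists>p\<in>K. (\<Sum>i<n. \<Sum>j<n. p (i, j) * c i j) + (\<Sum>j<n. (b j - (\<Sum>i<n. p (i, j)))\<^sup>2) / \<delta> \<le> B"
proof -
  define cost where "cost p = (\<Sum>i<n. \<Sum>j<n. p (i, j) * c i j)" for p
  define col where "col p j = (\<Sum>i<n. p (i, j))" for p :: "nat \<times> nat \<Rightarrow> real" and j
  define J where "J p = cost p + (\<Sum>j<n. (b j - col p j)\<^sup>2) / (2 * \<delta>)" for p
  have "continuous_on K J"
    unfolding J_def cost_def col_def
    by (intro continuous_intros continuous_on_product_coordinates continuous_on_subset[OF
        continuous_on_product_coordinates]) (use \<delta> in auto)
  from continuous_attains_inf[OF K this] obtain p where p: "p \<in> K" and min: "\<And>q. q \<in> K \<Longrightarrow> J p \<le> J q"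
    by blast
  define v where "v j = (b j - col p j) / \<delta>" for j
  have opt: "c i j - v j \<le> c i k - v k" if ijk: "i < n" "j < n" "k < n" and pos: "0 < p (i, j)"
    for i j k
  proof (cases "j = k")
    case False
    \<comment> \<open>The direction that moves mass from \<open>j\<close> to \<open>k\<close> within row \<open>i\<close>; \<open>G\<close> is the derivative along
        it.\<close>
    define w where "w x = (if x = (i, k) then 1 else 0) - (if x = (i, j) then 1 else (0::real))"
      for x
    have w_row: "(\<Sum>l<n. w (m, l)) = 0" for m
      using ijk by (cases "m = i") (simp_all add: w_def sum_subtractf)
    have w_cost: "cost w = c i k - c i j"
    proof -
      have "(\<Sum>l<n. w (m, l) * c m l) = (if m = i then c i k - c i j else 0)" for m
        using ijk by (simp add: w_def left_diff_distrib sum_subtractf if_distrib[of "\<lambda>x. x * _"]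
            cong: if_cong)
      then show ?thesis using ijk by (simp add: cost_def)
    qed
    have w_col: "col w l = (if l = k then 1 else 0) - (if l = j then 1 else 0)" for l
    proof -
      have *: "w (m, l) = (if m = i then (if l = k then 1 else 0) - (if l
          = j then 1 else 0) else 0)" for m
        by (auto simp: w_def)
      show ?thesis unfolding col_def * using ijk by simp
    qed
    have lin_cost: "cost (\<lambda>x. p x + e * w x) = cost p + e * cost w" for e
      by (simp add: cost_def sum.distrib distrib_right sum_distrib_left mult.assoc)
    have lin_col: "col (\<lambda>x. p x + e * w x) l = col p l + e * col w l" for e l
      by (simp add: col_def sum.distrib sum_distrib_left)
    define G where "G = cost w - (\<Sum>l<n. v l * col w l)"
    define H where "H = (\<Sum>l<n. (col w l)\<^sup>2) / (2 * \<delta>)"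
    have "(\<Sum>l<n. v l * col w l) = v k - v j"
      using ijk by (simp add: w_col right_diff_distrib sum_subtractf if_distrib[of "\<lambda>x. _ * x"]
          cong: if_cong)
    then have G: "G = (c i k - v k) - (c i j - v j)" by (simp add: G_def w_cost)
    have expand: "J (\<lambda>x. p x + e * w x) = J p + e * G + e\<^sup>2 * H" for e
    proof -
      have "(b l - (col p l + e * col w l))\<^sup>2
          = (b l - col p l)\<^sup>2 - 2 * e * (\<delta> * v l * col w l) + e\<^sup>2 * (col w l)\<^sup>2" for l
      proof -
        have *: "\<delta> * v l = b l - col p l" using \<delta> by (simp add: v_def)
        show ?thesis unfolding * by (simp add: power2_eq_square algebra_simps)
      qed
      then have "(\<Sum>l<n. (b l - (col p l + e * col w l))\<^sup>2)
        = (\<Sum>l<n. (b l - col p l)\<^sup>2) - 2 * e * (\<delta> * (\<Sum>l<n. v l * col w l)) + e\<^sup>2 * (\<Sum>l<n. (col w l)\<^sup>2)"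
        by (simp add: sum.distrib sum_subtractf sum_distrib_left mult.assoc)
      then show ?thesis
        unfolding J_def lin_cost lin_col G_def H_def using \<delta> by (simp add: field_simps)
    qed
    have nonneg: "0 \<le> G + e * H" if e: "0 < e" "e \<le> p (i, j)" for e
    proof -
      have "(\<lambda>x. p x + e * w x) \<in> K"
      proof -
        have "0 \<le> p (m, l) + e * w (m, l)" for m l
          using p e unfolding K_def w_def by (auto simp: add_nonneg_nonneg)
        moreover have "(\<Sum>l<n. p (m, l) + e * w (m, l)) = a m" if "m < n" for m
          using p that w_row[of m] unfolding K_def
          by (simp add: sum.distrib sum_distrib_left[symmetric])
        moreover have "m < n \<and> l < n \<or> p (m, l) + e * w (m, l) = 0" for m l
          using p ijk unfolding K_def w_def by auto
        ultimately show ?thesis unfolding K_def by blast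
      qed
      from min[OF this] have "0 \<le> e * (G + e * H)"
        by (simp add: expand power2_eq_square algebra_simps)
      then show ?thesis using e by (simp add: zero_le_mult_iff)
    qed
    have "0 \<le> G"
    proof (rule tendsto_lowerbound)
      show "((\<lambda>e. G + e * H) \<longlongrightarrow> G) (at_right 0)" by (auto intro!: tendsto_eq_intros)
      have "eventually (\<lambda>e. e < p (i, j)) (at_right 0)" using pos
        by (rule eventually_at_right_real[THEN eventually_mono]) auto
      moreover have "eventually (\<lambda>e::real. 0 < e) (at_right 0)"
        by (simp add: eventually_at_right_less)
      ultimately show "eventually (\<lambda>e. 0 \<le> G + e * H) (at_right 0)"
        by eventually_elim (auto intro!: nonneg)
    qed simp
    then show ?thesis unfolding G by simp
  qed simp
  have cs: "p (i, j) * (c i j - v j) = p (i, j) * (MIN k\<in>{..<n}. c i k - v k)" if "i < n" "j < n"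
    for i j
  proof (cases "p (i, j) = 0")
    case False
    then have pos: "0 < p (i, j)" using p unfolding K_def by (auto simp: less_le)
    have "(MIN k\<in>{..<n}. c i k - v k) = c i j - v j"
      using opt[OF that(1) that(2) _ pos] that by (intro Min_eqI) auto
    then show ?thesis by simp
  qed simp
  have "cost p = (\<Sum>i<n. \<Sum>j<n. p (i, j) * (c i j - v j)) + (\<Sum>i<n. \<Sum>j<n. p (i, j) * v j)"
    unfolding cost_def sum.distrib[symmetric] by (simp add: algebra_simps)
  also have "(\<Sum>i<n. \<Sum>j<n. p (i, j) * v j) = (\<Sum>j<n. col p j * v j)"
    unfolding col_def by (subst sum.swap) (simp add: sum_distrib_right)
  also have "(\<Sum>i<n. \<Sum>j<n. p (i, j) * (c i j - v j)) = (\<Sum>i<n. a i * (MIN k\<in>{..<n}. c i k - v k))"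
  proof (intro sum.cong refl)
    fix i assume "i \<in> {..<n}"
    then have i: "i < n" by simp
    have "(\<Sum>j<n. p (i, j) * (c i j - v j)) = (\<Sum>j<n. p (i, j) * (MIN k\<in>{..<n}. c i k - v k))"
      using cs[OF i] by (intro sum.cong) auto
    also have "\<dots> = (\<Sum>j<n. p (i, j)) * (MIN k\<in>{..<n}. c i k - v k)" by (simp only: sum_distrib_right)
    also have "(\<Sum>j<n. p (i, j)) = a i" using p i unfolding K_def by simp
    finally show "(\<Sum>j<n. p (i, j) * (c i j - v j)) = a i * (MIN k\<in>{..<n}. c i k - v k)" .
  qed
  also have "(\<Sum>j<n. col p j * v j) = (\<Sum>j<n. b j * v j) - (\<Sum>j<n. (b j - col p j)\<^sup>2) / \<delta>"
  proof -
    have "col p j * v j = b j * v j - (b j - col p j)\<^sup>2 / \<delta>" for j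
      using \<delta> by (simp add: v_def power2_eq_square field_simps)
    then show ?thesis by (simp add: sum_subtractf sum_divide_distrib)
  qed
  finally have "cost p + (\<Sum>j<n. (b j - col p j)\<^sup>2) / \<delta> \<le> B" using dual[of v] by linarith
  then show ?thesis using p unfolding cost_def col_def by blast
qed

lemma compact_transport_plans:
  fixes a :: "nat \<Rightarrow> real"
  shows "compact {p. (\<forall>i j. 0 \<le> p (i, j)) \<and> (\<forall>i j. i < n \<and> j < n \<or> p (i, j) = 0)
      \<and> (\<forall>i<n. (\<Sum>j<n. p (i, j)) = a i)}"
    (is "compact ?K")
proof -
  define X where "X x = (if fst x < n \<and> snd x < n then {0..a (fst x)} else {0})"
    for x :: "nat \<times> nat"
  have "compact (X x)" for x by (simp add: X_def)
  then have "compactin (product_topology (\<lambda>_. euclidean) UNIV) (PiE UNIV X)"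
    by (simp add: compactin_PiE)
  then have box: "compact (PiE UNIV X)" by (simp add: euclidean_product_topology)
  have eq: "?K = PiE UNIV X \<inter> (\<Inter>i\<in>{..<n}. {p. (\<Sum>j<n. p (i, j)) = a i})"
  proof (intro equalityI subsetI)
    fix p assume p: "p \<in> ?K"
    have "p (i, j) \<le> a i" if "i < n" "j < n" for i j
    proof -
      have "p (i, j) \<le> (\<Sum>j<n. p (i, j))" using p that by (intro member_le_sum) auto
      then show ?thesis using p that by simp
    qed
    then have "p \<in> PiE UNIV X" using p unfolding X_def PiE_iff by auto
    then show "p \<in> PiE UNIV X \<inter> (\<Inter>i\<in>{..<n}. {p. (\<Sum>j<n. p (i, j)) = a i})" using p by blast
  next
    fix p assume p: "p \<in> PiE UNIV X \<inter> (\<Inter>i\<in>{..<n}. {p. (\<Sum>j<n. p (i, j)) = a i})"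
    then have "p (i, j) \<in> X (i, j)" for i j by (auto simp: PiE_iff)
    then have "0 \<le> p (i, j) \<and> (i < n \<and> j < n \<or> p (i, j) = 0)" for i j
      unfolding X_def
        by (metis (full_types) atLeastAtMost_iff fst_conv snd_conv order_refl singletonD)
    then show "p \<in> ?K" using p by blast
  qed
  have "closed {p. (\<Sum>j<n. p (i, j)) = a i}" for i
    by (intro closed_Collect_eq continuous_intros continuous_on_product_coordinates)
  then show ?thesis unfolding eq by (intro compact_Int_closed[OF box] closed_INT) auto
qed

text \<open>
By \<open>penalized_transport\<close> there are plans of cost at most \<open>B\<close> whose column error is as small as
desired; by compactness one of them has no error.
\<close>
lemma finite_transport_duality:
  fixes a b :: "nat \<Rightarrow> real" and c :: "nat \<Rightarrow> nat \<Rightarrow> real"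
  assumes n: "0 < n" and a: "\<And>i. 0 \<le> a i" and c: "\<And>i j. 0 \<le> c i j"
    and dual: "\<And>v. (\<Sum>i<n. a i * (MIN j\<in>{..<n}. c i j - v j)) + (\<Sum>j<n. b j * v j) \<le> B"
  obtains p :: "nat \<Rightarrow> nat \<Rightarrow> real" where "\<And>i j. 0 \<le> p i j" "\<And>i. i < n \<Longrightarrow> (\<Sum>j<n. p i j) = a i"
    "\<And>j. j < n \<Longrightarrow> (\<Sum>i<n. p i j) = b j" "(\<Sum>i<n. \<Sum>j<n. p i j * c i j) \<le> B"
proof -
  define K where "K = {p. (\<forall>i j. 0 \<le> p (i, j)) \<and> (\<forall>i j. i < n \<and> j < n \<or> p (i, j) = 0)
      \<and> (\<forall>i<n. (\<Sum>j<n. p (i, j)) = a i)}"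
  have K: "compact K" unfolding K_def by (rule compact_transport_plans)
  have "(\<lambda>x. if fst x < n \<and> snd x = 0 then a (fst x) else 0) \<in> K"
    using n a unfolding K_def by auto
  then have ne: "K \<noteq> {}" by blast
  define cost where "cost p = (\<Sum>i<n. \<Sum>j<n. p (i, j) * c i j)" for p
  define err where "err p = (\<Sum>j<n. (b j - (\<Sum>i<n. p (i, j)))\<^sup>2)" for p :: "nat \<times> nat \<Rightarrow> real"
  have cont: "continuous_on UNIV cost" "continuous_on UNIV err"
    unfolding cost_def err_def by (intro continuous_intros continuous_on_product_coordinates)+
  have cost0: "0 \<le> cost p" if "p \<in> K" for p
    using that c unfolding cost_def K_def by (intro sum_nonneg mult_nonneg_nonneg) auto
  have err0: "0 \<le> err p" for p unfolding err_def by (intro sum_nonneg) auto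
  have pen: "\<exists>p\<in>K. cost p \<le> B \<and> err p \<le> \<delta> * B" if \<delta>: "0 < \<delta>" for \<delta>
  proof -
    obtain p where p: "p \<in> K" "cost p + err p / \<delta> \<le> B"
      using penalized_transport[OF n \<delta> K ne K_def dual] unfolding cost_def err_def by blast
    have "0 \<le> err p / \<delta>" using err0 \<delta> by simp
    then have "cost p \<le> B" using p(2) by linarith
    moreover have "err p / \<delta> \<le> B" using p(2) cost0[OF p(1)] by linarith
    then have "err p \<le> \<delta> * B" using \<delta> by (simp add: field_simps)
    ultimately show ?thesis using p(1) by blast
  qed
  define K' where "K' = K \<inter> {p. cost p \<le> B}"
  have K': "compact K'" unfolding K'_def
    by (intro compact_Int_closed K closed_Collect_le cont continuous_on_const)
  have "K' \<noteq> {}" using pen[of 1] unfolding K'_def by auto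
  from continuous_attains_inf[OF K' this continuous_on_subset[OF cont(2) subset_UNIV]]
  obtain p where p: "p \<in> K'" "\<And>q. q \<in> K' \<Longrightarrow> err p \<le> err q" by blast
  have B0: "0 \<le> B" using p(1) cost0[of p] unfolding K'_def by auto
  have "err p \<le> 0 + e" if e: "0 < e" for e
  proof -
    obtain q where "q \<in> K" "cost q \<le> B" "err q \<le> e / (B + 1) * B"
      using pen[of "e / (B + 1)"] e B0 by auto
    then have "err p \<le> e / (B + 1) * B" using p(2)[of q] by (auto simp: K'_def)
    also have "\<dots> \<le> e" using e B0 by (simp add: field_simps)
    finally show ?thesis by simp
  qed
  then have "err p \<le> 0" by (rule field_le_epsilon)
  then have "err p = 0" using err0[of p] by (rule antisym)
  then have "\<forall>j<n. (b j - (\<Sum>i<n. p (i, j)))\<^sup>2 = 0"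
    unfolding err_def by (subst (asm) sum_nonneg_eq_0_iff) auto
  then have "\<And>j. j < n \<Longrightarrow> (\<Sum>i<n. p (i, j)) = b j" by simp
  moreover have "p \<in> K" "cost p \<le> B" using p(1) unfolding K'_def by auto
  ultimately show ?thesis
    using that[of "\<lambda>i j. p (i, j)"] unfolding K_def cost_def by blast
qed

section \<open>Transport plans with a density\<close>

lemma nn_integral_finite_partition:
  assumes M: "prob_space M" and \<kappa>[measurable]: "\<kappa> \<in> M \<rightarrow>\<^sub>M count_space UNIV"
    and lt: "\<And>x. \<kappa> x < (n::nat)"
  shows "(\<integral>\<^sup>+x. g (\<kappa> x) \<partial>M) = (\<Sum>i<n. g i * ennreal (measure M {x\<in>space M. \<kappa> x = i}))"
proof -
  interpret prob_space M by fact
  have "g (\<kappa> x) = (\<Sum>i<n. g i * indicator {x\<in>space M. \<kappa> x = i} x)" if "x \<in> space M" for x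
    using lt[of x] that by (simp add: indicator_def if_distrib[of "\<lambda>x. _ * x"] cong: if_cong)
  then have "(\<integral>\<^sup>+x. g (\<kappa> x) \<partial>M) = (\<integral>\<^sup>+x. (\<Sum>i<n. g i * indicator {x\<in>space M. \<kappa> x = i} x) \<partial>M)"
    by (intro nn_integral_cong) auto
  also have "\<dots> = (\<Sum>i<n. g i * emeasure M {x\<in>space M. \<kappa> x = i})"
    by (subst nn_integral_sum) (auto intro!: sum.cong nn_integral_cmult_indicator)
  finally show ?thesis by (simp add: emeasure_eq_measure)
qed

text \<open>
The cell of a point is the index of the first element of a dense sequence that is close to it; the
tail of the sequence, whose cells carry little mass, is collapsed into a single cell.
\<close>
lemma finite_quantization:
  fixes \<mu> \<nu> :: "'a::{second_countable_topology, metric_space} measure"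
  assumes \<mu>: "\<mu> \<in> space (prob_algebra borel)" and \<nu>: "\<nu> \<in> space (prob_algebra borel)"
    and D: "\<And>x y::'a. dist x y \<le> D" and e: "0 < e"
  obtains n :: nat and \<kappa> :: "'a \<Rightarrow> nat" and z :: "nat \<Rightarrow> 'a" where
    "0 < n" "\<kappa> \<in> borel \<rightarrow>\<^sub>M count_space UNIV" "\<And>x. \<kappa> x < n"
    "(\<integral>x. dist x (z (\<kappa> x)) \<partial>\<mu>) \<le> e" "(\<integral>x. dist x (z (\<kappa> x)) \<partial>\<nu>) \<le> e"
proof -
  obtain S :: "'a set" where S: "countable S" "\<And>U. open U \<Longrightarrow> U \<noteq> {} \<Longrightarrow> \<exists>s\<in>S. s \<in> U"
    using countable_dense_setE by metis
  have Sne: "S \<noteq> {}" using S(2)[of UNIV] by auto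
  define d where "d = from_nat_into S"
  have D0: "0 \<le> D" using D[of undefined undefined] by simp
  define e1 where "e1 = e / (2 * (D + 1))"
  have e1: "0 < e1" using e D0 by (simp add: e1_def)
  have ex: "\<exists>k. dist x (d k) < e / 2" for x
  proof -
    obtain s where s: "s \<in> S" "s \<in> ball x (e / 2)" using S(2)[of "ball x (e / 2)"] e by auto
    obtain k where "d k = s" unfolding d_def using from_nat_into_surj[OF S(1) s(1)] by blast
    then show ?thesis using s(2) by (auto simp: dist_commute)
  qed
  define \<kappa>0 where "\<kappa>0 x = (LEAST k. dist x (d k) < e / 2)" for x
  have \<kappa>0: "dist x (d (\<kappa>0 x)) < e / 2" for x unfolding \<kappa>0_def by (rule LeastI_ex[OF ex])
  have \<kappa>0_meas[measurable]: "\<kappa>0 \<in> borel \<rightarrow>\<^sub>M count_space UNIV"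
    unfolding \<kappa>0_def by measurable
  have small: "\<exists>N. \<forall>m\<ge>N. measure M {x. \<kappa>0 x \<ge> m} < e1" if M: "M \<in> space (prob_algebra borel)"
    for M :: "'a measure"
  proof -
    interpret prob_space M using M by (simp add: space_prob_algebra)
    have sets[measurable_cong]: "sets M = sets borel" using M by (simp add: space_prob_algebra)
    have sp: "space M = UNIV" using sets_eq_imp_space_eq[OF sets] by simp
    have meas: "{x. \<kappa>0 x \<ge> m} \<in> sets M" for m using sets by measurable
    have "(\<lambda>m. measure M {x. \<kappa>0 x \<ge> m}) \<longlonglongrightarrow> measure M (\<Inter>m. {x. \<kappa>0 x \<ge> m})"
      using meas by (intro finite_Lim_measure_decseq) (auto simp: decseq_def)
    also have "(\<Inter>m. {x. \<kappa>0 x \<ge> m}) = {}" using Suc_n_not_le_n by blast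
    finally have "eventually (\<lambda>m. measure M {x. \<kappa>0 x \<ge> m} < e1) sequentially"
      using e1 by (intro order_tendstoD) auto
    then show ?thesis by (simp add: eventually_sequentially)
  qed
  obtain N1 N2 where N: "\<And>m. m \<ge> N1 \<Longrightarrow> measure \<mu> {x. \<kappa>0 x \<ge> m} < e1" "\<And>m. m \<ge> N2
      \<Longrightarrow> measure \<nu> {x. \<kappa>0 x \<ge> m} < e1"
    using small[OF \<mu>] small[OF \<nu>] by blast
  define N where "N = max N1 N2"
  define \<kappa> where "\<kappa> x = min (\<kappa>0 x) N" for x
  have \<kappa>_meas[measurable]: "\<kappa> \<in> borel \<rightarrow>\<^sub>M count_space UNIV" unfolding \<kappa>_def by measurable
  have int: "(\<integral>x. dist x (d (\<kappa> x)) \<partial>M) \<le> e"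
    if M: "M \<in> space (prob_algebra borel)" and le: "measure M {x. \<kappa>0 x \<ge> N} < e1"
      for M :: "'a measure"
  proof -
    interpret prob_space M using M by (simp add: space_prob_algebra)
    have sets[measurable_cong]: "sets M = sets borel" using M by (simp add: space_prob_algebra)
    have sp: "space M = UNIV" using sets_eq_imp_space_eq[OF sets] by simp
    have meas[measurable]: "{x. \<kappa>0 x \<ge> N} \<in> sets M" using sets by measurable
    have [measurable]: "d \<in> count_space UNIV \<rightarrow>\<^sub>M borel" by simp
    have dm: "(\<lambda>x. dist x (d (\<kappa> x))) \<in> borel_measurable M" by measurable
    have "(\<integral>x. dist x (d (\<kappa> x)) \<partial>M) \<le> (\<integral>x. e / 2 + D * indicator {x. \<kappa>0 x \<ge> N} x \<partial>M)"
    proof (rule integral_mono)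
      show "integrable M (\<lambda>x. dist x (d (\<kappa> x)))"
        by (rule integrable_const_bound[of _ D]) (use dm D in auto)
      show "integrable M (\<lambda>x. e / 2 + D * indicator {x. \<kappa>0 x \<ge> N} x)"
        by (auto simp: sp less_top[symmetric])
      fix x show "dist x (d (\<kappa> x)) \<le> e / 2 + D * indicator {x. \<kappa>0 x \<ge> N} x"
        using \<kappa>0[of x] D[of x "d N"] e by (auto simp: \<kappa>_def min_def indicator_def) 
    qed
    also have "\<dots> = e / 2 + D * measure M {x. \<kappa>0 x \<ge> N}"
      by (subst Bochner_Integration.integral_add)
          (auto simp: sp prob_space[unfolded sp] less_top[symmetric])
    also have "\<dots> \<le> e / 2 + (D + 1) * e1" using le D0 by (intro add_left_mono mult_mono) auto
    also have "\<dots> = e" using D0 by (simp add: e1_def field_simps)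
    finally show ?thesis .
  qed
  show ?thesis
  proof (rule that[of "Suc N" \<kappa> d])
    show "(\<integral>x. dist x (d (\<kappa> x)) \<partial>\<mu>) \<le> e" using \<mu> N(1)[of N] by (intro int) (auto simp: N_def)
    show "(\<integral>x. dist x (d (\<kappa> x)) \<partial>\<nu>) \<le> e" using \<nu> N(2)[of N] by (intro int) (auto simp: N_def)
  qed (auto simp: \<kappa>_def \<kappa>_meas)
qed

lemma integrable_bounded_borel:
  assumes M: "M \<in> space (prob_algebra N)" and f: "f \<in> borel_measurable N"
    and B: "\<And>x. \<bar>f x\<bar> \<le> (B::real)"
  shows "integrable M f"
proof -
  interpret prob_space M using M by (simp add: space_prob_algebra)
  have "sets M = sets N" using M by (simp add: space_prob_algebra)
  then have "f \<in> borel_measurable M" using f by (simp cong: measurable_cong_sets)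
  then show ?thesis using B by (intro integrable_const_bound[of _ B]) auto
qed

lemma lipschitz_borel_measurable:
  fixes f :: "'a::metric_space \<Rightarrow> real"
  shows "l-lipschitz_on UNIV f \<Longrightarrow> f \<in> borel_measurable borel"
  by (intro borel_measurable_continuous_onI lipschitz_on_continuous_on)

lemma lipschitz_bounded:
  fixes f :: "'a::metric_space \<Rightarrow> real"
  assumes D: "\<And>x y::'a. dist x y \<le> D" and f: "l-lipschitz_on UNIV f"
  shows "\<bar>f x\<bar> \<le> \<bar>f undefined\<bar> + l * D"
proof -
  have "\<bar>f x - f undefined\<bar> \<le> l * dist x undefined"
    using lipschitz_onD[OF f, of x undefined] by (simp add: dist_real_def)
  also have "\<dots> \<le> l * D"
    using lipschitz_on_nonneg[OF f] D by (intro mult_left_mono)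
  finally show ?thesis by linarith
qed

lemma lipschitz_integrable:
  fixes f :: "'a::metric_space \<Rightarrow> real"
  assumes D: "\<And>x y::'a. dist x y \<le> D" and f: "l-lipschitz_on UNIV f"
    and M: "M \<in> space (prob_algebra borel)"
  shows "integrable M f"
  by (rule integrable_bounded_borel[OF M lipschitz_borel_measurable[OF f] lipschitz_bounded[OF D
      f]])

text \<open>
A transport plan between the two quantized measures is spread over each product of cells as a
multiple of \<open>\<mu> \<otimes> \<nu>\<close>, so that both marginals are exact. A potential \<open>v\<close> on the cell centres \<open>z j\<close>
of the finite problem extends to the 1-Lipschitz function \<open>\<lambda>x. MIN j. dist x (z j) - v j\<close>, to
which the dual bound applies.
\<close>
lemma transport_density:
  fixes \<mu> \<nu> :: "'a::{second_countable_topology, metric_space} measure"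
  assumes \<mu>: "\<mu> \<in> space (prob_algebra borel)" and \<nu>: "\<nu> \<in> space (prob_algebra borel)"
    and D: "\<And>x y::'a. dist x y \<le> D"
    and dual: "\<And>f::'a \<Rightarrow> real. 1-lipschitz_on UNIV f \<Longrightarrow> (\<integral>x. f x \<partial>\<mu>) - (\<integral>x. f x \<partial>\<nu>) \<le> B"
    and e: "0 < e"
  obtains \<rho> :: "'a \<Rightarrow> 'a \<Rightarrow> ennreal" where "(\<lambda>(x, y). \<rho> x y) \<in> borel_measurable (borel \<Otimes>\<^sub>M borel)"
    "\<And>x. (\<integral>\<^sup>+y. \<rho> x y \<partial>\<nu>) = 1" "\<And>y. (\<integral>\<^sup>+x. \<rho> x y \<partial>\<mu>) = 1"
    "(\<integral>\<^sup>+x. \<integral>\<^sup>+y. \<rho> x y * ennreal (dist x y) \<partial>\<nu> \<partial>\<mu>) \<le> ennreal (B + e)"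
proof -
  interpret \<mu>: prob_space \<mu> using \<mu> by (simp add: space_prob_algebra)
  interpret \<nu>: prob_space \<nu> using \<nu> by (simp add: space_prob_algebra)
  have s\<mu>[measurable_cong]: "sets \<mu> = sets borel" using \<mu> by (simp add: space_prob_algebra)
  have s\<nu>[measurable_cong]: "sets \<nu> = sets borel" using \<nu> by (simp add: space_prob_algebra)
  have sp: "space \<mu> = UNIV" "space \<nu> = UNIV"
    using sets_eq_imp_space_eq[OF s\<mu>] sets_eq_imp_space_eq[OF s\<nu>] by auto
  obtain n \<kappa> z where n: "0 < n" and \<kappa>[measurable]: "\<kappa> \<in> borel \<rightarrow>\<^sub>M count_space UNIV"
    and lt: "\<And>x::'a. \<kappa> x < (n::nat)"
    and \<theta>\<mu>: "(\<integral>x. dist x (z (\<kappa> x)) \<partial>\<mu>) \<le> e / 4" and \<theta>\<nu>: "(\<integral>x. dist x (z (\<kappa> x)) \<partial>\<nu>) \<le> e / 4"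
    using finite_quantization[OF \<mu> \<nu> D, of "e / 4"] e by auto
  have z[measurable]: "z \<in> count_space UNIV \<rightarrow>\<^sub>M borel" by simp
  define \<theta> where "\<theta> x = dist x (z (\<kappa> x))" for x
  have \<theta>_meas[measurable]: "\<theta> \<in> borel_measurable borel" unfolding \<theta>_def by measurable
  have \<theta>_nn: "(\<integral>\<^sup>+x. ennreal (\<theta> x) \<partial>M) \<le> ennreal (e / 4)" and \<theta>_int: "integrable M \<theta>"
    if M: "M \<in> space (prob_algebra borel)" and le: "(\<integral>x. dist x (z (\<kappa> x)) \<partial>M) \<le> e / 4" for M
  proof -
    show int: "integrable M \<theta>"
      by (rule integrable_bounded_borel[OF M \<theta>_meas, of D]) (use D in \<open>auto simp: \<theta>_def\<close>)
    show "(\<integral>\<^sup>+x. ennreal (\<theta> x) \<partial>M) \<le> ennreal (e / 4)"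
      using int le by (subst nn_integral_eq_integral)
          (auto simp: \<theta>_def[abs_def] intro!: ennreal_leI)
  qed
  define a where "a i = measure \<mu> {x. \<kappa> x = i}" for i
  define b where "b j = measure \<nu> {x. \<kappa> x = j}" for j
  have part\<mu>: "(\<integral>\<^sup>+x. g (\<kappa> x) \<partial>\<mu>) = (\<Sum>i<n. g i * ennreal (a i))" for g
    using nn_integral_finite_partition[OF \<mu>.prob_space_axioms, of \<kappa> n g] lt by (simp add: a_def sp)
  have part\<nu>: "(\<integral>\<^sup>+x. g (\<kappa> x) \<partial>\<nu>) = (\<Sum>i<n. g i * ennreal (b i))" for g
    using nn_integral_finite_partition[OF \<nu>.prob_space_axioms, of \<kappa> n g] lt by (simp add: b_def sp)
  have real_part: "(\<integral>x. g (\<kappa> x) \<partial>M) = (\<Sum>i<n. g i * measure M {x. \<kappa> x = i})"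
    if M: "M \<in> space (prob_algebra borel)" for M and g :: "nat \<Rightarrow> real"
  proof -
    interpret M: prob_space M using M by (simp add: space_prob_algebra)
    have sM[measurable_cong]: "sets M = sets borel" using M by (simp add: space_prob_algebra)
    have spM: "space M = UNIV" using sets_eq_imp_space_eq[OF sM] by simp
    have eq: "g (\<kappa> x) = (\<Sum>i<n. g i * indicator {x. \<kappa> x = i} x)" for x
      using lt[of x] by (simp add: indicator_def if_distrib[of "\<lambda>x. _ * x"] cong: if_cong)
    have ms: "{x. \<kappa> x = i} \<in> sets M" for i using sM by measurable
    have "(\<integral>x. g (\<kappa> x) \<partial>M) = (\<Sum>i<n. \<integral>x. g i * indicator {x. \<kappa> x = i} x \<partial>M)"
      unfolding eq using ms
        by (intro Bochner_Integration.integral_sum) (auto simp: less_top[symmetric])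
    then show ?thesis using ms by (simp add: spM)
  qed
  define c where "c i j = dist (z i) (z j)" for i j
  have dualv: "(\<Sum>i<n. a i * (MIN j\<in>{..<n}. c i j - v j)) + (\<Sum>j<n. b j * v j) \<le> B + e / 2" for v
  proof -
    define f where "f x = (MIN j\<in>{..<n}. dist x (z j) - v j)" for x
    have ne: "{..<n} \<noteq> {}" using n by auto
    have f_le: "f x \<le> f y + dist x y" for x y
    proof -
      have "f y \<in> (\<lambda>j. dist y (z j) - v j) ` {..<n}" unfolding f_def using ne by (intro Min_in) auto
      then obtain j where j: "j < n" "f y = dist y (z j) - v j" by auto
      have "f x \<le> dist x (z j) - v j" unfolding f_def using j by (intro Min_le) auto
      also have "\<dots> \<le> f y + dist x y" using dist_triangle[of x "z j" y] j by simp
      finally show ?thesis .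
    qed
    have f_lip: "1-lipschitz_on UNIV f"
    proof (rule lipschitz_onI)
      fix x y show "dist (f x) (f y) \<le> 1 * dist x y"
        using f_le[of x y] f_le[of y x] by (simp add: dist_real_def abs_le_iff dist_commute)
    qed simp
    have v_le: "v j \<le> - f (z j)" if "j < n" for j
    proof -
      have "f (z j) \<le> dist (z j) (z j) - v j" unfolding f_def using that
        by (intro Min_le image_eqI[where x = j]) auto
      then show ?thesis by simp
    qed
    have fint: "integrable M f" if "M \<in> space (prob_algebra borel)" for M
      by (rule lipschitz_integrable[OF D f_lip that])
    have fm[measurable]: "f \<in> borel_measurable borel" by (rule lipschitz_borel_measurable[OF f_lip])
    have zint: "integrable M (\<lambda>x. f (z (\<kappa> x)))" if "M \<in> space (prob_algebra borel)" for M
      by (rule integrable_bounded_borel[OF that _ lipschitz_bounded[OF D f_lip]]) measurable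
    have "(\<integral>x. f (z (\<kappa> x)) \<partial>\<mu>) \<le> (\<integral>x. f x + \<theta> x \<partial>\<mu>)"
      using f_le[of "z (\<kappa> _)"]
        by (intro integral_mono zint fint Bochner_Integration.integrable_add \<theta>_int \<mu> \<theta>\<mu>)
          (auto simp: \<theta>_def dist_commute)
    also have "\<dots> = (\<integral>x. f x \<partial>\<mu>) + (\<integral>x. \<theta> x \<partial>\<mu>)"
      by (intro Bochner_Integration.integral_add fint \<theta>_int \<mu> \<theta>\<mu>)
    finally have 1: "(\<integral>x. f (z (\<kappa> x)) \<partial>\<mu>) \<le> (\<integral>x. f x \<partial>\<mu>) + e / 4" using \<theta>\<mu> by (simp add: \<theta>_def)
    have "(\<integral>x. f x \<partial>\<nu>) \<le> (\<integral>x. f (z (\<kappa> x)) + \<theta> x \<partial>\<nu>)"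
      using f_le by (intro integral_mono zint fint Bochner_Integration.integrable_add \<theta>_int \<nu> \<theta>\<nu>)
          (auto simp: \<theta>_def)
    also have "\<dots> = (\<integral>x. f (z (\<kappa> x)) \<partial>\<nu>) + (\<integral>x. \<theta> x \<partial>\<nu>)"
      by (intro Bochner_Integration.integral_add zint \<theta>_int \<nu> \<theta>\<nu>)
    finally have 2: "(\<integral>x. f x \<partial>\<nu>) \<le> (\<integral>x. f (z (\<kappa> x)) \<partial>\<nu>) + e / 4" using \<theta>\<nu> by (simp add: \<theta>_def)
    have "(\<Sum>i<n. a i * (MIN j\<in>{..<n}. c i j - v j)) + (\<Sum>j<n. b j * v j)
      \<le> (\<Sum>i<n. f (z i) * a i) + (\<Sum>j<n. b j * - f (z j))"
      using v_le by (intro add_mono sum_mono mult_left_mono)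
          (auto simp: f_def c_def b_def mult.commute)
    also have "\<dots> = (\<integral>x. f (z (\<kappa> x)) \<partial>\<mu>) - (\<integral>x. f (z (\<kappa> x)) \<partial>\<nu>)"
      using real_part[OF \<mu>, of "\<lambda>i. f (z i)"] real_part[OF \<nu>, of "\<lambda>i. f (z i)"]
      by (simp add: a_def b_def sum_negf mult.commute)
    also have "\<dots> \<le> B + e / 2" using 1 2 dual[OF f_lip] by linarith
    finally show ?thesis .
  qed
  have ab: "0 \<le> a i" "0 \<le> b i" for i by (auto simp: a_def b_def)
  have c0: "0 \<le> c i j" for i j by (simp add: c_def)
  obtain p where p: "\<And>i j. 0 \<le> p i j" "\<And>i. i < n \<Longrightarrow> (\<Sum>j<n. p i j) = a i"
    "\<And>j. j < n \<Longrightarrow> (\<Sum>i<n. p i j) = b j" "(\<Sum>i<n. \<Sum>j<n. p i j * c i j) \<le> B + e / 2"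
    using finite_transport_duality[OF n ab(1) c0 dualv] by blast
  have p0: "p i j = 0" if "i < n" "j < n" "a i = 0 \<or> b j = 0" for i j
  proof -
    have "p i j \<le> a i" using p(1) p(2)[OF that(1)] member_le_sum[of j "{..<n}" "p i"] that by auto
    moreover have "p i j \<le> b j"
      using p(1) p(3)[OF that(2)] member_le_sum[of i "{..<n}" "\<lambda>i. p i j"] that by auto
    ultimately show ?thesis using p(1)[of i j] that by auto
  qed
  have sum1: "(\<Sum>i<n. a i) = 1" "(\<Sum>j<n. b j) = 1"
    using real_part[OF \<mu>, of "\<lambda>_. 1"] real_part[OF \<nu>, of "\<lambda>_. 1"] \<mu>.prob_space \<nu>.prob_space
    by (auto simp: a_def b_def)
  \<comment> \<open>The value 1 on cells without mass makes the marginals of the density exact at every point.\<close>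
  define q where "q i j = (if a i = 0 \<or> b j = 0 then 1 else p i j / (a i * b j))" for i j
  have q0: "0 \<le> q i j" for i j using p(1) ab by (simp add: q_def)
  have qab: "q i j * a i * b j = p i j" if "i < n" "j < n" for i j
    using p0[OF that] by (auto simp: q_def)
  have row: "(\<Sum>j<n. q i j * b j) = 1" if "i < n" for i
  proof (cases "a i = 0")
    case True then show ?thesis by (simp add: q_def sum1)
  next
    case False
    have "(\<Sum>j<n. q i j * b j) = (\<Sum>j<n. p i j / a i)"
      using qab[OF that] False by (intro sum.cong) (auto simp: field_simps)
    then show ?thesis using p(2)[OF that] False by (simp add: sum_divide_distrib[symmetric])
  qed
  have column: "(\<Sum>i<n. q i j * a i) = 1" if "j < n" for j
  proof (cases "b j = 0")
    case True then show ?thesis by (simp add: q_def sum1)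
  next
    case False
    have "(\<Sum>i<n. q i j * a i) = (\<Sum>i<n. p i j / b j)"
      using qab[OF _ that] False by (intro sum.cong) (auto simp: field_simps)
    then show ?thesis using p(3)[OF that] False by (simp add: sum_divide_distrib[symmetric])
  qed
  define \<rho> where "\<rho> x y = ennreal (q (\<kappa> x) (\<kappa> y))" for x y
  show ?thesis
  proof (rule that[of \<rho>])
    show meas[measurable]: "(\<lambda>(x, y). \<rho> x y) \<in> borel_measurable (borel \<Otimes>\<^sub>M borel)"
    proof -
      have "(\<lambda>x. (\<kappa> (fst x), \<kappa> (snd x))) \<in> borel \<Otimes>\<^sub>M borel \<rightarrow>\<^sub>M count_space UNIV \<Otimes>\<^sub>M count_space UNIV"
        by measurable
      then have "(\<lambda>x. (\<kappa> (fst x), \<kappa> (snd x))) \<in> borel \<Otimes>\<^sub>M borel \<rightarrow>\<^sub>M count_space UNIV"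
        by (simp add: pair_measure_countable)
      from measurable_compose[OF this, of "\<lambda>(i, j). ennreal (q i j)" borel] show ?thesis
        by (simp add: \<rho>_def split_beta')
    qed
    show r1: "(\<integral>\<^sup>+y. \<rho> x y \<partial>\<nu>) = 1" for x
    proof -
      have "(\<integral>\<^sup>+y. \<rho> x y \<partial>\<nu>) = (\<Sum>j<n. ennreal (q (\<kappa> x) j) * ennreal (b j))"
        unfolding \<rho>_def by (rule part\<nu>)
      also have "\<dots> = ennreal (\<Sum>j<n. q (\<kappa> x) j * b j)"
        using q0 ab by (simp add: ennreal_mult'[symmetric] sum_ennreal)
      finally show ?thesis using row[OF lt] by simp
    qed
    show r2: "(\<integral>\<^sup>+x. \<rho> x y \<partial>\<mu>) = 1" for y
    proof -
      have "(\<integral>\<^sup>+x. \<rho> x y \<partial>\<mu>) = (\<Sum>i<n. ennreal (q i (\<kappa> y)) * ennreal (a i))"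
        unfolding \<rho>_def by (rule part\<mu>)
      also have "\<dots> = ennreal (\<Sum>i<n. q i (\<kappa> y) * a i)"
        using q0 ab by (simp add: ennreal_mult'[symmetric] sum_ennreal)
      finally show ?thesis using column[OF lt] by simp
    qed
    have \<rho>y[measurable]: "\<rho> x \<in> borel_measurable borel" "(\<lambda>x. \<rho> x y) \<in> borel_measurable borel"
      for x y
      unfolding \<rho>_def by measurable
    have "(\<integral>\<^sup>+x. \<integral>\<^sup>+y. \<rho> x y * ennreal (dist x y) \<partial>\<nu> \<partial>\<mu>)
      \<le> (\<integral>\<^sup>+x. \<integral>\<^sup>+y. ennreal (\<theta> x) * \<rho> x y + (\<rho> x y * ennreal (c (\<kappa> x) (\<kappa> y)) + ennreal (\<theta> y) * \<rho> x y)
          \<partial>\<nu> \<partial>\<mu>)"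
    proof (intro nn_integral_mono)
      fix x y
      have "dist x y \<le> \<theta> x + (c (\<kappa> x) (\<kappa> y) + \<theta> y)"
        using dist_triangle[of x y "z (\<kappa> x)"] dist_triangle[of "z (\<kappa> x)" y "z (\<kappa> y)"]
        by (simp add: \<theta>_def c_def dist_commute)
      then have "ennreal (dist x y) \<le> ennreal (\<theta> x) + (ennreal (c (\<kappa> x) (\<kappa> y)) + ennreal (\<theta> y))"
        by (simp add: \<theta>_def c_def flip: ennreal_plus)
      then have "\<rho> x y * ennreal (dist x y)
          \<le> \<rho> x y * (ennreal (\<theta> x) + (ennreal (c (\<kappa> x) (\<kappa> y)) + ennreal (\<theta> y)))"
        by (intro mult_left_mono) auto
      then show "\<rho> x y * ennreal (dist x y)
          \<le> ennreal (\<theta> x) * \<rho> x y + (\<rho> x y * ennreal (c (\<kappa> x) (\<kappa> y)) + ennreal (\<theta> y) * \<rho> x y)"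
        by (simp add: distrib_left mult.commute)
    qed
    also have "\<dots> = (\<integral>\<^sup>+x. ennreal (\<theta> x) + ((\<integral>\<^sup>+y. \<rho> x y * ennreal (c (\<kappa> x) (\<kappa> y)) \<partial>\<nu>)
        + (\<integral>\<^sup>+y. ennreal (\<theta> y) * \<rho> x y \<partial>\<nu>)) \<partial>\<mu>)"
    proof (intro nn_integral_cong)
      fix x
      have m: "(\<lambda>y. \<rho> x y * ennreal (c (\<kappa> x) (\<kappa> y))) \<in> borel_measurable \<nu>"
        unfolding \<rho>_def by measurable
      show "(\<integral>\<^sup>+y. ennreal (\<theta> x) * \<rho> x y + (\<rho> x y * ennreal (c (\<kappa> x) (\<kappa> y)) + ennreal (\<theta> y)
          * \<rho> x y) \<partial>\<nu>)
        = ennreal (\<theta> x) + ((\<integral>\<^sup>+y. \<rho> x y * ennreal (c (\<kappa> x) (\<kappa> y)) \<partial>\<nu>) + (\<integral>\<^sup>+y. ennreal (\<theta> y) * \<rho> x y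
            \<partial>\<nu>))"
        using m by (simp add: nn_integral_add nn_integral_cmult r1)
    qed
    also have "\<dots> = (\<integral>\<^sup>+x. ennreal (\<theta> x) \<partial>\<mu>) + ((\<integral>\<^sup>+x. \<integral>\<^sup>+y. \<rho> x y * ennreal (c (\<kappa> x) (\<kappa> y)) \<partial>\<nu> \<partial>\<mu>)
        + (\<integral>\<^sup>+x. \<integral>\<^sup>+y. ennreal (\<theta> y) * \<rho> x y \<partial>\<nu> \<partial>\<mu>))"
    proof -
      have "(\<lambda>x. \<integral>\<^sup>+y. \<rho> x y * ennreal (c (\<kappa> x) (\<kappa> y)) \<partial>\<nu>)
          = (\<lambda>x. \<Sum>j<n. ennreal (q (\<kappa> x) j) * ennreal (c (\<kappa> x) j) * ennreal (b j))"
        unfolding \<rho>_def by (intro ext part\<nu>)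
      then have [measurable]: "(\<lambda>x. \<integral>\<^sup>+y. \<rho> x y * ennreal (c (\<kappa> x) (\<kappa> y)) \<partial>\<nu>) \<in> borel_measurable \<mu>"
        by simp measurable
      have [measurable]: "(\<lambda>x. \<integral>\<^sup>+y. ennreal (\<theta> y) * \<rho> x y \<partial>\<nu>) \<in> borel_measurable \<mu>"
        by (intro \<nu>.borel_measurable_nn_integral) measurable
      show ?thesis by (simp add: nn_integral_add)
    qed
    also have "(\<integral>\<^sup>+x. \<integral>\<^sup>+y. ennreal (\<theta> y) * \<rho> x y \<partial>\<nu> \<partial>\<mu>) = (\<integral>\<^sup>+y. ennreal (\<theta> y) \<partial>\<nu>)"
    proof -
      interpret pair_sigma_finite \<mu> \<nu> ..
      have "(\<lambda>(x, y). ennreal (\<theta> y) * \<rho> x y) \<in> borel_measurable (\<mu> \<Otimes>\<^sub>M \<nu>)" by measurable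
      from Fubini'[OF this] show ?thesis by (simp add: nn_integral_cmult r2)
    qed
    also have "(\<integral>\<^sup>+x. \<integral>\<^sup>+y. \<rho> x y * ennreal (c (\<kappa> x) (\<kappa> y)) \<partial>\<nu> \<partial>\<mu>)
        = (\<Sum>i<n. (\<Sum>j<n. ennreal (q i j) * ennreal (c i j) * ennreal (b j)) * ennreal (a i))"
      unfolding \<rho>_def part\<nu>[of "\<lambda>j. ennreal (q _ j) * ennreal (c _ j)"] by (rule part\<mu>)
    also have "\<dots> = ennreal (\<Sum>i<n. \<Sum>j<n. p i j * c i j)"
    proof -
      have "(\<Sum>j<n. ennreal (q i j) * ennreal (c i j) * ennreal (b j)) * ennreal (a i)
          = ennreal (\<Sum>j<n. p i j * c i j)"
        if "i < n" for i
      proof -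
        have "(\<Sum>j<n. ennreal (q i j) * ennreal (c i j) * ennreal (b j)) * ennreal (a i)
            = (\<Sum>j<n. ennreal (q i j * a i * b j * c i j))"
          unfolding sum_distrib_right
          using q0 ab c0 by (intro sum.cong refl)
              (simp add: ennreal_mult mult.assoc mult.left_commute mult.commute)
        also have "\<dots> = (\<Sum>j<n. ennreal (p i j * c i j))" using qab[OF that] by (intro sum.cong) auto
        also have "\<dots> = ennreal (\<Sum>j<n. p i j * c i j)" using p(1) c0 by (intro sum_ennreal) auto
        finally show ?thesis .
      qed
      then have "(\<Sum>i<n. (\<Sum>j<n. ennreal (q i j) * ennreal (c i j) * ennreal (b j)) * ennreal (a i))
          = (\<Sum>i<n. ennreal (\<Sum>j<n. p i j * c i j))"
        by (intro sum.cong) auto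
      also have "\<dots> = ennreal (\<Sum>i<n. \<Sum>j<n. p i j * c i j)"
        using p(1) by (intro sum_ennreal sum_nonneg) (auto simp: c_def)
      finally show ?thesis .
    qed
    also have "(\<integral>\<^sup>+x. ennreal (\<theta> x) \<partial>\<mu>) + (ennreal (\<Sum>i<n. \<Sum>j<n. p i j * c i j)
        + (\<integral>\<^sup>+y. ennreal (\<theta> y) \<partial>\<nu>))
      \<le> ennreal (e / 4) + (ennreal (\<Sum>i<n. \<Sum>j<n. p i j * c i j) + ennreal (e / 4))"
      by (intro add_mono \<theta>_nn \<mu> \<nu> \<theta>\<mu> \<theta>\<nu> order_refl)
    also have "\<dots> \<le> ennreal (B + e)"
    proof -
      have "0 \<le> (\<Sum>i<n. \<Sum>j<n. p i j * c i j)" using p(1) by (intro sum_nonneg) (auto simp: c_def)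
      then show ?thesis using e p(4) by (simp flip: ennreal_plus)
    qed
    finally show "(\<integral>\<^sup>+x. \<integral>\<^sup>+y. \<rho> x y * ennreal (dist x y) \<partial>\<nu> \<partial>\<mu>) \<le> ennreal (B + e)" .
  qed
qed

section \<open>Kantorovich duality for the Wasserstein distance\<close>

lemma prob_algebraD:
  assumes "M \<in> space (prob_algebra N)" shows "prob_space M" "sets M = sets N" "space M = space N"
  using assms sets_eq_imp_space_eq[of M N] by (auto simp: space_prob_algebra)

text \<open>
The nontrivial half of Kantorovich duality: the density of \<open>transport_density\<close> defines a coupling
whose cost exceeds the dual bound as little as desired.
\<close>
lemma wasserstein_le:
  fixes \<mu> \<nu> :: "'a::polish_space measure"
  assumes \<mu>: "\<mu> \<in> space (prob_algebra borel)" and \<nu>: "\<nu> \<in> space (prob_algebra borel)"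
    and D: "\<And>x y::'a. dist x y \<le> D" and B: "0 \<le> B"
    and dual: "\<And>f::'a \<Rightarrow> real. 1-lipschitz_on UNIV f \<Longrightarrow> (\<integral>x. f x \<partial>\<mu>) - (\<integral>x. f x \<partial>\<nu>) \<le> B"
  shows "wasserstein \<mu> \<nu> \<le> B"
proof (rule field_le_epsilon)
  fix e :: real assume e: "0 < e"
  interpret \<mu>: prob_space \<mu> by (rule prob_algebraD[OF \<mu>])
  interpret \<nu>: prob_space \<nu> by (rule prob_algebraD[OF \<nu>])
  note [measurable_cong] = prob_algebraD(2)[OF \<mu>] prob_algebraD(2)[OF \<nu>]
  have sp: "space \<mu> = UNIV" "space \<nu> = UNIV" using prob_algebraD(3)[OF \<mu>] prob_algebraD(3)[OF \<nu>]
    by auto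
  interpret pair_sigma_finite \<mu> \<nu> ..
  obtain \<rho> :: "'a \<Rightarrow> 'a \<Rightarrow> ennreal"
    where [measurable]: "(\<lambda>(x, y). \<rho> x y) \<in> borel_measurable (borel \<Otimes>\<^sub>M borel)"
    and r: "\<And>x. (\<integral>\<^sup>+y. \<rho> x y \<partial>\<nu>) = 1" and c: "\<And>y. (\<integral>\<^sup>+x. \<rho> x y \<partial>\<mu>) = 1"
    and cost: "(\<integral>\<^sup>+x. \<integral>\<^sup>+y. \<rho> x y * ennreal (dist x y) \<partial>\<nu> \<partial>\<mu>) \<le> ennreal (B + e)"
    using transport_density[OF \<mu> \<nu> D dual e] by blast
  define \<pi> where "\<pi> = density (\<mu> \<Otimes>\<^sub>M \<nu>) (\<lambda>(x, y). \<rho> x y)"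
  have sets: "sets \<pi> = sets (borel \<Otimes>\<^sub>M borel)" unfolding \<pi>_def
    by (simp cong: sets_pair_measure_cong add: prob_algebraD(2)[OF \<mu>] prob_algebraD(2)[OF \<nu>])
  note [measurable_cong] = sets
  have nn: "(\<integral>\<^sup>+z. g z \<partial>\<pi>) = (\<integral>\<^sup>+x. \<integral>\<^sup>+y. \<rho> x y * g (x, y) \<partial>\<nu> \<partial>\<mu>)"
    if [measurable]: "g \<in> borel_measurable (borel \<Otimes>\<^sub>M borel)" for g
  proof -
    have "(\<integral>\<^sup>+z. g z \<partial>\<pi>) = (\<integral>\<^sup>+z. (case z of (x, y) \<Rightarrow> \<rho> x y) * g z \<partial>(\<mu> \<Otimes>\<^sub>M \<nu>))"
      unfolding \<pi>_def by (rule nn_integral_density) measurable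
    also have "\<dots> = (\<integral>\<^sup>+x. \<integral>\<^sup>+y. \<rho> x y * g (x, y) \<partial>\<nu> \<partial>\<mu>)"
      by (subst \<nu>.nn_integral_fst[symmetric]) auto
    finally show ?thesis .
  qed
  have \<rho>y[measurable]: "\<rho> x \<in> borel_measurable borel" "(\<lambda>x. \<rho> x y) \<in> borel_measurable borel" for x y
    by measurable
  have "emeasure (distr \<pi> borel fst) A = emeasure \<mu> A" if [measurable]: "A \<in> sets borel" for A
  proof -
    have "emeasure (distr \<pi> borel fst) A = (\<integral>\<^sup>+z. indicator A (fst z) \<partial>\<pi>)"
      by (subst nn_integral_distr[symmetric, of fst \<pi> borel]) auto
    also have "\<dots> = (\<integral>\<^sup>+x. \<integral>\<^sup>+y. indicator A x * \<rho> x y \<partial>\<nu> \<partial>\<mu>)"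
      by (subst nn) (auto simp: mult.commute)
    also have "\<dots> = (\<integral>\<^sup>+x. indicator A x \<partial>\<mu>)"
      by (intro nn_integral_cong) (simp add: nn_integral_cmult r)
    finally show ?thesis by simp
  qed
  then have fst: "distr \<pi> borel fst = \<mu>" by (intro measure_eqI) (auto simp: prob_algebraD(2)[OF \<mu>])
  have "emeasure (distr \<pi> borel snd) A = emeasure \<nu> A" if [measurable]: "A \<in> sets borel" for A
  proof -
    have "emeasure (distr \<pi> borel snd) A = (\<integral>\<^sup>+z. indicator A (snd z) \<partial>\<pi>)"
      by (subst nn_integral_distr[symmetric, of snd \<pi> borel]) auto
    also have "\<dots> = (\<integral>\<^sup>+x. \<integral>\<^sup>+y. indicator A y * \<rho> x y \<partial>\<nu> \<partial>\<mu>)"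
      by (subst nn) (auto simp: mult.commute)
    also have "\<dots> = (\<integral>\<^sup>+y. \<integral>\<^sup>+x. indicator A y * \<rho> x y \<partial>\<mu> \<partial>\<nu>)"
      by (rule Fubini'[symmetric]) measurable
    also have "\<dots> = (\<integral>\<^sup>+x. indicator A x \<partial>\<nu>)"
      by (intro nn_integral_cong) (simp add: nn_integral_cmult c)
    finally show ?thesis by simp
  qed
  then have snd: "distr \<pi> borel snd = \<nu>" by (intro measure_eqI) (auto simp: prob_algebraD(2)[OF \<nu>])
  have "prob_space (distr \<pi> borel fst)" unfolding fst by (rule \<mu>.prob_space_axioms)
  then have "prob_space \<pi>" by (rule prob_space_distrD[rotated]) simp
  then have \<pi>: "\<pi> \<in> measure_couplings \<mu> \<nu>"
    unfolding measure_couplings_def using fst snd sets by (simp add: space_prob_algebra)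
  have "(\<integral>p. dist (fst p) (snd p) \<partial>\<pi>) \<le> B + e"
  proof (rule integral_real_bounded)
    show "(\<integral>\<^sup>+p. ennreal (dist (fst p) (snd p)) \<partial>\<pi>) \<le> ennreal (B + e)"
      using cost by (subst nn) auto
  qed (use B e in auto)
  moreover have "wasserstein \<mu> \<nu> \<le> (\<integral>p. dist (fst p) (snd p) \<partial>\<pi>)"
    unfolding wasserstein_def
      by (rule cINF_lower[OF _ \<pi>]) (auto intro!: bdd_belowI2[of _ 0]
        Bochner_Integration.integral_nonneg)
  ultimately show "wasserstein \<mu> \<nu> \<le> B + e" by linarith
qed

lemma product_coupling:
  assumes \<mu>: "\<mu> \<in> space (prob_algebra borel)" and \<nu>: "\<nu> \<in> space (prob_algebra borel)"
  shows "\<mu> \<Otimes>\<^sub>M \<nu> \<in> measure_couplings \<mu> \<nu>"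
proof -
  interpret \<mu>: prob_space \<mu> by (rule prob_algebraD[OF \<mu>])
  interpret \<nu>: prob_space \<nu> by (rule prob_algebraD[OF \<nu>])
  interpret pair_prob_space \<mu> \<nu> ..
  have "distr (\<mu> \<Otimes>\<^sub>M \<nu>) borel fst = distr (\<mu> \<Otimes>\<^sub>M \<nu>) \<mu> fst" "distr (\<mu> \<Otimes>\<^sub>M \<nu>) borel snd
      = distr (\<mu> \<Otimes>\<^sub>M \<nu>) \<nu> snd"
    by (auto intro!: distr_cong simp: prob_algebraD(2)[OF \<mu>] prob_algebraD(2)[OF \<nu>])
  moreover have "distr (\<mu> \<Otimes>\<^sub>M \<nu>) \<mu> fst = \<mu>" by (rule \<nu>.distr_pair_fst)
  moreover have "distr (\<mu> \<Otimes>\<^sub>M \<nu>) \<nu> snd = \<nu>"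
  proof (rule measure_eqI)
    fix A assume "A \<in> sets (distr (\<mu> \<Otimes>\<^sub>M \<nu>) \<nu> snd)"
    then have A: "A \<in> sets \<nu>" by simp
    have "snd -` A \<inter> space (\<mu> \<Otimes>\<^sub>M \<nu>) = space \<mu> \<times> A"
      using sets.sets_into_space[OF A] by (auto simp: space_pair_measure)
    then show "emeasure (distr (\<mu> \<Otimes>\<^sub>M \<nu>) \<nu> snd) A = emeasure \<nu> A"
      using A by (simp add: emeasure_distr \<nu>.emeasure_pair_measure_Times \<mu>.emeasure_space_1)
  qed simp
  moreover have "sets (\<mu> \<Otimes>\<^sub>M \<nu>) = sets (borel \<Otimes>\<^sub>M borel)"
    by (intro sets_pair_measure_cong prob_algebraD[OF \<mu>] prob_algebraD[OF \<nu>])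
  ultimately show ?thesis
    unfolding measure_couplings_def using prob_space_axioms by (simp add: space_prob_algebra)
qed

text \<open>
The easy half of Kantorovich duality, in a form with two different integrands and an additive
constant, which suits quotients of integrals.
\<close>
lemma integral_coupling_diff_le:
  fixes f :: "'a::polish_space \<Rightarrow> real"
  assumes \<mu>: "\<mu> \<in> space (prob_algebra borel)" and \<nu>: "\<nu> \<in> space (prob_algebra borel)"
    and D: "\<And>x y::'a. dist x y \<le> D" and F: "l-lipschitz_on UNIV f" and G: "m-lipschitz_on UNIV g"
    and fg: "\<And>x y. f x - g y \<le> c * dist x y + b" and c: "0 \<le> c"
  shows "(\<integral>x. f x \<partial>\<mu>) - (\<integral>x. g x \<partial>\<nu>) \<le> c * wasserstein \<mu> \<nu> + b"
proof -
  have *: "(\<integral>x. f x \<partial>\<mu>) - (\<integral>x. g x \<partial>\<nu>) \<le> c * (\<integral>p. dist (fst p) (snd p) \<partial>\<pi>) + b"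
    if "\<pi> \<in> measure_couplings \<mu> \<nu>" for \<pi>
  proof -
    have \<pi>: "\<pi> \<in> space (prob_algebra (borel \<Otimes>\<^sub>M borel))" and fst: "distr \<pi> borel fst = \<mu>"
      and snd: "distr \<pi> borel snd = \<nu>"
      using that by (auto simp: measure_couplings_def)
    interpret \<pi>: prob_space \<pi> by (rule prob_algebraD[OF \<pi>])
    note [measurable_cong] = prob_algebraD(2)[OF \<pi>]
    have [measurable]: "f \<in> borel_measurable borel" "g \<in> borel_measurable borel"
      using F G by (auto intro: lipschitz_borel_measurable)
    have i: "integrable \<pi> (\<lambda>p. f (fst p))" "integrable \<pi> (\<lambda>p. g (snd p))"
        "integrable \<pi> (\<lambda>p. dist (fst p) (snd p))"
      by (rule integrable_bounded_borel[OF \<pi> _ lipschitz_bounded[OF D F]], measurable)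
        (rule integrable_bounded_borel[OF \<pi> _ lipschitz_bounded[OF D G]], measurable,
         rule integrable_bounded_borel[OF \<pi>, of _ D], use D in auto)
    have "(\<integral>x. f x \<partial>\<mu>) - (\<integral>x. g x \<partial>\<nu>) = (\<integral>p. f (fst p) \<partial>\<pi>) - (\<integral>p. g (snd p) \<partial>\<pi>)"
      unfolding fst[symmetric] snd[symmetric] by (subst (1 2) integral_distr) auto
    also have "\<dots> = (\<integral>p. f (fst p) - g (snd p) \<partial>\<pi>)" using i by simp
    also have "\<dots> \<le> (\<integral>p. c * dist (fst p) (snd p) + b \<partial>\<pi>)"
      using i fg by (intro integral_mono) auto
    also have "\<dots> = c * (\<integral>p. dist (fst p) (snd p) \<partial>\<pi>) + b" using i by (simp add: \<pi>.prob_space)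
    finally show ?thesis .
  qed
  have ne: "measure_couplings \<mu> \<nu> \<noteq> {}" using product_coupling[OF \<mu> \<nu>] by blast
  show ?thesis
  proof (cases "c = 0")
    case True then show ?thesis using * ne by auto
  next
    case False
    have "((\<integral>x. f x \<partial>\<mu>) - (\<integral>x. g x \<partial>\<nu>) - b) / c \<le> wasserstein \<mu> \<nu>"
      unfolding wasserstein_def using * c False
      by (intro cINF_greatest[OF ne]) (auto simp: field_simps)
    then show ?thesis using c False by (simp add: field_simps)
  qed
qed

lemma lipschitz_integral_diff_le:
  fixes f :: "'a::polish_space \<Rightarrow> real"
  assumes \<mu>: "\<mu> \<in> space (prob_algebra borel)" and \<nu>: "\<nu> \<in> space (prob_algebra borel)"
    and D: "\<And>x y::'a. dist x y \<le> D" and f: "l-lipschitz_on UNIV f"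
  shows "\<bar>(\<integral>x. f x \<partial>\<mu>) - (\<integral>x. f x \<partial>\<nu>)\<bar> \<le> l * wasserstein \<mu> \<nu>"
proof -
  have f': "l-lipschitz_on UNIV (\<lambda>x. - f x)" using f by (rule lipschitz_on_minus)
  have "f x - f y \<le> l * dist x y" "f y - f x \<le> l * dist x y" for x y
    using lipschitz_onD[OF f, of x y] by (auto simp: dist_real_def)
  then have "(\<integral>x. f x \<partial>\<mu>) - (\<integral>x. f x \<partial>\<nu>) \<le> l * wasserstein \<mu> \<nu> + 0"
    "(\<integral>x. - f x \<partial>\<mu>) - (\<integral>x. - f x \<partial>\<nu>) \<le> l * wasserstein \<mu> \<nu> + 0"
    using integral_coupling_diff_le[OF \<mu> \<nu> D f f, of l 0] lipschitz_on_nonneg[OF f]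
      integral_coupling_diff_le[OF \<mu> \<nu> D f' f', of l 0] by auto
  then show ?thesis by simp
qed

lemma wasserstein_nonneg: "0 \<le> wasserstein \<mu> \<nu>"
  if "\<mu> \<in> space (prob_algebra borel)" "\<nu> \<in> space (prob_algebra borel)"
  unfolding wasserstein_def using product_coupling[OF that]
  by (intro cINF_greatest) (auto intro!: Bochner_Integration.integral_nonneg)

lemma wasserstein_le_bound:
  fixes \<mu> \<nu> :: "'a::polish_space measure"
  assumes \<mu>: "\<mu> \<in> space (prob_algebra borel)" and \<nu>: "\<nu> \<in> space (prob_algebra borel)"
    and D: "\<And>x y::'a. dist x y \<le> D"
  shows "wasserstein \<mu> \<nu> \<le> D"
proof (rule wasserstein_le[OF \<mu> \<nu> D])
  show "0 \<le> D" using D[of undefined undefined] by simp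
  fix f :: "'a \<Rightarrow> real" assume f: "1-lipschitz_on UNIV f"
  interpret \<mu>: prob_space \<mu> by (rule prob_algebraD[OF \<mu>])
  interpret \<nu>: prob_space \<nu> by (rule prob_algebraD[OF \<nu>])
  have le: "f x \<le> f y + D" for x y
    using lipschitz_onD[OF f, of x y] D[of x y] by (auto simp: dist_real_def)
  have "(\<integral>x. f x \<partial>\<mu>) \<le> f y + D" for y
    using le by (intro \<mu>.integral_le_const lipschitz_integrable[OF D f \<mu>]) auto
  then have "(\<integral>x. f x \<partial>\<mu>) - D \<le> f y" for y by (simp add: algebra_simps)
  then have "(\<integral>x. f x \<partial>\<mu>) - D \<le> (\<integral>y. f y \<partial>\<nu>)"
    by (intro \<nu>.integral_ge_const lipschitz_integrable[OF D f \<nu>]) auto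
  then show "(\<integral>x. f x \<partial>\<mu>) - (\<integral>x. f x \<partial>\<nu>) \<le> D" by simp
qed

text \<open>
The indicator of a closed set \<open>C\<close> is the decreasing limit of the Lipschitz functions \<open>x \<mapsto> max 0 (1
- k d(x, C))\<close>.
\<close>
lemma measure_eqI_lipschitz:
  fixes \<mu> \<nu> :: "'a::polish_space measure"
  assumes \<mu>: "\<mu> \<in> space (prob_algebra borel)" and \<nu>: "\<nu> \<in> space (prob_algebra borel)"
    and eq: "\<And>f l. l-lipschitz_on UNIV f \<Longrightarrow> (\<integral>x. f x \<partial>\<mu>) = (\<integral>x. f x \<partial>\<nu> :: real)"
  shows "\<mu> = \<nu>"
proof (rule measure_eqI_generator_eq[where E = "Collect closed" and \<Omega> = UNIV and A = "\<lambda>_. UNIV"])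
  show "Int_stable (Collect closed :: 'a set set)" by (auto simp: Int_stable_def)
  show "sets \<mu> = sigma_sets UNIV (Collect closed)" "sets \<nu> = sigma_sets UNIV (Collect closed)"
    using prob_algebraD(2)[OF \<mu>] prob_algebraD(2)[OF \<nu>] by (simp_all add: borel_eq_closed)
  interpret \<mu>: prob_space \<mu> by (rule prob_algebraD[OF \<mu>])
  interpret \<nu>: prob_space \<nu> by (rule prob_algebraD[OF \<nu>])
  show "emeasure \<mu> UNIV \<noteq> \<infinity>" by simp
  fix C :: "'a set" assume "C \<in> Collect closed"
  then have C: "closed C" by simp
  show "emeasure \<mu> C = emeasure \<nu> C"
  proof (cases "C = {}")
    case False
    define f where "f k x = max 0 (1 - real k * infdist x C)" for k x
    have f_lip: "(real k)-lipschitz_on UNIV (f k)" for k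
    proof (rule lipschitz_onI)
      fix x y
      have "\<bar>f k x - f k y\<bar> \<le> \<bar>real k * infdist x C - real k * infdist y C\<bar>" unfolding f_def
        by linarith
      also have "\<dots> = real k * \<bar>infdist x C - infdist y C\<bar>"
        by (simp add: abs_mult right_diff_distrib[symmetric])
      also have "\<dots> \<le> real k * dist x y" by (intro mult_left_mono infdist_triangle_abs) auto
      finally show "dist (f k x) (f k y) \<le> real k * dist x y" by (simp add: dist_real_def)
    qed simp
    have lim: "(\<lambda>k. f k x) \<longlonglongrightarrow> indicator C x" for x
    proof (cases "x \<in> C")
      case True then show ?thesis by (simp add: f_def)
    next
      case x: False
      then have "0 < infdist x C"
        using C False in_closed_iff_infdist_zero[OF C False, of x] infdist_nonneg[of x C]
        by linarith
      then obtain N where "1 < real N * infdist x C" using reals_Archimedean3 by blast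
      then have "f k x = 0" if "k \<ge> N" for k
      proof -
        have "real N * infdist x C \<le> real k * infdist x C" using that infdist_nonneg
          by (intro mult_right_mono) auto
        then show ?thesis using \<open>1 < real N * infdist x C\<close> by (simp add: f_def)
      qed
      then have "eventually (\<lambda>k. f k x = indicator C x) sequentially"
        using x by (auto simp: eventually_sequentially)
      then show ?thesis by (rule tendsto_eventually)
    qed
    have f_le_1: "\<bar>f k x\<bar> \<le> 1" for k x by (auto simp: f_def infdist_nonneg)
    have conv: "(\<lambda>k. \<integral>x. f k x \<partial>M) \<longlonglongrightarrow> measure M C" if M: "M \<in> space (prob_algebra borel)" for M
    proof -
      interpret M: prob_space M by (rule prob_algebraD[OF M])
      have [measurable]: "f k \<in> borel_measurable M" for k
        using lipschitz_borel_measurable[OF f_lip] prob_algebraD(2)[OF M]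
          by (simp cong: measurable_cong_sets)
      have Cm: "C \<in> sets M" using C prob_algebraD(2)[OF M] by simp
      have "(\<lambda>k. \<integral>x. f k x \<partial>M) \<longlonglongrightarrow> (\<integral>x. indicator C x \<partial>M)"
        by (rule integral_dominated_convergence[where w = "\<lambda>_. 1"])
           (use lim Cm f_le_1 in auto)
      then show ?thesis using Cm by simp
    qed
    have "measure \<mu> C = measure \<nu> C"
      using conv[OF \<mu>] conv[OF \<nu>] eq[OF f_lip] by (metis LIMSEQ_unique ext)
    then show ?thesis by (simp add: \<mu>.emeasure_eq_measure \<nu>.emeasure_eq_measure)
  qed simp
qed auto

lemma wasserstein_eq_0D:
  fixes \<mu> \<nu> :: "'a::polish_space measure"
  assumes \<mu>: "\<mu> \<in> space (prob_algebra borel)" and \<nu>: "\<nu> \<in> space (prob_algebra borel)"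
    and D: "\<And>x y::'a. dist x y \<le> D" and 0: "wasserstein \<mu> \<nu> \<le> 0"
  shows "\<mu> = \<nu>"
proof (rule measure_eqI_lipschitz[OF \<mu> \<nu>])
  fix f :: "'a \<Rightarrow> real" and l assume f: "l-lipschitz_on UNIV f"
  have "l * wasserstein \<mu> \<nu> \<le> 0" using 0 lipschitz_on_nonneg[OF f] by (simp add: mult_nonneg_nonpos)
  then show "(\<integral>x. f x \<partial>\<mu>) = (\<integral>x. f x \<partial>\<nu>)" using lipschitz_integral_diff_le[OF \<mu> \<nu> D f] by linarith
qed

section \<open>Convergence of Wasserstein-Cauchy sequences\<close>

lemma Cauchy_if_summable_dist:
  fixes y :: "nat \<Rightarrow> 'a::metric_space"
  assumes "summable (\<lambda>n. dist (y n) (y (Suc n)))"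
  shows "Cauchy y"
proof (rule metric_CauchyI)
  fix e :: real assume "0 < e"
  then obtain N where N: "\<And>m n. m \<ge> N \<Longrightarrow> norm (\<Sum>k\<in>{m..<n}. dist (y k) (y (Suc k))) < e"
    using assms unfolding summable_Cauchy by blast
  have le: "dist (y m) (y n) \<le> (\<Sum>k\<in>{m..<n}. dist (y k) (y (Suc k)))" if "m \<le> n" for m n
    using that
  proof (induction n rule: dec_induct)
    case (step n)
    then show ?case using dist_triangle[of "y m" "y (Suc n)" "y n"] by simp
  qed simp
  have "dist (y m) (y n) < e" if "m \<ge> N" "m \<le> n" for m n
    using le[OF that(2)] N[OF that(1), of n] by simp
  then show "\<exists>N. \<forall>m\<ge>N. \<forall>n\<ge>N. dist (y m) (y n) < e"
    by (metis dist_commute linear)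
qed

context Ionescu_Tulcea
begin

lemma nn_integral_lim:
  assumes f[measurable]: "f \<in> borel_measurable (PiM {0..<n} M)"
  shows "(\<integral>\<^sup>+x. f (restrict x {0..<n}) \<partial>PF.lim) = (\<integral>\<^sup>+x. f x \<partial>C 0 n (\<lambda>_. undefined))"
proof -
  have up: "up_to {0..<n} = n"
    using up_to_iff_Ico[of "{0..<n}" n] up_to[of "{0..<n}"] by (cases n) (auto intro: antisym)
  have u: "(\<lambda>_. undefined) \<in> space (PiM {0..<0::nat} M)" by (simp add: space_PiM)
  have "(\<integral>\<^sup>+x. f (restrict x {0..<n}) \<partial>PF.lim)
      = (\<integral>\<^sup>+x. f x \<partial>distr PF.lim (PiM {0..<n} M) (\<lambda>x. restrict x {0..<n}))"
    by (subst nn_integral_distr)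
       (auto simp: measurable_cong_sets[OF PF.sets_lim refl] intro!: measurable_restrict_subset)
  also have "distr PF.lim (PiM {0..<n} M) (\<lambda>x. restrict x {0..<n}) = CI {0..<n}"
    by (rule distr_lim) simp
  also have "CI {0..<n} = C 0 n (\<lambda>_. undefined)"
    unfolding CI_def up using distr_C[of n n "\<lambda>_. undefined" 0] u by simp
  finally show ?thesis .
qed

end

text \<open>
The density \<open>\<rho> n\<close> of a nearly optimal plan between \<open>\<mu> n\<close> and \<open>\<mu> (Suc n)\<close> yields the kernel \<open>x \<mapsto> \<rho>
n x \<cdot> \<mu> (Suc n)\<close>; \<open>Q\<close> is the law of the Markov chain with these kernels started from \<open>\<mu> 0\<close>.
\<close>
lemma coupled_sequence_exists:
  fixes \<mu> :: "nat \<Rightarrow> 'a::polish_space measure" and b :: "nat \<Rightarrow> real"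
  assumes \<mu>: "\<And>n. \<mu> n \<in> space (prob_algebra borel)"
    and D: "\<And>x y::'a. dist x y \<le> D"
    and dual: "\<And>n (f :: 'a \<Rightarrow> real). 1-lipschitz_on UNIV f \<Longrightarrow> (\<integral>x. f x \<partial>\<mu> n) - (\<integral>x. f x \<partial>\<mu> (Suc n))
        \<le> b n"
    and e: "\<And>n. 0 < e n"
  obtains Q :: "(nat \<Rightarrow> 'a) measure" where "prob_space Q" "sets Q = sets (PiM UNIV (\<lambda>_. borel))"
    "\<And>n. distr Q borel (\<lambda>\<omega>. \<omega> n) = \<mu> n"
    "\<And>n. (\<integral>\<^sup>+\<omega>. ennreal (dist (\<omega> n) (\<omega> (Suc n))) \<partial>Q) \<le> ennreal (b n + e n)"
proof -
  interpret \<mu>: prob_space "\<mu> n" for n by (rule prob_algebraD[OF \<mu>])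
  note [measurable_cong] = prob_algebraD(2)[OF \<mu>]
  have sp: "space (\<mu> n) = UNIV" for n using prob_algebraD(3)[OF \<mu>] by simp
  define good where "good n \<rho> \<longleftrightarrow> (\<lambda>(x, y). \<rho> x y) \<in> borel_measurable (borel \<Otimes>\<^sub>M borel) \<and>
    (\<forall>x. (\<integral>\<^sup>+y. \<rho> x y \<partial>\<mu> (Suc n)) = 1) \<and> (\<forall>y. (\<integral>\<^sup>+x. \<rho> x y \<partial>\<mu> n) = 1) \<and>
    (\<integral>\<^sup>+x. \<integral>\<^sup>+y. \<rho> x y * ennreal (dist x y) \<partial>\<mu> (Suc n) \<partial>\<mu> n) \<le> ennreal (b n + e n)" for n \<rho>
  have "\<exists>\<rho>. good n \<rho>" for n
    by (rule transport_density[OF \<mu>[of n] \<mu>[of "Suc n"] D dual[where n = n] e[of n]])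
       (assumption | rule exI good_def[THEN iffD2] conjI allI)+
  then obtain \<rho> where good: "\<And>n. good n (\<rho> n)" by metis
  have \<rho>[measurable]: "(\<lambda>(x, y). \<rho> n x y) \<in> borel_measurable (borel \<Otimes>\<^sub>M borel)"
    and r: "(\<integral>\<^sup>+y. \<rho> n x y \<partial>\<mu> (Suc n)) = 1" and c: "(\<integral>\<^sup>+x. \<rho> n x y \<partial>\<mu> n) = 1"
    and cost: "(\<integral>\<^sup>+x. \<integral>\<^sup>+y. \<rho> n x y * ennreal (dist x y) \<partial>\<mu> (Suc n) \<partial>\<mu> n) \<le> ennreal (b n + e n)"
    for n x y using good[of n] by (simp_all add: good_def)
  have \<rho>x[measurable]: "\<rho> n x \<in> borel_measurable borel" "(\<lambda>x. \<rho> n x y) \<in> borel_measurable borel"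
    for n x y
    by measurable
  define \<kappa> where "\<kappa> i x = density (\<mu> (Suc i)) (\<rho> i x)" for i x
  have \<kappa>_prob: "prob_space (\<kappa> i x)" for i x
    by (rule prob_spaceI) (simp add: \<kappa>_def emeasure_density sp r[unfolded sp]
        cong: nn_integral_cong)
  have \<kappa>_sets: "sets (\<kappa> i x) = sets borel" for i x by (simp add: \<kappa>_def prob_algebraD(2)[OF \<mu>])
  have \<kappa>_meas[measurable]: "\<kappa> i \<in> borel \<rightarrow>\<^sub>M subprob_algebra borel" for i
  proof (rule measurable_subprob_algebra)
    show "subprob_space (\<kappa> i x)" for x using \<kappa>_prob by (rule prob_space_imp_subprob_space)
    show "sets (\<kappa> i x) = sets borel" for x by (rule \<kappa>_sets)
    fix A :: "'a set" assume A[measurable]: "A \<in> sets borel"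
    have eq: "emeasure (\<kappa> i x) A = (\<integral>\<^sup>+y. \<rho> i x y * indicator A y \<partial>\<mu> (Suc i))" for x
      unfolding \<kappa>_def by (subst emeasure_density) auto
    show "(\<lambda>x. emeasure (\<kappa> i x) A) \<in> borel_measurable borel"
      unfolding eq by (intro \<mu>.borel_measurable_nn_integral) measurable
  qed
  have nn_\<kappa>: "(\<integral>\<^sup>+y. g y \<partial>\<kappa> i x) = (\<integral>\<^sup>+y. \<rho> i x y * g y \<partial>\<mu> (Suc i))"
    if [measurable]: "g \<in> borel_measurable borel" for i x g
    unfolding \<kappa>_def by (rule nn_integral_density) measurable
  define P where "P i \<omega> = (case i of 0 \<Rightarrow> \<mu> 0 | Suc j \<Rightarrow> \<kappa> j (\<omega> j))" for i :: nat and \<omega> :: "nat \<Rightarrow> 'a"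
  interpret IT: Ionescu_Tulcea P "\<lambda>_. borel :: 'a measure"
  proof (rule Ionescu_Tulcea.intro)
    fix i
    show "P i \<in> PiM {0..<i} (\<lambda>_. borel) \<rightarrow>\<^sub>M subprob_algebra borel"
    proof (cases i)
      case 0
      have "\<mu> 0 \<in> space (subprob_algebra borel)"
        using \<mu>.subprob_space_axioms[of 0]
          by (simp add: space_subprob_algebra prob_algebraD(2)[OF \<mu>])
      then show ?thesis using 0 by (simp add: P_def[abs_def])
    next
      case (Suc j)
      have "(\<lambda>\<omega>. \<omega> j) \<in> PiM {0..<i} (\<lambda>_. borel) \<rightarrow>\<^sub>M borel"
        using Suc by (intro measurable_component_singleton) auto
      from measurable_compose[OF this \<kappa>_meas[of j]] show ?thesis
        using Suc by (simp add: P_def[abs_def])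
    qed
    show "prob_space (P i x)" for x
      using \<kappa>_prob \<mu>.prob_space_axioms by (auto simp: P_def split: nat.split)
  qed
  define u :: "nat \<Rightarrow> 'a" where "u = (\<lambda>_. undefined)"
  have u: "u \<in> space (PiM {0..<0} (\<lambda>_. borel :: 'a measure))" by (simp add: space_PiM u_def)
  have step: "(\<integral>\<^sup>+\<omega>. F \<omega> \<partial>IT.C 0 (Suc n) u) = (\<integral>\<^sup>+\<omega>. \<integral>\<^sup>+y. F (fun_upd \<omega> n y) \<partial>P n \<omega> \<partial>IT.C 0 n u)"
    if F[measurable]: "F \<in> borel_measurable (PiM {0..<Suc n} (\<lambda>_. borel))" for F n
  proof -
    have sC: "sets (IT.C 0 n u) = sets (PiM {0..<n} (\<lambda>_. borel))" using IT.sets_C[OF u, of n]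
      by simp
    have spC: "space (IT.C 0 n u) = space (PiM {0..<n} (\<lambda>_. borel))"
      by (rule sets_eq_imp_space_eq[OF sC])
    have "(\<integral>\<^sup>+\<omega>. F \<omega> \<partial>IT.C 0 (Suc n) u) = (\<integral>\<^sup>+\<omega>. \<integral>\<^sup>+\<omega>'. F \<omega>' \<partial>IT.eP n \<omega> \<partial>IT.C 0 n u)"
      unfolding IT.C.simps add_0
      by (rule nn_integral_bind[OF F]) (unfold measurable_cong_sets[OF sC refl], rule
          IT.measurable_eP)
    also have "\<dots> = (\<integral>\<^sup>+\<omega>. \<integral>\<^sup>+y. F (fun_upd \<omega> n y) \<partial>P n \<omega> \<partial>IT.C 0 n u)"
      by (intro nn_integral_cong IT.nn_integral_eP[OF _ F]) (simp add: spC)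
    finally show ?thesis .
  qed
  have upd: "(\<lambda>\<omega>. \<omega> n) \<in> PiM {0..<Suc n} (\<lambda>_. borel :: 'a measure) \<rightarrow>\<^sub>M borel" for n
    by (intro measurable_component_singleton) auto
  have marg: "(\<integral>\<^sup>+\<omega>. g (\<omega> n) \<partial>IT.C 0 (Suc n) u) = (\<integral>\<^sup>+x. g x \<partial>\<mu> n)"
    if g[measurable]: "g \<in> borel_measurable borel" for g n
    using g
  proof (induction n arbitrary: g)
    case 0
    note [measurable] = 0
    have "(\<integral>\<^sup>+\<omega>. g (\<omega> 0) \<partial>IT.C 0 (Suc 0) u) = (\<integral>\<^sup>+\<omega>. (\<integral>\<^sup>+y. g y \<partial>\<mu> 0) \<partial>IT.C 0 0 u)"
      by (subst step) (auto simp: P_def intro!: measurable_compose[OF upd])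
    also have "\<dots> = (\<integral>\<^sup>+y. g y \<partial>\<mu> 0)" using u by simp
    finally show ?case .
  next
    case (Suc n)
    note [measurable] = Suc.prems
    interpret pair_sigma_finite "\<mu> n" "\<mu> (Suc n)" ..
    have "(\<integral>\<^sup>+\<omega>. g (\<omega> (Suc n)) \<partial>IT.C 0 (Suc (Suc n)) u)
        = (\<integral>\<^sup>+\<omega>. (\<integral>\<^sup>+y. g y \<partial>\<kappa> n (\<omega> n)) \<partial>IT.C 0 (Suc n) u)"
      by (subst step) (auto simp: P_def intro!: measurable_compose[OF upd])
    also have "\<dots> = (\<integral>\<^sup>+x. (\<integral>\<^sup>+y. g y \<partial>\<kappa> n x) \<partial>\<mu> n)"
      by (rule Suc.IH) measurable
    also have "\<dots> = (\<integral>\<^sup>+x. \<integral>\<^sup>+y. \<rho> n x y * g y \<partial>\<mu> (Suc n) \<partial>\<mu> n)"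
      by (simp add: nn_\<kappa>)
    also have "\<dots> = (\<integral>\<^sup>+y. \<integral>\<^sup>+x. \<rho> n x y * g y \<partial>\<mu> n \<partial>\<mu> (Suc n))"
      by (rule Fubini'[symmetric]) measurable
    also have "\<dots> = (\<integral>\<^sup>+y. g y \<partial>\<mu> (Suc n))"
      by (intro nn_integral_cong) (simp add: nn_integral_multc c)
    finally show ?case .
  qed
  define Q where "Q = IT.PF.lim"
  have Q_sets: "sets Q = sets (PiM UNIV (\<lambda>_. borel))" by (simp add: Q_def)
  note [measurable_cong] = Q_sets
  have comp[measurable]: "(\<lambda>\<omega>. \<omega> n) \<in> Q \<rightarrow>\<^sub>M borel" for n
    by (simp add: measurable_cong_sets[OF Q_sets refl])
  have limit: "(\<integral>\<^sup>+\<omega>. F (restrict \<omega> {0..<n}) \<partial>Q) = (\<integral>\<^sup>+\<omega>. F \<omega> \<partial>IT.C 0 n u)"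
    if "F \<in> borel_measurable (PiM {0..<n} (\<lambda>_. borel))" for F n
    unfolding Q_def u_def by (rule IT.nn_integral_lim[OF that])
  have law: "(\<integral>\<^sup>+\<omega>. g (\<omega> n) \<partial>Q) = (\<integral>\<^sup>+x. g x \<partial>\<mu> n)" if g: "g \<in> borel_measurable borel" for g n
    using limit[OF measurable_compose[OF upd g]] marg[OF g] by simp
  have distr: "distr Q borel (\<lambda>\<omega>. \<omega> n) = \<mu> n" for n
  proof (rule measure_eqI)
    fix A assume "A \<in> sets (distr Q borel (\<lambda>\<omega>. \<omega> n))"
    then have A[measurable]: "A \<in> sets borel" by simp
    have "emeasure (distr Q borel (\<lambda>\<omega>. \<omega> n)) A = (\<integral>\<^sup>+\<omega>. indicator A (\<omega> n) \<partial>Q)"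
      by (subst nn_integral_distr[symmetric, of "\<lambda>\<omega>. \<omega> n" Q borel]) auto
    also have "\<dots> = emeasure (\<mu> n) A" by (subst law) auto
    finally show "emeasure (distr Q borel (\<lambda>\<omega>. \<omega> n)) A = emeasure (\<mu> n) A" .
  qed (simp add: prob_algebraD(2)[OF \<mu>])
  have prob: "prob_space Q"
    using \<mu>.prob_space_axioms[of 0] unfolding distr[symmetric] by (rule prob_space_distrD[OF comp])
  have "(\<integral>\<^sup>+\<omega>. ennreal (dist (\<omega> n) (\<omega> (Suc n))) \<partial>Q) \<le> ennreal (b n + e n)" for n
  proof -
    have m: "(\<lambda>\<omega>. ennreal (dist (\<omega> n) (\<omega> (Suc n))))
        \<in> borel_measurable (PiM {0..<Suc (Suc n)} (\<lambda>_. borel :: 'a measure))"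
    proof -
      have [measurable]: "(\<lambda>\<omega>. \<omega> n) \<in> PiM {0..<Suc (Suc n)} (\<lambda>_. borel :: 'a measure) \<rightarrow>\<^sub>M borel"
         "(\<lambda>\<omega>. \<omega> (Suc n)) \<in> PiM {0..<Suc (Suc n)} (\<lambda>_. borel :: 'a measure) \<rightarrow>\<^sub>M borel"
        by (intro measurable_component_singleton; simp)+
      show ?thesis by measurable
    qed
    have "(\<integral>\<^sup>+\<omega>. ennreal (dist (\<omega> n) (\<omega> (Suc n))) \<partial>Q)
        = (\<integral>\<^sup>+\<omega>. ennreal (dist (\<omega> n) (\<omega> (Suc n))) \<partial>IT.C 0 (Suc (Suc n)) u)"
      using limit[OF m] by simp
    also have "\<dots> = (\<integral>\<^sup>+\<omega>. (\<integral>\<^sup>+y. ennreal (dist (\<omega> n) y) \<partial>\<kappa> n (\<omega> n)) \<partial>IT.C 0 (Suc n) u)"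
      by (subst step[OF m]) (simp add: P_def)
    also have "\<dots> = (\<integral>\<^sup>+\<omega>. (\<integral>\<^sup>+y. \<rho> n (\<omega> n) y * ennreal (dist (\<omega> n) y) \<partial>\<mu> (Suc n)) \<partial>IT.C 0 (Suc n) u)"
      by (subst nn_\<kappa>) auto
    also have "\<dots> = (\<integral>\<^sup>+x. (\<integral>\<^sup>+y. \<rho> n x y * ennreal (dist x y) \<partial>\<mu> (Suc n)) \<partial>\<mu> n)"
      by (rule marg) (intro \<mu>.borel_measurable_nn_integral, measurable)
    finally show ?thesis using cost by simp
  qed
  with prob Q_sets distr show ?thesis using that by blast
qed

text \<open>
The coupled sequence has summable expected increments, so it converges almost surely; \<open>\<nu>\<close> is the
law of its limit.
\<close>
lemma wasserstein_complete:
  fixes \<mu> :: "nat \<Rightarrow> 'a::polish_space measure" and b :: "nat \<Rightarrow> real"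
  assumes \<mu>: "\<And>n. \<mu> n \<in> space (prob_algebra borel)"
    and D: "\<And>x y::'a. dist x y \<le> D"
    and dual: "\<And>n (f :: 'a \<Rightarrow> real). 1-lipschitz_on UNIV f \<Longrightarrow> (\<integral>x. f x \<partial>\<mu> n) - (\<integral>x. f x \<partial>\<mu> (Suc n))
        \<le> b n"
    and b: "\<And>n. 0 \<le> b n" "summable b"
  obtains \<nu> where "\<nu> \<in> space (prob_algebra borel)"
    "\<And>f l. l-lipschitz_on UNIV f \<Longrightarrow> (\<lambda>n. \<integral>x. f x \<partial>\<mu> n) \<longlonglongrightarrow> (\<integral>x. f x \<partial>\<nu> :: real)"
proof -
  obtain Q :: "(nat \<Rightarrow> 'a) measure" where Q: "prob_space Q"
    and Q_sets[measurable_cong]: "sets Q = sets (PiM UNIV (\<lambda>_. borel))"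
    and distr: "\<And>n. distr Q borel (\<lambda>\<omega>. \<omega> n) = \<mu> n"
    and cost: "\<And>n. (\<integral>\<^sup>+\<omega>. ennreal (dist (\<omega> n) (\<omega> (Suc n))) \<partial>Q) \<le> ennreal (b n + (1/2) ^ n)"
    by (rule coupled_sequence_exists[where \<mu> = \<mu> and b = b and D = D and e = "\<lambda>n. (1/2) ^ n"])
       (use \<mu> D dual in auto)
  interpret Q: prob_space Q by fact
  have comp[measurable]: "(\<lambda>\<omega>. \<omega> n) \<in> Q \<rightarrow>\<^sub>M borel" for n
    by (simp add: measurable_cong_sets[OF Q_sets refl])
  have sb: "summable (\<lambda>n. b n + (1/2) ^ n)" using b by (intro summable_add summable_geometric) auto
  have "(\<integral>\<^sup>+\<omega>. (\<Sum>n. ennreal (dist (\<omega> n) (\<omega> (Suc n)))) \<partial>Q)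
      = (\<Sum>n. \<integral>\<^sup>+\<omega>. ennreal (dist (\<omega> n) (\<omega> (Suc n))) \<partial>Q)"
    by (rule nn_integral_suminf) measurable
  also have "\<dots> \<le> (\<Sum>n. ennreal (b n + (1/2) ^ n))" by (intro suminf_le cost) auto
  also have "\<dots> = ennreal (\<Sum>n. b n + (1/2) ^ n)" using sb b by (intro suminf_ennreal2) auto
  also have "\<dots> < \<infinity>" by simp
  finally have "AE \<omega> in Q. (\<Sum>n. ennreal (dist (\<omega> n) (\<omega> (Suc n)))) \<noteq> \<infinity>"
    by (intro nn_integral_PInf_AE) auto
  then have conv: "AE \<omega> in Q. Cauchy \<omega>"
  proof eventually_elim
    fix \<omega> :: "nat \<Rightarrow> 'a" assume "(\<Sum>n. ennreal (dist (\<omega> n) (\<omega> (Suc n)))) \<noteq> \<infinity>"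
    then have "summable (\<lambda>n. dist (\<omega> n) (\<omega> (Suc n)))" by (intro summable_suminf_not_top) auto
    then show "Cauchy \<omega>" by (rule Cauchy_if_summable_dist)
  qed
  define Y where "Y \<omega> = (if Cauchy \<omega> then lim \<omega> else undefined)" for \<omega> :: "nat \<Rightarrow> 'a"
  have Y_lim: "\<omega> \<longlonglongrightarrow> Y \<omega>" if "Cauchy \<omega>" for \<omega>
    using that by (simp add: Y_def Cauchy_convergent_iff convergent_LIMSEQ_iff)
  have Y[measurable]: "Y \<in> Q \<rightarrow>\<^sub>M borel"
  proof (rule borel_measurable_LIMSEQ_metric)
    have [measurable]: "Measurable.pred Q Cauchy"
      unfolding pred_def using sets_Collect_Cauchy[of "\<lambda>n \<omega>. \<omega> n" Q] comp by simp
    show "(\<lambda>\<omega>. if Cauchy \<omega> then \<omega> n else undefined) \<in> Q \<rightarrow>\<^sub>M borel" for n by measurable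
    show "(\<lambda>n. if Cauchy \<omega> then \<omega> n else undefined) \<longlonglongrightarrow> Y \<omega>" for \<omega>
      using Y_lim by (cases "Cauchy \<omega>") (auto simp: Y_def)
  qed
  define \<nu> where "\<nu> = distr Q borel Y"
  have \<nu>: "\<nu> \<in> space (prob_algebra borel)"
    unfolding \<nu>_def by (simp add: space_prob_algebra Q.prob_space_distr)
  have "(\<lambda>n. \<integral>x. f x \<partial>\<mu> n) \<longlonglongrightarrow> (\<integral>x. f x \<partial>\<nu>)" if f: "l-lipschitz_on UNIV f" for f :: "'a \<Rightarrow> real" and l
  proof -
    have [measurable]: "f \<in> borel_measurable borel" by (rule lipschitz_borel_measurable[OF f])
    have cont: "isCont f x" for x
      using lipschitz_on_continuous_on[OF f] by (simp add: continuous_on_eq_continuous_at)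
    have "(\<lambda>n. \<integral>\<omega>. f (\<omega> n) \<partial>Q) \<longlonglongrightarrow> (\<integral>\<omega>. f (Y \<omega>) \<partial>Q)"
    proof (rule integral_dominated_convergence[where w = "\<lambda>_. \<bar>f undefined\<bar> + l * D"])
      show "AE \<omega> in Q. (\<lambda>n. f (\<omega> n)) \<longlonglongrightarrow> f (Y \<omega>)"
        using conv by eventually_elim (auto intro: isCont_tendsto_compose[OF cont] Y_lim)
      show "AE \<omega> in Q. norm (f (\<omega> n)) \<le> \<bar>f undefined\<bar> + l * D" for n
        using lipschitz_bounded[OF D f] by auto
    qed auto
    moreover have "(\<integral>x. f x \<partial>\<mu> n) = (\<integral>\<omega>. f (\<omega> n) \<partial>Q)" for n
      unfolding distr[symmetric] by (rule integral_distr) measurable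
    moreover have "(\<integral>x. f x \<partial>\<nu>) = (\<integral>\<omega>. f (Y \<omega>) \<partial>Q)"
      unfolding \<nu>_def by (rule integral_distr) measurable
    ultimately show ?thesis by simp
  qed
  with \<nu> show ?thesis using that by blast
qed

section \<open>Growth of the total mass of a penalized semigroup\<close>

lemma lipschitz_on_times:
  fixes f g :: "'a::metric_space \<Rightarrow> real"
  assumes f: "l-lipschitz_on U f" and g: "m-lipschitz_on U g"
    and A: "\<And>x. x \<in> U \<Longrightarrow> \<bar>f x\<bar> \<le> A" and B: "\<And>x. x \<in> U \<Longrightarrow> \<bar>g x\<bar> \<le> B"
    and nonneg: "0 \<le> A" "0 \<le> B"
  shows "(A * m + l * B)-lipschitz_on U (\<lambda>x. f x * g x)"
proof (rule lipschitz_onI)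
  show "0 \<le> A * m + l * B"
    using lipschitz_on_nonneg[OF f] lipschitz_on_nonneg[OF g] nonneg by simp
  fix x y assume xy: "x \<in> U" "y \<in> U"
  have "\<bar>f x * g x - f y * g y\<bar> = \<bar>f x * (g x - g y) + (f x - f y) * g y\<bar>"
    by (simp add: algebra_simps)
  also have "\<dots> \<le> \<bar>f x\<bar> * \<bar>g x - g y\<bar> + \<bar>f x - f y\<bar> * \<bar>g y\<bar>"
    by (metis abs_mult abs_triangle_ineq)
  also have "\<dots> \<le> A * (m * dist x y) + (l * dist x y) * B"
    using lipschitz_onD[OF f xy] lipschitz_onD[OF g xy] A[OF xy(1)] B[OF xy(2)] nonneg
      lipschitz_on_nonneg[OF f]
    by (intro add_mono mult_mono mult_nonneg_nonneg) (auto simp: dist_real_def)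
  also have "\<dots> = (A * m + l * B) * dist x y" by (simp add: algebra_simps)
  finally show "dist (f x * g x) (f y * g y) \<le> (A * m + l * B) * dist x y"
    by (simp add: dist_real_def)
qed

text \<open>
The properties of the penalized semigroup, restricted to Lipschitz functions, from which its
contraction is deduced. The last two are the consequences of the coupling condition; \<open>r\<close> bounds
the killing rate and \<open>D\<close> the diameter of the space.
\<close>
locale penalized_operators =
  fixes I :: "real set" and T :: "real \<Rightarrow> ('a::metric_space \<Rightarrow> real) \<Rightarrow> 'a \<Rightarrow> real"
    and C \<gamma> r D :: real and K :: "real \<Rightarrow> real"
  assumes dist_le: "\<And>x y::'a. dist x y \<le> D"
    and nat_I: "\<And>n. real n \<in> I"
    and add_I: "\<And>s t. s \<in> I \<Longrightarrow> t \<in> I \<Longrightarrow> s + t \<in> I"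
    and diff_I: "\<And>s t. s \<in> I \<Longrightarrow> t \<in> I \<Longrightarrow> s \<le> t \<Longrightarrow> t - s \<in> I"
    and nonneg_I: "\<And>t. t \<in> I \<Longrightarrow> 0 \<le> t"
    and C_pos: "0 < C" and \<gamma>_pos: "0 < \<gamma>" and r_nonneg: "0 \<le> r"
    and K_nonneg: "\<And>t. 0 \<le> t \<Longrightarrow> 0 \<le> K t"
    and K_mono: "\<And>s t. 0 \<le> s \<Longrightarrow> s \<le> t \<Longrightarrow> K s \<le> K t"
    and T_add: "\<And>t f g l m x. t \<in> I \<Longrightarrow> l-lipschitz_on UNIV f \<Longrightarrow> m-lipschitz_on UNIV g \<Longrightarrow>
      T t (\<lambda>x. f x + g x) x = T t f x + T t g x"
    and T_scale: "\<And>t f l c x. t \<in> I \<Longrightarrow> l-lipschitz_on UNIV f \<Longrightarrow>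
      T t (\<lambda>x. c * f x) x = c * T t f x"
    and T_mono: "\<And>t f g l m x. t \<in> I \<Longrightarrow> l-lipschitz_on UNIV f \<Longrightarrow> m-lipschitz_on UNIV g \<Longrightarrow>
      (\<And>x. f x \<le> g x) \<Longrightarrow> T t f x \<le> T t g x"
    and semigroup: "\<And>s t f l x. s \<in> I \<Longrightarrow> t \<in> I \<Longrightarrow> l-lipschitz_on UNIV f \<Longrightarrow>
      T (s + t) f x = T s (T t f) x"
    and T_zero: "\<And>f l x. l-lipschitz_on UNIV f \<Longrightarrow> T 0 f x = f x"
    and mass_le: "\<And>t x. t \<in> I \<Longrightarrow> T t (\<lambda>_. 1) x \<le> 1"
    and mass_ge: "\<And>t x. t \<in> I \<Longrightarrow> exp (- r * t) \<le> T t (\<lambda>_. 1) x"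
    and lasota_yorke: "\<And>t f l B x y. t \<in> I \<Longrightarrow> l-lipschitz_on UNIV f \<Longrightarrow> (\<And>x. \<bar>f x\<bar> \<le> B) \<Longrightarrow>
      \<bar>T t f x - T t f y\<bar> \<le> (l * C * exp (- \<gamma> * t) * T t (\<lambda>_. 1) x + B * K t) * dist x y"
    and comparison: "\<And>t f l x y. t \<in> I \<Longrightarrow> l-lipschitz_on UNIV f \<Longrightarrow> (\<And>x. 0 \<le> f x) \<Longrightarrow>
      exp (- r * t) * (T t f x - l * C * exp (- \<gamma> * t) * T t (\<lambda>_. 1) x * D) \<le> T t f y"
begin

abbreviation h :: "real \<Rightarrow> 'a \<Rightarrow> real" where "h t \<equiv> T t (\<lambda>_. 1)"

definition M :: "real \<Rightarrow> real" where "M t = (SUP x. h t x)"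

lemma D_nonneg: "0 \<le> D"
  using dist_le[of undefined undefined] by simp

lemma lip_const: "0-lipschitz_on UNIV (\<lambda>_::'a. c::real)"
  by (simp add: lipschitz_on_def)

lemma h_0: "h 0 x = 1"
  by (rule T_zero[OF lip_const])

lemma h_pos: "t \<in> I \<Longrightarrow> 0 < h t x"
  using mass_ge[of t x] exp_gt_zero less_le_trans by blast

lemma lip_bound:
  assumes "l-lipschitz_on UNIV (f :: 'a \<Rightarrow> real)"
  obtains B where "\<And>x. \<bar>f x\<bar> \<le> B" "0 \<le> B"
  using lipschitz_bounded[OF dist_le assms] abs_ge_zero order_trans by blast

lemma h_le_M: "t \<in> I \<Longrightarrow> h t x \<le> M t"
  unfolding M_def by (rule cSUP_upper) (auto intro!: bdd_aboveI2 mass_le)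

lemma M_le: "(\<And>x. h t x \<le> c) \<Longrightarrow> M t \<le> c"
  unfolding M_def by (rule cSUP_least) auto

lemma M_pos: "t \<in> I \<Longrightarrow> 0 < M t"
  using h_le_M h_pos less_le_trans by blast

lemma M_ge: "t \<in> I \<Longrightarrow> exp (- r * t) \<le> M t"
  using h_le_M mass_ge order_trans by blast

lemma M_0: "M 0 = 1"
  unfolding M_def by (simp add: h_0)

lemma T_lipschitz:
  assumes t: "t \<in> I" and f: "l-lipschitz_on UNIV f" and B: "\<And>x. \<bar>f x\<bar> \<le> B"
  shows "(l * C * exp (- \<gamma> * t) * M t + B * K t)-lipschitz_on UNIV (T t f)"
proof (rule lipschitz_onI)
  have l: "0 \<le> l" using f lipschitz_on_nonneg by blast
  have B0: "0 \<le> B" using B[of undefined] by simp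
  have K0: "0 \<le> K t" using K_nonneg nonneg_I t by blast
  show "0 \<le> l * C * exp (- \<gamma> * t) * M t + B * K t"
    using l B0 K0 C_pos M_pos[OF t] by (intro add_nonneg_nonneg mult_nonneg_nonneg) auto
  fix x y
  have "\<bar>T t f x - T t f y\<bar> \<le> (l * C * exp (- \<gamma> * t) * T t (\<lambda>_. 1) x + B * K t) * dist x y"
    by (rule lasota_yorke[OF t f B])
  also have "\<dots> \<le> (l * C * exp (- \<gamma> * t) * M t + B * K t) * dist x y"
    using l C_pos h_le_M[OF t] by (intro mult_right_mono add_right_mono mult_left_mono) auto
  finally show "dist (T t f x) (T t f y) \<le> (l * C * exp (- \<gamma> * t) * M t + B * K t) * dist x y"
    by (simp add: dist_real_def)
qed

lemma T_lip:
  assumes "t \<in> I" "l-lipschitz_on UNIV f" obtains m where "m-lipschitz_on UNIV (T t f)"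
  using lip_bound[OF assms(2)] T_lipschitz[OF assms] by metis

lemma h_lip: assumes "t \<in> I" obtains m where "m-lipschitz_on UNIV (h t)"
  using T_lip[OF assms lip_const] by blast

lemma T_le:
  assumes "t \<in> I" "l-lipschitz_on UNIV f" "\<And>x. f x \<le> B"
  shows "T t f x \<le> B * h t x"
proof -
  have "T t f x \<le> T t (\<lambda>_. B * 1) x"
    using assms lip_const by (intro T_mono) auto
  also have "\<dots> = B * h t x" using assms(1) lip_const T_scale[where f = "\<lambda>_. 1"] by blast
  finally show ?thesis .
qed

lemma T_ge:
  assumes "t \<in> I" "l-lipschitz_on UNIV f" "\<And>x. B \<le> f x"
  shows "B * h t x \<le> T t f x"
proof -
  have "B * h t x = T t (\<lambda>_. B * 1) x"
     using assms(1) lip_const T_scale[where f = "\<lambda>_. 1"] by metis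
  also have "\<dots> \<le> T t f x"
    using assms lip_const by (intro T_mono) auto
  finally show ?thesis .
qed

lemma h_add: "s \<in> I \<Longrightarrow> t \<in> I \<Longrightarrow> h (s + t) x = T s (h t) x"
  by (rule semigroup[OF _ _ lip_const])

lemma h_add_le: "s \<in> I \<Longrightarrow> t \<in> I \<Longrightarrow> h (s + t) x \<le> M t * h s x"
  using h_lip[of t] T_le[of s _ "h t"] h_add h_le_M by metis

lemma h_add_ge: "s \<in> I \<Longrightarrow> t \<in> I \<Longrightarrow> (\<And>y. c \<le> h t y) \<Longrightarrow> c * h s x \<le> h (s + t) x"
  using h_lip[of t] T_ge[of s _ "h t"] h_add by metis

lemma M_add: assumes "s \<in> I" "t \<in> I" shows "M (s + t) \<le> M s * M t"
proof (rule M_le)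
  fix x
  have "h (s + t) x \<le> M t * h s x" using assms h_add_le by blast
  also have "\<dots> \<le> M t * M s" using assms h_le_M M_pos[of t] by (intro mult_left_mono) auto
  finally show "h (s + t) x \<le> M s * M t" by (simp add: mult.commute)
qed

lemma mult_I: "s \<in> I \<Longrightarrow> real n * s \<in> I"
proof (induction n)
  case 0 then show ?case using nat_I[of 0] by simp
next
  case (Suc n) then show ?case using add_I[of s "real n * s"] by (simp add: algebra_simps)
qed

lemma M_power: assumes "s \<in> I" shows "M (real n * s) \<le> M s ^ n"
proof (induction n)
  case 0 then show ?case by (simp add: M_0)
next
  case (Suc n)
  have "M (s + real n * s) \<le> M s * M (real n * s)" using assms mult_I M_add by blast
  also have "\<dots> \<le> M s * M s ^ n" using Suc M_pos[OF assms] by (intro mult_left_mono) auto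
  finally show ?case by (simp add: algebra_simps)
qed

text \<open>
One step of length \<open>s\<close> multiplies the Lipschitz constant by \<open>C e\<^sup>-\<^sup>\<gamma>\<^sup>s M\<^sub>s \<le> 1 / (2 A)\<close> and adds \<open>K\<^sub>s\<close>
times the current maximum, which the assumption \<open>rec\<close> bounds by a geometric sequence of ratio \<open>1 /
A\<close>.
\<close>
lemma record_lipschitz:
  assumes s: "s \<in> I" and A: "0 < A" and b: "C * exp (- \<gamma> * s) * M s * A \<le> 1 / 2"
    and rec: "\<And>j. j \<le> n \<Longrightarrow> M (real j * s) \<le> A ^ (n - j) * M (real n * s)"
    and j: "j \<le> n"
  shows "(2 * K s * A * A ^ (n - j) * M (real n * s))-lipschitz_on UNIV (h (real j * s))"
  using j
proof (induction j)
  case 0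
  have "h 0 = (\<lambda>_. 1)" by (auto simp: h_0)
  then have "0-lipschitz_on UNIV (h 0)" using lip_const by simp
  then show ?case
    using A K_nonneg[OF nonneg_I[OF s]] M_pos[OF mult_I[OF s], of n]
    by (auto elim!: lipschitz_on_mono intro!: mult_nonneg_nonneg)
next
  case (Suc j)
  let ?m = "M (real n * s)" and ?l = "2 * K s * A * A ^ (n - j) * M (real n * s)"
  let ?l' = "2 * K s * A * A ^ (n - Suc j) * M (real n * s)"
  have K: "0 \<le> K s" using K_nonneg nonneg_I s by blast
  have js: "real j * s \<in> I" by (rule mult_I[OF s])
  have lip: "?l-lipschitz_on UNIV (h (real j * s))" using Suc by simp
  have new: "(?l * C * exp (- \<gamma> * s) * M s + M (real j * s) * K s)-lipschitz_on UNIV (T s (h (real j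
      * s)))"
    using h_le_M[OF js] h_pos[OF js] by (intro T_lipschitz[OF s lip]) (simp add: less_imp_le)
  have eq: "T s (h (real j * s)) = h (real (Suc j) * s)"
    using h_add[OF s js] by (auto simp: algebra_simps)
  have "?l * C * exp (- \<gamma> * s) * M s + M (real j * s) * K s \<le> ?l'"
  proof -
    have nj: "A ^ (n - j) = A * A ^ (n - Suc j)"
      using Suc.prems by (metis Suc_diff_Suc Suc_le_lessD power_Suc)
    have "?l * C * exp (- \<gamma> * s) * M s = (C * exp (- \<gamma> * s) * M s * A) * ?l'"
      by (simp add: nj algebra_simps)
    also have "\<dots> \<le> 1/2 * ?l'"
      using K A M_pos[OF mult_I[OF s], of n] by (intro mult_right_mono[OF b]) auto
    finally have 1: "?l * C * exp (- \<gamma> * s) * M s \<le> 1/2 * ?l'" .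
    have "M (real j * s) * K s \<le> A ^ (n - j) * ?m * K s"
      using rec[of j] Suc.prems K by (intro mult_right_mono) auto
    then have "M (real j * s) * K s \<le> 1/2 * ?l'" by (simp add: nj algebra_simps)
    with 1 show ?thesis by linarith
  qed
  from lipschitz_on_mono[OF new[unfolded eq] subset_refl this] show ?case .
qed

text \<open>
The comparison inequality is applied over the last \<open>k\<close> steps only. Their number does not depend on
\<open>n\<close>, so neither does the factor that is lost, and it is large enough for the error term to be at
most half of the maximum at time \<open>n s\<close>.
\<close>
lemma record_harnack:
  assumes s: "s \<in> I" and A: "0 < A" and b: "C * exp (- \<gamma> * s) * M s * A \<le> 1 / 2"
    and rec: "\<And>j. j \<le> n \<Longrightarrow> M (real j * s) \<le> A ^ (n - j) * M (real n * s)"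
    and k: "2 * C * D * K s * A * (exp (- \<gamma> * s) * M s * A) ^ k \<le> 1 / 2" "k \<le> n"
  shows "exp (- r * (real k * s)) / 2 * M (real n * s) \<le> h (real n * s) y"
proof -
  let ?m = "M (real n * s)" and ?t = "real k * s" and ?u = "real (n - k) * s"
  let ?l = "2 * K s * A * A ^ k * ?m"
  have t: "?t \<in> I" and u: "?u \<in> I" using mult_I[OF s] by auto
  have tu: "?t + ?u = real n * s" using k(2) by (simp add: of_nat_diff algebra_simps)
  have m: "0 < ?m" using M_pos[OF mult_I[OF s]] .
  have K: "0 \<le> K s" using K_nonneg nonneg_I s by blast
  have lip: "?l-lipschitz_on UNIV (h ?u)"
    using record_lipschitz[OF s A b rec, of "n - k"] k(2) by simp
  have "h (real n * s) x \<le> 1/2 * ?m + exp (r * ?t) * h (real n * s) y" for x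
  proof -
    have "?l * C * exp (- \<gamma> * ?t) * h ?t x * D \<le> ?l * C * exp (- \<gamma> * ?t) * M s ^ k * D"
      using K A m C_pos D_nonneg order_trans[OF h_le_M[OF t] M_power[OF s]]
      by (intro mult_right_mono mult_left_mono) auto
    also have "\<dots> = 2 * C * D * K s * A * (exp (- \<gamma> * s) * M s * A) ^ k * ?m"
      by (simp add: power_mult_distrib exp_of_nat_mult[symmetric] algebra_simps)
    also have "\<dots> \<le> 1/2 * ?m" using m by (intro mult_right_mono[OF k(1)]) auto
    finally have 1: "?l * C * exp (- \<gamma> * ?t) * h ?t x * D \<le> 1/2 * ?m" .
    have "exp (- r * ?t) * (T ?t (h ?u) x - ?l * C * exp (- \<gamma> * ?t) * h ?t x * D) \<le> T ?t (h ?u) y"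
      using h_pos[OF u] by (intro comparison[OF t lip]) (auto intro: less_imp_le)
    then have "exp (- r * ?t) * (h (real n * s) x - ?l * C * exp (- \<gamma> * ?t) * h ?t x * D)
        \<le> h (real n * s) y"
      by (simp only: h_add[OF t u, symmetric] tu)
    then have "h (real n * s) x - ?l * C * exp (- \<gamma> * ?t) * h ?t x * D
        \<le> exp (r * ?t) * h (real n * s) y"
      by (simp add: exp_minus field_simps)
    with 1 show ?thesis by linarith
  qed
  then have "?m \<le> 1/2 * ?m + exp (r * ?t) * h (real n * s) y" by (rule M_le)
  then show ?thesis by (simp add: exp_minus field_simps)
qed

end

text \<open>
A record occurs at the first index where \<open>v\<close> exceeds its maximum over \<open>{..k}\<close>.
\<close>
lemma unbounded_records:
  fixes v :: "nat \<Rightarrow> real"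
  assumes "\<And>B. \<exists>n. B < v n"
  shows "\<exists>n\<ge>k. \<forall>j\<le>n. v j \<le> v n"
proof -
  define B where "B = Max (v ` {..k})"
  have B: "v j \<le> B" if "j \<le> k" for j unfolding B_def using that by (intro Max_ge) auto
  define n where "n = (LEAST n. B < v n)"
  have n: "B < v n" unfolding n_def using assms by (rule LeastI_ex)
  have less: "v j \<le> B" if "j < n" for j using not_less_Least[of j] that unfolding n_def by force
  have "k \<le> n" using B[of n] n by (meson le_cases not_le)
  moreover have "v j \<le> v n" if "j \<le> n" for j
    using less[of j] n that by (cases "j = n") auto
  ultimately show ?thesis by blast
qed

context penalized_operators
begin

text \<open>
\<open>\<Lambda>\<close> is the infimum over \<open>n \<ge> 1\<close> of the \<open>n\<close>-th root of \<open>M n\<close>.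
\<close>
lemma growth_rate:
  "\<exists>\<Lambda>>0. (\<forall>n. \<Lambda> ^ n \<le> M (real n)) \<and> (\<forall>\<eta>>1. \<exists>s\<ge>1. M (real s) \<le> (\<eta> * \<Lambda>) ^ s)"
proof -
  define g where "g n = root n (M (real n))" for n
  define \<Lambda> where "\<Lambda> = (INF n\<in>{1..}. g n)"
  have ge: "exp (- r) \<le> g n" if "n \<ge> 1" for n
  proof -
    have "root n (exp (- r * real n)) \<le> g n"
      unfolding g_def using that M_ge[OF nat_I, of n] by (intro real_root_le_mono) auto
    moreover have "root n (exp (- r * real n)) = exp (- r)"
      using that by (intro real_root_pos_unique)
          (auto simp: exp_of_nat_mult[symmetric] mult.commute)
    ultimately show ?thesis by simp
  qed
  have bdd: "bdd_below (g ` {1..})" using ge by (intro bdd_belowI2) auto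
  have "exp (- r) \<le> \<Lambda>"
    unfolding \<Lambda>_def by (rule cINF_greatest) (use ge in auto)
  then have pos: "0 < \<Lambda>" using exp_gt_zero less_le_trans by blast
  have "\<Lambda> ^ n \<le> M (real n)" for n
  proof (cases "n = 0")
    case True then show ?thesis by (simp add: M_0)
  next
    case False
    then have "\<Lambda> \<le> g n" unfolding \<Lambda>_def using bdd by (intro cINF_lower) auto
    then have "\<Lambda> ^ n \<le> g n ^ n" using pos by (intro power_mono) auto
    also have "\<dots> = M (real n)" unfolding g_def
      using False M_pos[OF nat_I, of n] by (simp add: less_imp_le)
    finally show ?thesis .
  qed
  moreover have "\<exists>s\<ge>1. M (real s) \<le> (\<eta> * \<Lambda>) ^ s" if "\<eta> > 1" for \<eta>
  proof -
    have "\<Lambda> < \<eta> * \<Lambda>" using pos that by simp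
    then obtain n where n: "n \<ge> 1" "g n < \<eta> * \<Lambda>"
      unfolding \<Lambda>_def using cInf_lessD[of "g ` {1..}" "\<eta> * \<Lambda>"] by (auto simp: \<Lambda>_def)
    have "M (real n) = g n ^ n" unfolding g_def
      using n(1) M_pos[OF nat_I, of n] by (simp add: less_imp_le)
    also have "\<dots> \<le> (\<eta> * \<Lambda>) ^ n"
      using n order_trans[OF exp_ge_zero ge[OF n(1)]] by (intro power_mono) auto
    finally show ?thesis using n(1) by blast
  qed
  ultimately show ?thesis using pos by blast
qed

text \<open>
The assumptions \<open>s\<close> and \<open>small\<close> provide the smallness conditions of \<open>record_lipschitz\<close> and
\<open>record_harnack\<close> for the ratio \<open>A = (\<eta> / \<Lambda>)\<^sup>s\<close>, since \<open>M\<^sub>s A \<le> \<eta>\<^sup>2\<^sup>s\<close>.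
\<close>
lemma harnack_at_records:
  assumes \<Lambda>: "0 < \<Lambda>" and \<eta>: "0 < \<eta>" and s: "M (real s) \<le> (\<eta> * \<Lambda>) ^ s"
    and small: "exp (- \<gamma> * real s) * \<eta> ^ (2 * s) \<le> 1/2" "C * (exp (- \<gamma> * real s) * \<eta> ^ (2 * s))
        \<le> 1/2"
  shows "\<exists>c>0. \<exists>k L. \<forall>n\<ge>k.
    (\<forall>j\<le>n. M (real j * real s) \<le> ((\<eta> / \<Lambda>) ^ s) ^ (n - j) * M (real n * real s)) \<longrightarrow>
    (\<forall>y. c * M (real n * real s) \<le> h (real n * real s) y) \<and>
    (L * M (real n * real s))-lipschitz_on UNIV (h (real n * real s))"
proof -
  define A where "A = (\<eta> / \<Lambda>) ^ s"
  define b where "b = exp (- \<gamma> * real s) * M (real s) * A"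
  have A: "0 < A" using \<Lambda> \<eta> by (simp add: A_def)
  have "M (real s) * A \<le> (\<eta> * \<Lambda>) ^ s * A" using s A by (intro mult_right_mono) auto
  also have "\<dots> = \<eta> ^ (2 * s)"
    using \<Lambda> by (simp add: A_def power_mult_distrib[symmetric] power_mult power2_eq_square)
  finally have "exp (- \<gamma> * real s) * (M (real s) * A) \<le> exp (- \<gamma> * real s) * \<eta> ^ (2 * s)"
    by (intro mult_left_mono) auto
  then have b_le: "b \<le> exp (- \<gamma> * real s) * \<eta> ^ (2 * s)" by (simp add: b_def mult.assoc)
  have b0: "0 \<le> b" unfolding b_def using A M_pos[OF nat_I, of s] by simp
  have b_half: "b \<le> 1/2" using b_le small(1) by linarith
  have "C * b \<le> C * (exp (- \<gamma> * real s) * \<eta> ^ (2 * s))" using b_le C_pos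
    by (intro mult_left_mono) auto
  then have Cb: "C * exp (- \<gamma> * real s) * M (real s) * A \<le> 1/2"
    using small(2) by (simp add: b_def mult.assoc)
  define Q where "Q = 2 * C * D * K (real s) * A"
  have "(\<lambda>k. Q * b ^ k) \<longlonglongrightarrow> Q * 0"
    using b0 b_half by (intro tendsto_intros LIMSEQ_realpow_zero) auto
  then have "eventually (\<lambda>k. Q * b ^ k < 1/2) sequentially"
    by (rule order_tendstoD) simp
  then obtain k where k: "Q * b ^ k < 1/2" by (auto simp: eventually_sequentially)
  have "(\<forall>y. exp (- r * (real k * real s)) / 2 * M (real n * real s) \<le> h (real n * real s) y) \<and>
    (2 * K (real s) * A * M (real n * real s))-lipschitz_on UNIV (h (real n * real s))"
    if n: "n \<ge> k" and rec: "\<forall>j\<le>n. M (real j * real s) \<le> A ^ (n - j) * M (real n * real s)" for n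
  proof (intro conjI allI)
    show "exp (- r * (real k * real s)) / 2 * M (real n * real s) \<le> h (real n * real s) y" for y
      using k n rec by (intro record_harnack[OF nat_I A Cb]) (auto simp: Q_def b_def)
    show "(2 * K (real s) * A * M (real n * real s))-lipschitz_on UNIV (h (real n * real s))"
      using record_lipschitz[OF nat_I A Cb, of n n] rec by simp
  qed
  then show ?thesis unfolding A_def
    by (intro exI[of _ "exp (- r * (real k * real s)) / 2"] conjI exI[of _ k]
      exI[of _ "2 * K (real s) * ((\<eta> / \<Lambda>) ^ s)"]) auto
qed

text \<open>
Two passes through \<open>harnack_at_records\<close>. The first one uses the record times along the multiples
of some \<open>s\<close>. It provides a record time \<open>s'\<close> at which \<open>inf h\<^sub>s\<^sub>' \<ge> c M\<^sub>s\<^sub>'\<close>, with \<open>s'\<close> so large that \<open>c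
\<eta>\<^sup>s\<^sup>' \<ge> 1\<close>; hence \<open>M\<^sub>t\<^sub>+\<^sub>s\<^sub>' \<ge> c M\<^sub>s\<^sub>' M\<^sub>t \<ge> (\<Lambda> / \<eta>)\<^sup>s\<^sup>' M\<^sub>t\<close>, which says that every multiple of \<open>s'\<close> is a
record time for the second pass.
\<close>
lemma eventual_harnack:
  "\<exists>s\<ge>1. \<exists>c>0. \<exists>k L. \<forall>n\<ge>k. (\<forall>y. c * M (real n * real s) \<le> h (real n * real s) y) \<and>
    (L * M (real n * real s))-lipschitz_on UNIV (h (real n * real s))"
proof -
  obtain \<Lambda> where \<Lambda>: "0 < \<Lambda>" "\<And>n. \<Lambda> ^ n \<le> M (real n)"
    "\<And>\<eta>. \<eta> > 1 \<Longrightarrow> \<exists>s\<ge>1. M (real s) \<le> (\<eta> * \<Lambda>) ^ s"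
    using growth_rate by blast
  \<comment> \<open>Any \<open>\<eta> > 1\<close> with \<open>\<eta>\<^sup>2 < e\<^sup>\<gamma>\<close> would do: the weights \<open>w s\<close> must tend to 0.\<close>
  define \<eta> where "\<eta> = exp (\<gamma> / 8)"
  have \<eta>: "1 < \<eta>" using \<gamma>_pos by (simp add: \<eta>_def)
  define w where "w s = exp (- \<gamma> * real s) * \<eta> ^ (2 * s)" for s
  have w: "w s = exp (- 3 / 4 * \<gamma>) ^ s" for s
    unfolding w_def \<eta>_def by (simp add: exp_of_nat_mult[symmetric] exp_add[symmetric] algebra_simps)
  have "w \<longlonglongrightarrow> 0" unfolding w using \<gamma>_pos by (intro LIMSEQ_realpow_zero) auto
  moreover have "(\<lambda>s. C * w s) \<longlonglongrightarrow> 0" using tendsto_mult_right_zero[OF \<open>w \<longlonglongrightarrow> 0\<close>] .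
  ultimately have "eventually (\<lambda>s. w s < 1/2 \<and> C * w s < 1/2) sequentially"
    by (intro eventually_conj order_tendstoD(2)) auto
  then obtain k0 where k0: "\<And>s. s \<ge> k0 \<Longrightarrow> w s \<le> 1/2 \<and> C * w s \<le> 1/2"
    unfolding eventually_sequentially using less_imp_le by metis
  have multiple: "M (real (j * s)) \<le> (\<eta> * \<Lambda>) ^ (j * s)" if "M (real s) \<le> (\<eta> * \<Lambda>) ^ s" for j s
  proof -
    have "M (real j * real s) \<le> M (real s) ^ j" by (rule M_power[OF nat_I])
    also have "\<dots> \<le> ((\<eta> * \<Lambda>) ^ s) ^ j" using that M_pos[OF nat_I, of s] by (intro power_mono) auto
    finally show ?thesis by (simp add: power_mult[symmetric] mult.commute)
  qed
  obtain s0 where s0: "s0 \<ge> 1" "M (real s0) \<le> (\<eta> * \<Lambda>) ^ s0" using \<Lambda>(3)[OF \<eta>] by blast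
  define s where "s = Suc k0 * s0"
  have s1: "s \<ge> 1" unfolding s_def using s0(1) by auto
  have "k0 \<le> k0 * s0" using s0(1) by simp
  then have sk: "s \<ge> k0" unfolding s_def by (simp only: mult_Suc trans_le_add2)
  have Ms: "M (real s) \<le> (\<eta> * \<Lambda>) ^ s" unfolding s_def by (rule multiple[OF s0(2)])
  have \<eta>0: "0 < \<eta>" using \<eta> by simp
  obtain c k where c: "c > 0" and harn: "\<And>n y. n \<ge> k \<Longrightarrow>
    (\<forall>j\<le>n. M (real j * real s) \<le> ((\<eta> / \<Lambda>) ^ s) ^ (n - j) * M (real n * real s)) \<Longrightarrow>
    c * M (real n * real s) \<le> h (real n * real s) y"
    using harnack_at_records[OF \<Lambda>(1) \<eta>0 Ms] k0[OF sk] unfolding w_def by blast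
  define A where "A = (\<eta> / \<Lambda>) ^ s"
  have A: "0 < A" using \<Lambda>(1) \<eta>0 by (simp add: A_def)
  define v where "v n = A ^ n * M (real n * real s)" for n
  have v_ge: "(\<eta> ^ s) ^ n \<le> v n" for n
  proof -
    have "(\<eta> ^ s) ^ n = A ^ n * \<Lambda> ^ (n * s)"
      using \<Lambda>(1) by (simp add: A_def power_mult[symmetric] power_divide mult.commute)
    also have "\<dots> \<le> v n" unfolding v_def using A \<Lambda>(2)[of "n * s"] by (intro mult_left_mono) auto
    finally show ?thesis .
  qed
  have \<eta>s: "1 < \<eta> ^ s" using \<eta> s1 by (intro one_less_power) auto
  have unb: "\<exists>n. B < v n" for B
    using real_arch_pow[OF \<eta>s, of B] v_ge less_le_trans by blast
  obtain n0 where n0: "1 / c < (\<eta> ^ s) ^ n0" using real_arch_pow[OF \<eta>s] by blast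
  obtain n where n: "n \<ge> max (Suc k) n0" "\<forall>j\<le>n. v j \<le> v n"
    using unbounded_records[OF unb] by blast
  have rec: "M (real j * real s) \<le> A ^ (n - j) * M (real n * real s)" if "j \<le> n" for j
  proof -
    have "A ^ j * M (real j * real s) \<le> A ^ j * (A ^ (n - j) * M (real n * real s))"
      using n(2) that by (simp add: v_def mult.assoc[symmetric] power_add[symmetric])
    then show ?thesis using A by (simp add: mult_le_cancel_left_pos)
  qed
  define s' where "s' = n * s"
  have rs': "real s' = real n * real s" by (simp add: s'_def)
  have s'1: "s' \<ge> 1" and s'k: "s' \<ge> k0"
    using n(1) s1 sk unfolding s'_def by (auto intro: order_trans[OF sk])
  have Ms': "M (real s') \<le> (\<eta> * \<Lambda>) ^ s'" unfolding s'_def by (rule multiple[OF Ms])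
  have harn': "c * M (real s') \<le> h (real s') y" for y
    unfolding rs' using n(1) rec by (intro harn) (auto simp: A_def)
  have "1 / c < \<eta> ^ s'"
  proof -
    have "(\<eta> ^ s) ^ n0 \<le> (\<eta> ^ s) ^ n" using n(1) \<eta>s by (intro power_increasing) auto
    then show ?thesis using n0 by (simp add: s'_def power_mult[symmetric] mult.commute)
  qed
  then have c_ge: "1 \<le> c * \<eta> ^ s'" using c by (simp add: field_simps)
  define A' where "A' = (\<eta> / \<Lambda>) ^ s'"
  have A': "0 < A'" using \<Lambda>(1) \<eta>0 by (simp add: A'_def)
  have step: "M (real j * real s') \<le> A' * M (real (Suc j) * real s')" for j
  proof -
    let ?j = "real j * real s'"
    have j: "?j \<in> I" by (rule mult_I[OF nat_I])
    have "h ?j x \<le> A' * M (real (Suc j) * real s')" for x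
    proof -
      have "c * M (real s') * h ?j x \<le> h (?j + real s') x"
        by (rule h_add_ge[OF j nat_I harn'])
      also have "\<dots> \<le> M (?j + real s')" by (intro h_le_M add_I j nat_I)
      also have "?j + real s' = real (Suc j) * real s'" by (simp add: algebra_simps)
      finally have 1: "c * M (real s') * h ?j x \<le> M (real (Suc j) * real s')" .
      have "1 \<le> A' * (c * M (real s'))"
      proof -
        have "\<eta> ^ s' = A' * \<Lambda> ^ s'" using \<Lambda>(1) by (simp add: A'_def power_divide)
        then have "1 \<le> c * A' * \<Lambda> ^ s'" using c_ge by (simp add: mult.assoc)
        also have "\<dots> \<le> c * A' * M (real s')" using c A' \<Lambda>(2) by (intro mult_left_mono) auto
        finally show ?thesis by (simp add: algebra_simps)
      qed
      then have "h ?j x \<le> A' * (c * M (real s')) * h ?j x"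
        using h_pos[OF j, of x] by simp
      also have "\<dots> \<le> A' * M (real (Suc j) * real s')"
        using 1 A' by (simp add: mult.assoc)
      finally show ?thesis .
    qed
    then show ?thesis by (rule M_le)
  qed
  have rec': "M (real j * real s') \<le> A' ^ (N - j) * M (real N * real s')" if "j \<le> N" for j N
    using that
  proof (induction N rule: dec_induct)
    case base then show ?case by simp
  next
    case (step N)
    have "A' ^ (N - j) * M (real N * real s') \<le> A' ^ (N - j) * (A' * M (real (Suc N) * real s'))"
      using A' \<open>\<And>j. M (real j * real s') \<le> A' * M (real (Suc j) * real s')\<close>
        by (intro mult_left_mono) auto
    with step show ?case by (simp add: Suc_diff_le mult.assoc mult.left_commute)
  qed
  obtain c' k' L'
    where "c' > 0" "\<And>N. N \<ge> k' \<Longrightarrow> (\<forall>y. c' * M (real N * real s') \<le> h (real N * real s') y) \<and>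
    (L' * M (real N * real s'))-lipschitz_on UNIV (h (real N * real s'))"
    using harnack_at_records[OF \<Lambda>(1) \<eta>0 Ms'] k0[OF s'k] rec' unfolding w_def A'_def by blast
  then show ?thesis using s'1 by blast
qed

text \<open>
The estimates along the multiples of one time extend to all times: a remainder in a bounded
interval costs only a constant factor.
\<close>
lemma harnack:
  "\<exists>R\<ge>1. \<forall>t\<in>I. (\<forall>x y. h t x \<le> R * h t y) \<and> (\<forall>x y z. \<bar>h t x - h t y\<bar> \<le> R * h t z * dist x y)"
proof -
  obtain s c k L where s: "s \<ge> 1" and c: "c > 0"
    and harn: "\<And>n y. n \<ge> k \<Longrightarrow> c * M (real n * real s) \<le> h (real n * real s) y"
    and lip: "\<And>n. n \<ge> k \<Longrightarrow> (L * M (real n * real s))-lipschitz_on UNIV (h (real n * real s))"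
    using eventual_harnack by blast
  \<comment> \<open>\<open>t = u + n s\<close> with \<open>u \<le> S\<close>, where \<open>n = 0\<close> for the times up to \<open>S\<close>\<close>
  define S where "S = real (Suc k) * real s"
  have S: "0 \<le> S" unfolding S_def by simp
  define c' where "c' = min c 1"
  define L' where "L' = max L 0"
  have c': "0 < c'" "c' \<le> c" "c' \<le> 1" using c by (auto simp: c'_def)
  have split: "\<exists>n u. u \<in> I \<and> u \<le> S \<and> t = u + real n * real s \<and> (n = 0 \<or> n \<ge> k)" if t: "t \<in> I" for t
  proof (cases "t \<le> S")
    case True then show ?thesis using t by (intro exI[of _ 0] exI[of _ t]) auto
  next
    case False
    define n where "n = nat \<lfloor>t / real s\<rfloor>"
    have ts: "0 \<le> t / real s" using nonneg_I t by auto
    have n: "real n \<le> t / real s" "t / real s < real n + 1" unfolding n_def using ts by linarith+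
    have le: "real n * real s \<le> t" using n(1) s by (simp add: field_simps)
    have lt: "t < (real n + 1) * real s" using n(2) s by (simp add: field_simps)
    have "real (Suc k) * real s < (real n + 1) * real s" using False lt unfolding S_def by linarith
    then have "Suc k < n + 1" using s by (simp add: mult_less_cancel_right)
    moreover have "t - real n * real s \<in> I" by (intro diff_I t mult_I nat_I le)
    moreover have "t - real n * real s \<le> S"
    proof -
      have "t - real n * real s \<le> real s" using lt by (simp add: algebra_simps)
      also have "\<dots> \<le> S" unfolding S_def using s by (simp add: algebra_simps)
      finally show ?thesis .
    qed
    ultimately show ?thesis by (intro exI[of _ n] exI[of _ "t - real n * real s"]) auto
  qed
  define R where "R = max 1 (max (exp (r * S) / c') ((L' * C + K S) * (exp (r * S) / c')))"
  have "(\<forall>x y. h t x \<le> R * h t y) \<and> (\<forall>x y z. \<bar>h t x - h t y\<bar> \<le> R * h t z * dist x y)" if t: "t \<in> I"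
    for t
  proof -
    obtain n u where u: "u \<in> I" "u \<le> S" and tu: "t = u + real n * real s" and n: "n = 0 \<or> n \<ge> k"
      using split[OF t] by blast
    let ?v = "real n * real s"
    have v: "?v \<in> I" by (intro mult_I nat_I)
    have u0: "0 \<le> u" using u nonneg_I by blast
    have m: "0 < M ?v" using M_pos v by blast
    have hv: "c' * M ?v \<le> h ?v y" for y
    proof (cases "n \<ge> k")
      case True
      have "c' * M ?v \<le> c * M ?v" using c' m by (intro mult_right_mono) auto
      then show ?thesis using harn[OF True, of y] by linarith
    next
      case False then have "n = 0" using n by simp
      then show ?thesis using c' by (simp add: M_0 h_0)
    qed
    have lv: "(L' * M ?v)-lipschitz_on UNIV (h ?v)"
    proof (cases "n \<ge> k")
      case True
      show ?thesis by (rule lipschitz_on_mono[OF lip[OF True]])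
          (use m in \<open>auto simp: L'_def mult_right_mono\<close>)
    next
      case False then have "n = 0" using n by simp
      then have "h ?v = (\<lambda>_. 1)" by (auto simp: h_0)
      then show ?thesis
        using m lipschitz_on_mono[OF lip_const, of UNIV "L' * M ?v"] by (auto simp: L'_def)
    qed
    have ht: "M ?v \<le> exp (r * S) / c' * h t y" for y
    proof -
      have "exp (- r * S) \<le> exp (- r * u)" using u r_nonneg by (simp add: mult_left_mono)
      also have "\<dots> \<le> h u y" by (rule mass_ge[OF u(1)])
      finally have "c' * M ?v * exp (- r * S) \<le> c' * M ?v * h u y" using c' m
        by (intro mult_left_mono) auto
      also have "\<dots> \<le> h t y" unfolding tu by (rule h_add_ge[OF u(1) v hv])
      finally show ?thesis using c' by (simp add: exp_minus field_simps)
    qed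
    have ub: "h t x \<le> M ?v" for x
    proof -
      have "h t x \<le> M ?v * h u x" unfolding tu by (rule h_add_le[OF u(1) v])
      also have "\<dots> \<le> M ?v * 1" using m by (intro mult_left_mono mass_le u(1)) auto
      finally show ?thesis by simp
    qed
    have "h t x \<le> R * h t y" for x y
    proof -
      have "h t x \<le> exp (r * S) / c' * h t y" using ub[of x] ht[of y] by linarith
      also have "\<dots> \<le> R * h t y" using h_pos[OF t, of y]
        by (intro mult_right_mono) (auto simp: R_def)
      finally show ?thesis .
    qed
    moreover have "\<bar>h t x - h t y\<bar> \<le> R * h t z * dist x y" for x y z
    proof -
      have hb: "\<bar>h ?v x\<bar> \<le> M ?v" for x using h_le_M[OF v] h_pos[OF v, of x] by simp
      have L0: "0 \<le> L'" by (simp add: L'_def)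
      have "\<bar>T u (h ?v) x - T u (h ?v) y\<bar>
          \<le> (L' * M ?v * C * exp (- \<gamma> * u) * h u x + M ?v * K u) * dist x y"
        by (rule lasota_yorke[OF u(1) lv hb])
      also have "\<dots> \<le> (L' * M ?v * C * 1 * 1 + M ?v * K S) * dist x y"
        using L0 m C_pos \<gamma>_pos u0 u h_pos[OF u(1), of x] mass_le[OF u(1)] K_mono[OF u0 u(2)]
        by (intro mult_right_mono add_mono mult_mono mult_left_mono mult_nonneg_nonneg) auto
      also have "\<dots> = (L' * C + K S) * M ?v * dist x y" by (simp add: algebra_simps)
      also have "\<dots> \<le> (L' * C + K S) * (exp (r * S) / c' * h t z) * dist x y"
        using L0 C_pos K_nonneg[OF S] ht[of z] by (intro mult_right_mono mult_left_mono) auto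
      also have "\<dots> = (L' * C + K S) * (exp (r * S) / c') * h t z * dist x y"
        by (simp add: algebra_simps)
      also have "\<dots> \<le> R * h t z * dist x y"
        using h_pos[OF t, of z] by (intro mult_right_mono) (auto simp: R_def)
      finally show ?thesis using h_add[OF u(1) v] by (simp add: tu)
    qed
    ultimately show ?thesis by blast
  qed
  moreover have "1 \<le> R" by (simp add: R_def)
  ultimately show ?thesis by blast
qed

end

section \<open>Contraction of the normalized semigroup\<close>

locale harnack_operators = penalized_operators +
  fixes R :: real
  assumes R_ge_1: "1 \<le> R"
    and h_ratio: "\<And>t x y. t \<in> I \<Longrightarrow> h t x \<le> R * h t y"
    and h_diff: "\<And>t x y z. t \<in> I \<Longrightarrow> \<bar>h t x - h t y\<bar> \<le> R * h t z * dist x y"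
begin

text \<open>
The transition operator, over a duration \<open>t\<close>, of the process conditioned to survive for a further
time \<open>u\<close> after it.
\<close>
definition Cond :: "real \<Rightarrow> real \<Rightarrow> ('a \<Rightarrow> real) \<Rightarrow> 'a \<Rightarrow> real" where
  "Cond u t f x = T t (\<lambda>y. h u y * f y) x / h (t + u) x"

lemma M_le_h: assumes "t \<in> I" shows "M t \<le> R * h t x"
  by (intro M_le h_ratio assms)

lemma h_lip_M:
  assumes t: "t \<in> I" shows "(R * M t)-lipschitz_on UNIV (h t)"
proof (rule lipschitz_onI)
  show "0 \<le> R * M t" using R_ge_1 M_pos[OF t] by simp
  fix x y
  have "\<bar>h t x - h t y\<bar> \<le> R * h t x * dist x y" by (rule h_diff[OF t])
  also have "\<dots> \<le> R * M t * dist x y"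
    using R_ge_1 h_le_M[OF t, of x] by (intro mult_right_mono mult_left_mono) auto
  finally show "dist (h t x) (h t y) \<le> R * M t * dist x y" by (simp add: dist_real_def)
qed

lemma weighted_lip:
  assumes u: "u \<in> I" and f: "l-lipschitz_on UNIV f" and B: "\<And>x. \<bar>f x\<bar> \<le> B"
  shows "(M u * (l + R * B))-lipschitz_on UNIV (\<lambda>x. h u x * f x)"
proof -
  have "\<bar>h u x\<bar> \<le> M u" for x using h_le_M[OF u, of x] h_pos[OF u, of x] by simp
  moreover have "0 \<le> B" using B[of undefined] by simp
  ultimately have "(M u * l + R * M u * B)-lipschitz_on UNIV (\<lambda>x. h u x * f x)"
    using B M_pos[OF u] by (intro lipschitz_on_times[OF h_lip_M[OF u] f]) auto
  then show ?thesis by (simp add: algebra_simps)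
qed

lemma weighted_lip_ex:
  assumes u: "u \<in> I" and f: "l-lipschitz_on UNIV f"
  obtains m where "m-lipschitz_on UNIV (\<lambda>x. h u x * f x)"
  using weighted_lip[OF assms] lip_bound[OF f] by metis

lemma cond_shift:
  assumes t: "t \<in> I" and u: "u \<in> I" and f: "l-lipschitz_on UNIV f"
  shows "Cond u t (\<lambda>x. f x - a) x = Cond u t f x - a"
proof -
  obtain m where m: "m-lipschitz_on UNIV (\<lambda>x. h u x * f x)" using weighted_lip_ex[OF u f] .
  obtain k where k: "k-lipschitz_on UNIV (h u)" using h_lip[OF u] .
  obtain k' where k': "k'-lipschitz_on UNIV (\<lambda>x. (- a) * h u x)"
    using lipschitz_on_cmult_real[OF k] by blast
  have "T t (\<lambda>y. h u y * (f y - a)) x = T t (\<lambda>y. h u y * f y + (- a) * h u y) x"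
    by (simp add: algebra_simps)
  also have "\<dots> = T t (\<lambda>y. h u y * f y) x + (- a) * T t (h u) x"
    by (simp only: T_add[OF t m k'] T_scale[OF t k])
  finally show ?thesis
    using h_add[OF t u, of x] h_pos[OF add_I[OF t u], of x] by (simp add: Cond_def field_simps)
qed

lemma cond_ge:
  assumes t: "t \<in> I" and u: "u \<in> I" and f: "l-lipschitz_on UNIV f" and B: "\<And>x. B \<le> f x"
  shows "B \<le> Cond u t f x"
proof -
  obtain m where m: "m-lipschitz_on UNIV (\<lambda>x. h u x * f x)" using weighted_lip_ex[OF u f] .
  obtain k where k: "k-lipschitz_on UNIV (h u)" using h_lip[OF u] .
  obtain k' where k': "k'-lipschitz_on UNIV (\<lambda>x. B * h u x)"
    using lipschitz_on_cmult_real[OF k] by blast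
  have "B * h (t + u) x = T t (\<lambda>y. B * h u y) x"
    using T_scale[OF t k] h_add[OF t u] by simp
  also have "\<dots> \<le> T t (\<lambda>y. h u y * f y) x"
    using B h_pos[OF u] by (intro T_mono[OF t k' m]) (metis less_imp_le mult.commute mult_left_mono)
  finally show ?thesis using h_pos[OF add_I[OF t u], of x] by (simp add: Cond_def field_simps)
qed

lemma cond_le:
  assumes t: "t \<in> I" and u: "u \<in> I" and f: "l-lipschitz_on UNIV f" and B: "\<And>x. f x \<le> B"
  shows "Cond u t f x \<le> B"
proof -
  obtain m where m: "m-lipschitz_on UNIV (\<lambda>x. h u x * f x)" using weighted_lip_ex[OF u f] .
  obtain k where k: "k-lipschitz_on UNIV (h u)" using h_lip[OF u] .
  obtain k' where k': "k'-lipschitz_on UNIV (\<lambda>x. B * h u x)"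
    using lipschitz_on_cmult_real[OF k] by blast
  have "T t (\<lambda>y. h u y * f y) x \<le> T t (\<lambda>y. B * h u y) x"
    using B h_pos[OF u] by (intro T_mono[OF t m k']) (metis less_imp_le mult.commute mult_left_mono)
  also have "\<dots> = B * h (t + u) x"
    using T_scale[OF t k] h_add[OF t u] by simp
  finally show ?thesis using h_pos[OF add_I[OF t u], of x] by (simp add: Cond_def field_simps)
qed

lemma cond_zero:
  assumes u: "u \<in> I" and f: "l-lipschitz_on UNIV f"
  shows "Cond u 0 f = f"
proof
  fix x
  obtain m where m: "m-lipschitz_on UNIV (\<lambda>x. h u x * f x)" using weighted_lip_ex[OF u f] .
  show "Cond u 0 f x = f x" using T_zero[OF m, of x] h_pos[OF u, of x] by (simp add: Cond_def)
qed

lemma cond_compose: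
  assumes s: "s \<in> I" and t: "t \<in> I" and u: "u \<in> I" and f: "l-lipschitz_on UNIV f"
  shows "Cond u (s + t) f = Cond (t + u) s (Cond u t f)"
proof
  fix x
  obtain m where m: "m-lipschitz_on UNIV (\<lambda>x. h u x * f x)" using weighted_lip_ex[OF u f] .
  have "h (t + u) y * Cond u t f y = T t (\<lambda>y. h u y * f y) y" for y
    using h_pos[OF add_I[OF t u], of y] by (simp add: Cond_def)
  then show "Cond u (s + t) f x = Cond (t + u) s (Cond u t f) x"
    using semigroup[OF s t m, of x] by (simp add: Cond_def add.assoc)
qed

definition osc_coeff :: "real \<Rightarrow> real" where "osc_coeff t = R * R * C + R * K t * exp (r * t) + R"

lemma osc_coeff_mono: "0 \<le> s \<Longrightarrow> s \<le> t \<Longrightarrow> osc_coeff s \<le> osc_coeff t"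
  unfolding osc_coeff_def using R_ge_1 K_nonneg[of s] K_nonneg[of t] K_mono r_nonneg
  by (intro add_mono mult_mono mult_left_mono mult_nonneg_nonneg) (auto intro!: mult_left_mono)

lemma osc_coeff_pos: "0 \<le> t \<Longrightarrow> 0 < osc_coeff t"
  unfolding osc_coeff_def using R_ge_1 K_nonneg[of t] C_pos
  by (intro add_nonneg_pos add_nonneg_nonneg mult_nonneg_nonneg) auto

lemma h_add_ge_M:
  assumes t: "t \<in> I" and u: "u \<in> I" shows "M u * h t x \<le> R * h (t + u) x"
proof -
  have "M u / R \<le> h u y" for y using M_le_h[OF u, of y] R_ge_1 by (simp add: field_simps)
  from h_add_ge[OF t u this] show ?thesis using R_ge_1 by (simp add: field_simps)
qed

text \<open>
Since constants are fixed by the kernel, \<open>f\<close> may be replaced by \<open>f - f undefined\<close>, which is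
bounded by the oscillation \<open>b\<close>. The Harnack inequality controls the variation of the
normalization.
\<close>
lemma cond_lasota_yorke:
  assumes t: "t \<in> I" and u: "u \<in> I" and f: "l-lipschitz_on UNIV f" and osc: "\<And>x y. \<bar>f x - f y\<bar> \<le> b"
  shows "(R * C * exp (- \<gamma> * t) * l + osc_coeff t * b)-lipschitz_on UNIV (Cond u t f)"
proof (rule lipschitz_onI)
  have l0: "0 \<le> l" using f lipschitz_on_nonneg by blast
  have b0: "0 \<le> b" using osc[of undefined undefined] by simp
  have K0: "0 \<le> K t" using K_nonneg nonneg_I t by blast
  show "0 \<le> R * C * exp (- \<gamma> * t) * l + osc_coeff t * b"
    using R_ge_1 C_pos l0 b0 osc_coeff_pos[OF nonneg_I[OF t]]
      by (intro add_nonneg_nonneg mult_nonneg_nonneg) auto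
  fix x y
  define g where "g = (\<lambda>z. f z - f undefined)"
  have g: "l-lipschitz_on UNIV g" using f unfolding g_def lipschitz_on_def
    by (simp add: dist_real_def)
  have gb: "\<bar>g z\<bar> \<le> b" for z unfolding g_def by (rule osc)
  define V where "V = T t (\<lambda>z. h u z * g z)"
  define H where "H = h (t + u)"
  have H: "0 < H z" for z unfolding H_def by (rule h_pos[OF add_I[OF t u]])
  have Mu: "0 < M u" by (rule M_pos[OF u])
  have ht: "0 < h t x" by (rule h_pos[OF t])
  have MH: "M u * h t x \<le> R * H x" unfolding H_def by (rule h_add_ge_M[OF t u])
  have "Cond u t f x - Cond u t f y = Cond u t g x - Cond u t g y"
    using cond_shift[OF t u f, of "f undefined"] by (simp add: g_def)
  also have "\<dots> = (V x - V y) / H x + V y / H y * ((H y - H x) / H x)"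
    using H[of x] H[of y] by (simp add: Cond_def V_def H_def field_simps)
  finally have "\<bar>Cond u t f x - Cond u t f y\<bar>
      \<le> \<bar>V x - V y\<bar> / H x + \<bar>V y / H y\<bar> * (\<bar>H y - H x\<bar> / H x)"
    using H[of x] by (metis abs_divide abs_mult abs_of_pos abs_triangle_ineq)
  also have "\<dots> \<le> (R * C * exp (- \<gamma> * t) * (l + R * b) + R * K t * exp (r * t) * b) * dist x y
      + b * (R * dist x y)"
  proof (intro add_mono mult_mono)
    have "\<bar>h u z * g z\<bar> \<le> M u * b" for z
      unfolding abs_mult using h_le_M[OF u, of z] h_pos[OF u, of z] gb b0 Mu
        by (intro mult_mono) auto
    then have "\<bar>V x - V y\<bar> \<le> (M u * (l + R * b) * C * exp (- \<gamma> * t) * h t x + M u * b * K t)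
        * dist x y"
      unfolding V_def by (intro lasota_yorke[OF t weighted_lip[OF u g gb]])
    also have "\<dots> \<le> (M u * (l + R * b) * C * exp (- \<gamma> * t) * h t x + M u * b * K t * (exp (r * t)
        * h t x)) * dist x y"
    proof -
      have "1 \<le> exp (r * t) * h t x" using mass_ge[OF t, of x] by (simp add: exp_minus field_simps)
      then have "M u * b * K t * 1 \<le> M u * b * K t * (exp (r * t) * h t x)"
        using Mu b0 K0 by (intro mult_left_mono) auto
      then show ?thesis by (intro mult_right_mono add_left_mono) auto
    qed
    also have "\<dots> = (M u * h t x) * ((l + R * b) * C * exp (- \<gamma> * t) + b * K t * exp (r * t))
        * dist x y"
      by (simp add: algebra_simps)
    also have "\<dots> \<le> (R * H x) * ((l + R * b) * C * exp (- \<gamma> * t) + b * K t * exp (r * t)) * dist x y"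
      using l0 b0 R_ge_1 C_pos K0 by (intro mult_right_mono[OF mult_right_mono[OF MH]]) auto
    finally show "\<bar>V x - V y\<bar> / H x
        \<le> (R * C * exp (- \<gamma> * t) * (l + R * b) + R * K t * exp (r * t) * b) * dist x y"
      using H[of x] by (simp add: field_simps)
    have "\<bar>Cond u t g y\<bar> \<le> b"
      using cond_ge[OF t u g, of "- b" y] cond_le[OF t u g, of b y] gb
        by (simp add: abs_le_iff) (metis minus_le_iff)
    then show "\<bar>V y / H y\<bar> \<le> b" by (simp add: Cond_def V_def H_def)
    show "\<bar>H y - H x\<bar> / H x \<le> R * dist x y"
      using h_diff[OF add_I[OF t u], of y x x] H[of x] by (simp add: H_def field_simps dist_commute)
  qed (use b0 H[of x] in auto)
  also have "\<dots> \<le> (R * C * exp (- \<gamma> * t) * l + osc_coeff t * b) * dist x y"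
  proof -
    have "R * C * exp (- \<gamma> * t) * (R * b) \<le> R * C * 1 * (R * b)"
      using R_ge_1 C_pos b0 \<gamma>_pos nonneg_I[OF t] by (intro mult_right_mono mult_left_mono) auto
    then have "(R * C * exp (- \<gamma> * t) * (l + R * b) + R * K t * exp (r * t) * b) + b * R
      \<le> R * C * exp (- \<gamma> * t) * l + osc_coeff t * b"
      by (simp add: osc_coeff_def algebra_simps)
    from mult_right_mono[OF this zero_le_dist[of x y]] show ?thesis by (simp add: algebra_simps)
  qed
  finally show "dist (Cond u t f x) (Cond u t f y)
      \<le> (R * C * exp (- \<gamma> * t) * l + osc_coeff t * b) * dist x y"
    by (simp add: dist_real_def)
qed

text \<open>
A Doeblin type bound. For \<open>f\<close> with infimum 0, the comparison inequality gives \<open>Cond u t f y \<ge> c'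
(Cond u t f x / R - const \<cdot> l)\<close>, so the gap to \<open>Cond u t f x\<close> is a proportion \<open>1 - c\<close> of the
oscillation, up to a term in the Lipschitz constant. The same factor \<open>c\<close> stands in front of this
term, which can therefore be absorbed however small \<open>c\<close> is.
\<close>
lemma cond_osc:
  assumes t: "t \<in> I" and u: "u \<in> I" and f: "l-lipschitz_on UNIV f" and osc: "\<And>x y. \<bar>f x - f y\<bar> \<le> b"
  defines "c \<equiv> exp (- 2 * r * t) / (R * R)"
  shows "\<bar>Cond u t f x - Cond u t f y\<bar> \<le> (1 - c) * b + c * (R * C * exp (- \<gamma> * t) * D) * l"
proof -
  have l0: "0 \<le> l" using f lipschitz_on_nonneg by blast
  obtain B where B: "\<And>x. \<bar>f x\<bar> \<le> B" using lip_bound[OF f] by blast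
  have bdd: "bdd_below (range f)" using B
    by (intro bdd_belowI2[of _ "- B"]) (simp add: abs_le_iff minus_le_iff)
  define g where "g = (\<lambda>z. f z - (INF x. f x))"
  have g: "l-lipschitz_on UNIV g" using f unfolding g_def lipschitz_on_def
    by (simp add: dist_real_def)
  have g0: "0 \<le> g z" for z unfolding g_def using bdd by (simp add: cINF_lower)
  have gb: "g z \<le> b" for z
  proof -
    have "f z - b \<le> (INF x. f x)" using osc
      by (intro cINF_greatest) (auto simp: abs_le_iff algebra_simps)
    then show ?thesis by (simp add: g_def)
  qed
  define k where "k = C * exp (- \<gamma> * t) * D"
  have k0: "0 \<le> k" using C_pos D_nonneg by (simp add: k_def)
  have Mu: "0 < M u" by (rule M_pos[OF u])
  have gl: "\<exists>m. m-lipschitz_on UNIV (\<lambda>x. M u * g x)" "\<exists>m. m-lipschitz_on UNIV (\<lambda>x. M u / R * g x)"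
    using lipschitz_on_cmult_real[OF g] by blast+
  obtain m where m: "m-lipschitz_on UNIV (\<lambda>x. h u x * g x)" using weighted_lip_ex[OF u g] .
  \<comment> \<open>The factor \<open>exp (- r * t)\<close> is used once for the comparison inequality and once for \<open>h t x\<close>.\<close>
  define c' where "c' = exp (- r * t) * exp (- r * t) / R"
  have c': "0 < c'" "c = c' / R"
    using R_ge_1 by (auto simp: c'_def c_def exp_add[symmetric] field_simps)
  have main: "Cond u t g x - Cond u t g y \<le> (1 - c) * b + c * (R * k) * l" for x y
  proof -
    let ?H = "\<lambda>x. h (t + u) x"
    have H: "0 < ?H z" for z by (rule h_pos[OF add_I[OF t u]])
    have "T t (\<lambda>z. h u z * g z) x \<le> T t (\<lambda>z. M u * g z) x"
      using gl m g0 h_le_M[OF u] by (auto intro!: T_mono[OF t m] mult_right_mono)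
    also have "\<dots> = M u * T t g x" by (rule T_scale[OF t g])
    finally have "Cond u t g x * ?H x \<le> M u * T t g x" using H[of x] by (simp add: Cond_def)
    moreover have "Cond u t g x * (M u * h t x) \<le> Cond u t g x * (R * ?H x)"
      using cond_ge[OF t u g g0] by (intro mult_left_mono h_add_ge_M t u) auto
    moreover have "R * (Cond u t g x * ?H x) \<le> R * (M u * T t g x)"
      using calculation(1) R_ge_1 by (intro mult_left_mono) auto
    ultimately have "M u * (Cond u t g x * h t x) \<le> M u * (R * T t g x)"
      by (simp only: mult.assoc mult.left_commute mult.commute)
    then have 1: "Cond u t g x * h t x / R \<le> T t g x" using Mu R_ge_1 by (simp add: field_simps)
    have "T t (\<lambda>z. M u / R * g z) y \<le> T t (\<lambda>z. h u z * g z) y"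
    proof -
      have "M u / R * g z \<le> h u z * g z" for z
        using M_le_h[OF u, of z] R_ge_1 g0[of z] by (intro mult_right_mono) (auto simp: field_simps)
      then show ?thesis using gl(2) by (auto intro: T_mono[OF t _ m])
    qed
    then have "M u / R * T t g y \<le> Cond u t g y * ?H y"
      using T_scale[OF t g, of "M u / R" y] H[of y] by (simp add: Cond_def)
    also have "\<dots> \<le> Cond u t g y * (M u * 1)"
    proof -
      have "?H y \<le> M u * h t y" by (rule h_add_le[OF t u])
      also have "\<dots> \<le> M u * 1" using Mu mass_le[OF t] by (intro mult_left_mono) auto
      finally show ?thesis using cond_ge[OF t u g g0] by (intro mult_left_mono) auto
    qed
    finally have "T t g y / R \<le> Cond u t g y" using Mu R_ge_1 by (simp add: field_simps)
    moreover have "exp (- r * t) * (T t g x - l * C * exp (- \<gamma> * t) * h t x * D) \<le> T t g y"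
      by (rule comparison[OF t g g0])
    ultimately have 2: "exp (- r * t) / R * (T t g x - l * k * h t x) \<le> Cond u t g y"
      using R_ge_1 by (simp add: k_def field_simps)
    define \<Delta> where "\<Delta> = Cond u t g x / R - l * k"
    have "c' * \<Delta> \<le> Cond u t g y"
    proof (cases "0 \<le> \<Delta>")
      case True
      have "c' * \<Delta> \<le> exp (- r * t) / R * (h t x * \<Delta>)"
      proof -
        have "exp (- r * t) / R * (exp (- r * t) * \<Delta>) \<le> exp (- r * t) / R * (h t x * \<Delta>)"
          using R_ge_1 by (intro mult_left_mono mult_right_mono mass_ge[OF t] True) auto
        then show ?thesis by (simp add: c'_def)
      qed
      also have "\<dots> \<le> exp (- r * t) / R * (T t g x - l * k * h t x)"
        using 1 R_ge_1 by (intro mult_left_mono) (auto simp: \<Delta>_def algebra_simps)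
      finally show ?thesis using 2 by linarith
    next
      case False
      then have "c' * \<Delta> \<le> 0" using c' by (simp add: mult_le_0_iff)
      then show ?thesis using cond_ge[OF t u g g0, of y] by linarith
    qed
    moreover have "c' * \<Delta> = c * Cond u t g x - c * (R * k) * l"
      using R_ge_1 by (simp add: \<Delta>_def c'(2) field_simps)
    ultimately have "Cond u t g x - Cond u t g y \<le> (1 - c) * Cond u t g x + c * (R * k) * l"
      by (simp add: algebra_simps)
    also have "\<dots> \<le> (1 - c) * b + c * (R * k) * l"
    proof -
      have "exp (- 2 * r * t) \<le> 1" using r_nonneg nonneg_I[OF t] by simp
      also have "1 \<le> R * R" using R_ge_1 mult_mono[of 1 R 1 R] by simp
      finally have "c \<le> 1" unfolding c_def using R_ge_1 by simp
      then show ?thesis using cond_le[OF t u g gb] by (intro add_right_mono mult_left_mono) auto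
    qed
    finally show ?thesis .
  qed
  have "Cond u t f x - Cond u t f y = Cond u t g x - Cond u t g y" "Cond u t f y - Cond u t f x
      = Cond u t g y - Cond u t g x"
    using cond_shift[OF t u f, of "INF x. f x"] by (simp_all add: g_def)
  then show ?thesis using main[of x y] main[of y x] by (simp add: k_def mult.assoc)
qed

lemma cond_osc_le:
  assumes t: "t \<in> I" and u: "u \<in> I" and f: "l-lipschitz_on UNIV f" and osc: "\<And>x y. \<bar>f x - f y\<bar> \<le> b"
  shows "\<bar>Cond u t f x - Cond u t f y\<bar> \<le> b"
proof -
  have le: "f z - b \<le> f w" for z w using osc[of z w] by linarith
  have *: "f z - b \<le> Cond u t f w" for z w by (rule cond_ge[OF t u f le])
  have "Cond u t f x \<le> Cond u t f y + b" for x y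
  proof -
    have "f z \<le> Cond u t f y + b" for z using *[of z y] by linarith
    then show ?thesis by (intro cond_le[OF t u f])
  qed
  from this[of x y] this[of y x] show ?thesis by linarith
qed

text \<open>
The contributions of the oscillation at the successive steps are damped geometrically, so their
sum is bounded uniformly in \<open>n\<close>.
\<close>
lemma cond_iterate_lip:
  assumes \<tau>: "\<tau> \<in> I" and half: "R * C * exp (- \<gamma> * \<tau>) \<le> 1/2" and u: "u \<in> I"
    and f: "l-lipschitz_on UNIV f" and osc: "\<And>x y. \<bar>f x - f y\<bar> \<le> b"
  shows "((1/2) ^ n * l + 2 * osc_coeff \<tau> * b)-lipschitz_on UNIV (Cond u (real n * \<tau>) f)"
proof (induction n)
  case 0
  have "Cond u 0 f = f" by (rule cond_zero[OF u f])
  moreover have "0 \<le> b" using osc[of undefined undefined] by simp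
  ultimately show ?case using f osc_coeff_pos[OF nonneg_I[OF \<tau>]] by (auto elim!: lipschitz_on_mono)
next
  case (Suc n)
  let ?l = "(1/2) ^ n * l + 2 * osc_coeff \<tau> * b"
  have n: "real n * \<tau> \<in> I" by (rule mult_I[OF \<tau>])
  have l0: "0 \<le> ?l" using Suc lipschitz_on_nonneg by blast
  have new: "(R * C * exp (- \<gamma> * \<tau>) * ?l + osc_coeff \<tau> * b)-lipschitz_on UNIV (Cond (real n * \<tau>
      + u) \<tau> (Cond u (real n * \<tau>) f))"
    by (intro cond_lasota_yorke[OF \<tau> add_I[OF n u] Suc] cond_osc_le[OF n u f osc])
  have eq: "Cond (real n * \<tau> + u) \<tau> (Cond u (real n * \<tau>) f) = Cond u (real (Suc n) * \<tau>) f"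
    using cond_compose[OF \<tau> n u f] by (simp add: algebra_simps)
  have "R * C * exp (- \<gamma> * \<tau>) * ?l + osc_coeff \<tau> * b \<le> (1/2) ^ Suc n * l + 2 * osc_coeff \<tau> * b"
  proof -
    have "R * C * exp (- \<gamma> * \<tau>) * ?l \<le> 1/2 * ?l" by (rule mult_right_mono[OF half l0])
    then show ?thesis by (simp add: algebra_simps)
  qed
  from lipschitz_on_mono[OF new[unfolded eq] subset_refl this] show ?case .
qed

text \<open>
The quantity that contracts is \<open>max (osc f) (\<beta> Lip f)\<close>. The weight \<open>\<beta>\<close> is chosen first, small
enough for the Lipschitz constant to contract by \<open>cond_iterate_lip\<close>; then the time \<open>\<sigma>\<close>, large
enough for the last term of \<open>cond_osc\<close> to be at most \<open>c / 2\<close> times this quantity.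
\<close>
lemma contraction_step:
  "\<exists>\<sigma>\<in>I. \<exists>\<beta>>0. \<exists>q. 0 < \<sigma> \<and> 0 < q \<and> q < 1
      \<and> (\<forall>u\<in>I. \<forall>a f. (a / \<beta>)-lipschitz_on UNIV f \<and> (\<forall>x y. \<bar>f x - f y\<bar> \<le> a) \<longrightarrow>
     (q * a / \<beta>)-lipschitz_on UNIV (Cond u \<sigma> f) \<and> (\<forall>x y. \<bar>Cond u \<sigma> f x - Cond u \<sigma> f y\<bar> \<le> q * a))"
proof -
  have lim: "(\<lambda>n. A * exp (- \<gamma> * real n)) \<longlonglongrightarrow> 0" for A
  proof -
    have "(\<lambda>n. A * exp (- \<gamma>) ^ n) \<longlonglongrightarrow> A * 0"
      using \<gamma>_pos by (intro tendsto_intros LIMSEQ_realpow_zero) auto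
    then show ?thesis by (simp add: exp_of_nat_mult[symmetric] mult.commute)
  qed
  have "eventually (\<lambda>n. R * C * exp (- \<gamma> * real n) < 1/2) sequentially"
    by (rule order_tendstoD[OF lim]) simp
  then obtain \<tau> :: nat where \<tau>: "\<tau> \<ge> 1" "R * C * exp (- \<gamma> * real \<tau>) \<le> 1/2"
    unfolding eventually_sequentially using less_imp_le by (metis max.cobounded1 max.cobounded2)
  define W where "W = 2 * osc_coeff (real \<tau>)"
  have W: "0 < W" using osc_coeff_pos[of "real \<tau>"] by (simp add: W_def)
  define \<beta> where "\<beta> = 1 / (4 * W)"
  have \<beta>: "0 < \<beta>" using W by (simp add: \<beta>_def)
  have "eventually (\<lambda>n. (R * C * D / \<beta>) * exp (- \<gamma> * real n) < 1/2) sequentially"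
    by (rule order_tendstoD[OF lim]) simp
  then obtain n :: nat where n: "n \<ge> 1" "\<And>m. m \<ge> n \<Longrightarrow> (R * C * D / \<beta>) * exp (- \<gamma> * real m) \<le> 1/2"
    unfolding eventually_sequentially using less_imp_le by (metis max.boundedE max.cobounded2)
  define \<sigma> where "\<sigma> = real n * real \<tau>"
  have \<sigma>: "\<sigma> \<in> I" "0 < \<sigma>" unfolding \<sigma>_def using mult_I[OF nat_I] n(1) \<tau>(1) by auto
  have "n \<le> n * \<tau>" using \<tau>(1) by simp
  from n(2)[OF this] have small: "(R * C * D / \<beta>) * exp (- \<gamma> * \<sigma>) \<le> 1/2" by (simp add: \<sigma>_def)
  define c where "c = exp (- 2 * r * \<sigma>) / (R * R)"
  have c: "0 < c" using R_ge_1 by (simp add: c_def)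
  define q where "q = max (3/4) (1 - c / 2)"
  have q: "0 < q" "q < 1" using c by (auto simp: q_def)
  have main: "\<forall>u\<in>I. \<forall>a f. (a / \<beta>)-lipschitz_on UNIV f \<and> (\<forall>x y. \<bar>f x - f y\<bar> \<le> a) \<longrightarrow>
     (q * a / \<beta>)-lipschitz_on UNIV (Cond u \<sigma> f) \<and> (\<forall>x y. \<bar>Cond u \<sigma> f x - Cond u \<sigma> f y\<bar> \<le> q * a)"
  proof (intro ballI allI impI)
    fix u a and f :: "'a \<Rightarrow> real" assume u: "u \<in> I"
      and "(a / \<beta>)-lipschitz_on UNIV f \<and> (\<forall>x y. \<bar>f x - f y\<bar> \<le> a)"
    then have f: "(a / \<beta>)-lipschitz_on UNIV f" and osc: "\<forall>x y. \<bar>f x - f y\<bar> \<le> a" by auto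
    have a: "0 \<le> a" using osc[rule_format, of undefined undefined] by simp
    have "((1/2) ^ n * (a / \<beta>) + W * a)-lipschitz_on UNIV (Cond u \<sigma> f)"
      unfolding \<sigma>_def W_def using \<tau> osc by (intro cond_iterate_lip nat_I u f) auto
    moreover have "(1/2) ^ n * (a / \<beta>) + W * a \<le> q * a / \<beta>"
    proof -
      have "(1/2::real) ^ n \<le> (1/2) ^ 1" using n(1) by (intro power_decreasing) auto
      then have "(1/2) ^ n * (a / \<beta>) \<le> 1/2 * (a / \<beta>)" using a \<beta> by (intro mult_right_mono) auto
      moreover have "W * a = 1/4 * (a / \<beta>)" using W by (simp add: \<beta>_def)
      moreover have "3/4 * (a / \<beta>) \<le> q * (a / \<beta>)" using a \<beta>
        by (intro mult_right_mono) (auto simp: q_def)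
      ultimately show ?thesis by simp
    qed
    ultimately have "(q * a / \<beta>)-lipschitz_on UNIV (Cond u \<sigma> f)"
      by (metis lipschitz_on_mono order_refl)
    moreover have "\<bar>Cond u \<sigma> f x - Cond u \<sigma> f y\<bar> \<le> q * a" for x y
    proof -
      have "\<bar>Cond u \<sigma> f x - Cond u \<sigma> f y\<bar> \<le> (1 - c) * a + c * (R * C * exp (- \<gamma> * \<sigma>) * D) * (a / \<beta>)"
        unfolding c_def using osc by (intro cond_osc \<sigma> u f) auto
      also have "\<dots> = (1 - c) * a + c * a * ((R * C * D / \<beta>) * exp (- \<gamma> * \<sigma>))"
        by (simp add: field_simps)
      also have "\<dots> \<le> (1 - c) * a + c * a * (1/2)"
        using c a small by (intro add_left_mono mult_left_mono) auto
      also have "\<dots> = (1 - c/2) * a" by (simp add: algebra_simps)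
      also have "\<dots> \<le> q * a" using a by (intro mult_right_mono) (auto simp: q_def)
      finally show ?thesis .
    qed
    ultimately show "(q * a / \<beta>)-lipschitz_on UNIV (Cond u \<sigma> f)
        \<and> (\<forall>x y. \<bar>Cond u \<sigma> f x - Cond u \<sigma> f y\<bar> \<le> q * a)"
      by blast
  qed
  show ?thesis by (intro bexI[of _ \<sigma>] exI[of _ \<beta>] exI[of _ q] conjI main \<sigma> \<beta> q)
qed

text \<open>
For \<open>u = 0\<close> the conditioned kernel is \<open>f \<mapsto> T t f / h t\<close>; a time \<open>t\<close> is split into steps of length
\<open>\<sigma>\<close> and a remainder.
\<close>
lemma contraction:
  "\<exists>C1>0. \<exists>\<alpha>>0. \<forall>t\<in>I. \<forall>f. 1-lipschitz_on UNIV f \<longrightarrow>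
     (\<forall>x y. \<bar>T t f x / h t x - T t f y / h t y\<bar> \<le> C1 * exp (- \<alpha> * t) * dist x y)"
proof -
  obtain \<sigma> \<beta> q where \<sigma>: "\<sigma> \<in> I" "0 < \<sigma>" and \<beta>: "0 < \<beta>" and q: "0 < q" "q < 1"
    and step: "\<And>u a f. u \<in> I \<Longrightarrow> (a / \<beta>)-lipschitz_on UNIV f \<Longrightarrow> (\<And>x y. \<bar>f x - f y\<bar> \<le> a) \<Longrightarrow>
       (q * a / \<beta>)-lipschitz_on UNIV (Cond u \<sigma> f) \<and> (\<forall>x y. \<bar>Cond u \<sigma> f x - Cond u \<sigma> f y\<bar> \<le> q * a)"
    using contraction_step by metis
  have iter: "(q ^ j * a / \<beta>)-lipschitz_on UNIV (Cond 0 (real j * \<sigma>) f) \<and>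
      (\<forall>x y. \<bar>Cond 0 (real j * \<sigma>) f x - Cond 0 (real j * \<sigma>) f y\<bar> \<le> q ^ j * a)"
    if f: "(a / \<beta>)-lipschitz_on UNIV f" and osc: "\<And>x y. \<bar>f x - f y\<bar> \<le> a" for a f j
  proof (induction j)
    case 0
    have "Cond 0 0 f = f" using cond_zero[OF _ f, of 0] nat_I[of 0] by simp
    then show ?case using f osc by simp
  next
    case (Suc j)
    have j: "real j * \<sigma> \<in> I" by (rule mult_I[OF \<sigma>(1)])
    have "Cond 0 (real (Suc j) * \<sigma>) f = Cond (real j * \<sigma>) \<sigma> (Cond 0 (real j * \<sigma>) f)"
      using cond_compose[OF \<sigma>(1) j _ f, of 0] nat_I[of 0] by (simp add: algebra_simps)
    then show ?case using step[OF j, of "q ^ j * a" "Cond 0 (real j * \<sigma>) f"] Suc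
      by (simp add: mult.assoc)
  qed
  define \<alpha> where "\<alpha> = - ln q / \<sigma>"
  have \<alpha>: "0 < \<alpha>" using q \<sigma> by (simp add: \<alpha>_def divide_neg_pos)
  define a where "a = \<beta> + D"
  define E where "E = (R * C / \<beta> + osc_coeff \<sigma>) * a / q"
  have a: "0 < a" using \<beta> D_nonneg by (simp add: a_def)
  have E1: "0 < R * C / \<beta> + osc_coeff \<sigma>"
    using R_ge_1 C_pos \<beta> osc_coeff_pos[of \<sigma>] \<sigma> by (intro add_nonneg_pos) auto
  have E: "0 < E" unfolding E_def using E1 a q by simp
  have "\<bar>T t f x / h t x - T t f y / h t y\<bar> \<le> E * exp (- \<alpha> * t) * dist x y"
    if t: "t \<in> I" and f: "1-lipschitz_on UNIV f" for t f x y
  proof -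
    have fl: "(a / \<beta>)-lipschitz_on UNIV f"
      by (rule lipschitz_on_mono[OF f]) (use \<beta> D_nonneg in \<open>auto simp: a_def field_simps\<close>)
    have fo: "\<bar>f x - f y\<bar> \<le> a" for x y
      using lipschitz_onD[OF f, of x y] dist_le[of x y] \<beta> by (simp add: a_def dist_real_def)
    define j where "j = nat \<lfloor>t / \<sigma>\<rfloor>"
    have ts: "0 \<le> t / \<sigma>" using nonneg_I[OF t] \<sigma> by auto
    have jj: "real j \<le> t / \<sigma>" "t / \<sigma> < real j + 1" unfolding j_def using ts by linarith+
    define v where "v = t - real j * \<sigma>"
    have j: "real j * \<sigma> \<in> I" by (rule mult_I[OF \<sigma>(1)])
    have le: "real j * \<sigma> \<le> t" using jj(1) \<sigma> by (simp add: field_simps)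
    have v: "v \<in> I" unfolding v_def by (rule diff_I[OF j t le])
    have v\<sigma>: "v \<le> \<sigma>" using jj(2) \<sigma> by (simp add: v_def field_simps)
    have v0: "0 \<le> v" using nonneg_I[OF v] .
    let ?g = "Cond 0 (real j * \<sigma>) f"
    have comp: "Cond 0 t f = Cond (real j * \<sigma>) v ?g"
      using cond_compose[OF v j _ f, of 0] nat_I[of 0] by (simp add: v_def)
    have g: "(q ^ j * a / \<beta>)-lipschitz_on UNIV ?g" "\<And>x y. \<bar>?g x - ?g y\<bar> \<le> q ^ j * a"
      using iter[OF fl fo] by blast+
    have "(R * C * exp (- \<gamma> * v) * (q ^ j * a / \<beta>) + osc_coeff v * (q ^ j
        * a))-lipschitz_on UNIV (Cond 0 t f)"
      unfolding comp by (rule cond_lasota_yorke[OF v j g])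
    from lipschitz_onD[OF this, of x y]
    have "\<bar>Cond 0 t f x - Cond 0 t f y\<bar>
        \<le> (R * C * exp (- \<gamma> * v) * (q ^ j * a / \<beta>) + osc_coeff v * (q ^ j * a)) * dist x y"
      by (simp add: dist_real_def)
    also have "\<dots> \<le> (R * C * 1 * (q ^ j * a / \<beta>) + osc_coeff \<sigma> * (q ^ j * a)) * dist x y"
      using R_ge_1 C_pos q a \<beta> \<gamma>_pos v0 osc_coeff_mono[OF v0 v\<sigma>]
      by (intro mult_right_mono add_mono mult_left_mono) auto
    also have "\<dots> = (R * C / \<beta> + osc_coeff \<sigma>) * a * q ^ j * dist x y" by (simp add: field_simps)
    also have "\<dots> \<le> (R * C / \<beta> + osc_coeff \<sigma>) * a * (exp (- \<alpha> * t) / q) * dist x y"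
    proof -
      have "q ^ j * q = exp (- \<alpha> * ((real j + 1) * \<sigma>))"
      proof -
        have "exp (- \<alpha> * ((real j + 1) * \<sigma>)) = exp (real (Suc j) * ln q)"
          using \<sigma> by (simp add: \<alpha>_def field_simps)
        also have "\<dots> = q ^ Suc j" using q by (simp only: exp_of_nat_mult exp_ln)
        finally show ?thesis by simp
      qed
      also have "\<dots> \<le> exp (- \<alpha> * t)"
      proof -
        have "t \<le> (real j + 1) * \<sigma>" using jj(2) \<sigma> by (simp add: field_simps)
        then show ?thesis using \<alpha> by simp
      qed
      finally have "q ^ j \<le> exp (- \<alpha> * t) / q" using q by (simp add: field_simps)
      then show ?thesis using E1 a by (intro mult_right_mono mult_left_mono) auto
    qed
    also have "\<dots> = E * exp (- \<alpha> * t) * dist x y" by (simp add: E_def)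
    finally show ?thesis by (simp add: Cond_def h_0)
  qed
  then show ?thesis using E \<alpha> by blast
qed

end

section \<open>Penalizations and cylinder functions\<close>

lemma integrable_bounded_measurable:
  fixes f :: "'a \<Rightarrow> real"
  assumes "finite_measure M" "f \<in> borel_measurable M" "\<And>x. x \<in> space M \<Longrightarrow> \<bar>f x\<bar> \<le> B"
  shows "integrable M f"
  using assms by (intro finite_measure.integrable_const_bound[of M f B]) auto

lemma integral_bind_kernel:
  fixes f :: "'b \<Rightarrow> real"
  assumes M: "finite_measure M" "space M \<noteq> {}" and K: "K \<in> M \<rightarrow>\<^sub>M prob_algebra N"
    and f: "f \<in> borel_measurable N" and B: "\<And>x. x \<in> space N \<Longrightarrow> \<bar>f x\<bar> \<le> B"
  shows "(\<integral>x. f x \<partial>(M \<bind> K)) = (\<integral>x. (\<integral>y. f y \<partial>K x) \<partial>M)"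
proof -
  have K': "K \<in> M \<rightarrow>\<^sub>M subprob_algebra N" by (rule measurable_prob_algebraD[OF K])
  have "(\<integral>x. f x \<partial>(M \<bind> K)) = (\<integral>x. f x \<partial>join (distr M (subprob_algebra N) K))"
    by (simp add: bind_nonempty''[OF K' M(2)])
  also have "\<dots> = (\<integral>M'. (\<integral>y. f y \<partial>M') \<partial>distr M (subprob_algebra N) K)"
  proof (rule integral_join[OF f _ _ _ _, where B = B and B' = 1])
    show "finite_measure (distr M (subprob_algebra N) K)"
      by (rule finite_measure.finite_measure_distr[OF M(1) K'])
    show "AE M' in distr M (subprob_algebra N) K. emeasure M' (space M') \<le> ennreal 1"
      by (intro AE_I2) (auto simp: space_subprob_algebra dest: subprob_space.emeasure_space_le_1)
  qed (use B in auto)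
  also have "\<dots> = (\<integral>x. (\<integral>y. f y \<partial>K x) \<partial>M)"
    by (rule integral_distr[OF K' integral_measurable_subprob_algebra[OF f]])
  finally show ?thesis .
qed

text \<open>
A function of finitely many coordinates of a path, in product form; the times need not be sorted
or distinct.
\<close>
definition cylinder :: "(real \<times> ('a \<Rightarrow> real)) list \<Rightarrow> (real \<Rightarrow> 'w \<Rightarrow> 'a) \<Rightarrow> 'w \<Rightarrow> real" where
  "cylinder K X \<omega> = prod_list (map (\<lambda>(u, g). g (X u \<omega>)) K)"

definition test_list :: "real set \<Rightarrow> (real \<times> ('a::topological_space \<Rightarrow> real)) list \<Rightarrow> bool" where
  "test_list J K \<longleftrightarrow> (\<forall>(u, g) \<in> set K. u \<in> J \<and> g \<in> borel_measurable borel \<and> bounded (range g))"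

lemma cylinder_simps: "cylinder [] X \<omega> = 1" "cylinder ((u, g) # K) X \<omega> = g (X u \<omega>) * cylinder K X \<omega>"
  by (simp_all add: cylinder_def)

lemma test_list_simps: "test_list J []"
  "test_list J ((u, g) # K) \<longleftrightarrow> u \<in> J \<and> g \<in> borel_measurable borel \<and> bounded (range g)
      \<and> test_list J K"
  by (auto simp: test_list_def)

lemma cylinder_measurable:
  assumes "test_list J K" "\<And>u. u \<in> J \<Longrightarrow> X u \<in> M \<rightarrow>\<^sub>M borel"
  shows "cylinder K X \<in> borel_measurable M"
  using assms(1)
proof (induction K)
  case Nil then show ?case by (simp add: cylinder_simps(1)[abs_def] cong: measurable_cong)
next
  case (Cons p K)
  obtain u g where p: "p = (u, g)" by force
  have "(\<lambda>\<omega>. g (X u \<omega>)) \<in> borel_measurable M"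
    using Cons p assms(2)[of u] by (auto simp: test_list_simps)
  then show ?case using Cons p by (simp add: cylinder_simps[abs_def] test_list_simps)
qed

lemma cylinder_bounded: "test_list J K
    \<Longrightarrow> \<exists>B\<ge>0. \<forall>(X :: real \<Rightarrow> 'w \<Rightarrow> 'a::topological_space) \<omega>. \<bar>cylinder K X \<omega>\<bar> \<le> B"
proof (induction K)
  case Nil then show ?case by (intro exI[of _ 1]) (simp add: cylinder_simps)
next
  case (Cons p K)
  obtain u g where p: "p = (u, g)" by force
  have "test_list J K" using Cons.prems p by (simp add: test_list_simps)
  from Cons.IH[OF this] obtain B where B: "B \<ge> 0" "\<And>(X :: real \<Rightarrow> 'w \<Rightarrow> 'a) \<omega>. \<bar>cylinder K X \<omega>\<bar> \<le> B"
    by blast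
  obtain A where A: "\<And>x. \<bar>g x\<bar> \<le> A" using Cons p by (auto simp: test_list_simps bounded_iff)
  have "\<bar>cylinder (p # K) X \<omega>\<bar> \<le> A * B" for X :: "real \<Rightarrow> 'w \<Rightarrow> 'a" and \<omega>
    unfolding p cylinder_simps abs_mult using A B
      by (intro mult_mono order_trans[OF abs_ge_zero A]) auto
  then show ?case using B A order_trans[OF abs_ge_zero A] by (intro exI[of _ "A * B"]) auto
qed

lemma time_setI:
  assumes "I = {0..} \<or> I = (\<nat> :: real set)" "s \<in> I" "t \<in> I"
  shows "0 \<le> t" "s + t \<in> I" "s \<le> t \<Longrightarrow> t - s \<in> I" "real n \<in> I"
  using assms by (auto intro: Nats_add Nats_diff elim: Nats_cases)

lemma nats_not_atLeast: "(\<nat> :: real set) \<noteq> {0..}"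
proof
  assume "(\<nat> :: real set) = {0..}"
  moreover have "(1/2 :: real) \<in> {0..}" by simp
  ultimately have "(1/2 :: real) \<in> \<nat>" by (simp only:)
  then obtain n where "(1/2 :: real) = of_nat n" by (auto simp: Nats_def)
  then have "2 * n = 1" by linarith
  then show False by presburger
qed

lemma set_integral_measurable:
  fixes g :: "real \<Rightarrow> 'w \<Rightarrow> real"
  assumes "(\<lambda>(s, \<omega>). g s \<omega>) \<in> borel_measurable (restrict_space borel {0..t} \<Otimes>\<^sub>M N)"
  shows "(\<lambda>\<omega>. LBINT s:{0..t}. g s \<omega>) \<in> borel_measurable N"
proof -
  let ?L = "restrict_space lborel {0..t}"
  have eq: "(LBINT s:{0..t}. g s \<omega>) = (\<integral>s. g s \<omega> \<partial>?L)" for \<omega>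
    by (simp add: set_lebesgue_integral_def integral_restrict_space)
  interpret sigma_finite_measure ?L
    by (rule sigma_finite_measure_restrict_space) (auto intro: lborel.sigma_finite_measure_axioms)
  have "sets ?L = sets (restrict_space borel {0..t})" by (rule sets_restrict_space_cong) simp
  then have "(\<lambda>(s, \<omega>). g s \<omega>) \<in> borel_measurable (?L \<Otimes>\<^sub>M N)"
    using assms by (simp cong: measurable_cong_sets sets_pair_measure_cong)
  then have "(\<lambda>p. g (snd p) (fst p)) \<in> borel_measurable (N \<Otimes>\<^sub>M ?L)"
    using measurable_compose[OF measurable_pair_swap', of "\<lambda>(s, \<omega>). g s \<omega>" ?L N borel]
      by (simp add: split_beta')
  then have "case_prod (\<lambda>\<omega> s. g s \<omega>) \<in> borel_measurable (N \<Otimes>\<^sub>M ?L)"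
    by (simp add: split_beta')
  then show ?thesis unfolding eq by (rule borel_measurable_lebesgue_integral)
qed

definition jointly_measurable :: "real set \<Rightarrow> real \<Rightarrow> 'w measure \<Rightarrow> (real \<Rightarrow> 'w \<Rightarrow> 'a::topological_space)
    \<Rightarrow> bool" where
  "jointly_measurable I t N X \<longleftrightarrow> (\<lambda>(s, \<omega>). X s \<omega>) \<in> restrict_space borel (I \<inter> {..t}) \<Otimes>\<^sub>M N \<rightarrow>\<^sub>M borel"

lemma jointly_measurable_section:
  assumes "jointly_measurable I t N X" "s \<in> I" "s \<le> t"
  shows "X s \<in> N \<rightarrow>\<^sub>M borel"
proof -
  have "(\<lambda>\<omega>. (s, \<omega>)) \<in> N \<rightarrow>\<^sub>M restrict_space borel (I \<inter> {..t}) \<Otimes>\<^sub>M N"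
    using assms(2,3) by (intro measurable_Pair measurable_const) (auto simp: space_restrict_space)
  from measurable_compose[OF this assms(1)[unfolded jointly_measurable_def]] show ?thesis by simp
qed

lemma jointly_measurable_interval:
  assumes "jointly_measurable {0..} t N X" "\<rho> \<in> borel_measurable borel"
  shows "(\<lambda>(s, \<omega>). \<rho> (X s \<omega>)) \<in> borel_measurable (restrict_space borel {0..t} \<Otimes>\<^sub>M N)"
proof -
  have "{0..} \<inter> {..t} = {0..t}" by auto
  then have "(\<lambda>p. X (fst p) (snd p)) \<in> restrict_space borel {0..t} \<Otimes>\<^sub>M N \<rightarrow>\<^sub>M borel"
    using assms(1) by (simp add: jointly_measurable_def split_beta')
  from measurable_compose[OF this assms(2)] show ?thesis by (simp add: split_beta')
qed

lemma penalization_measurable: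
  assumes I: "I = {0..} \<or> I = \<nat>" and t: "t \<in> I" and X: "jointly_measurable I t N X"
    and \<rho>: "\<rho> \<in> borel_measurable borel"
  shows "penalization I \<rho> X t \<in> borel_measurable N"
proof (cases "I = {0..}")
  case True
  with X have "(\<lambda>\<omega>. LBINT s:{0..t}. \<rho> (X s \<omega>)) \<in> borel_measurable N"
    by (intro set_integral_measurable jointly_measurable_interval \<rho>) simp
  then have "(\<lambda>\<omega>. exp (- (LBINT s:{0..t}. \<rho> (X s \<omega>)))) \<in> borel_measurable N" by measurable
  then show ?thesis using True unfolding penalization_def[abs_def] by simp
next
  case False
  then have N: "I = \<nat>" using I by simp
  have "(\<lambda>\<omega>. exp (- \<rho> (X (real k) \<omega>))) \<in> borel_measurable N" if "k < nat \<lfloor>t\<rfloor>" for k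
  proof -
    have "real k \<le> t" using that by linarith
    then have [measurable]: "X (real k) \<in> N \<rightarrow>\<^sub>M borel" using X N
      by (intro jointly_measurable_section) auto
    note [measurable] = \<rho>
    show ?thesis by measurable
  qed
  then show ?thesis using False unfolding penalization_def[abs_def] by simp
qed

lemma killing_integral_bounds:
  assumes X: "jointly_measurable {0..} t N X" and \<rho>: "\<rho> \<in> borel_measurable borel"
    and b: "\<And>x. 0 \<le> \<rho> x" "\<And>x. \<rho> x \<le> (c::real)" and t: "0 \<le> t" and \<omega>: "\<omega> \<in> space N"
  shows "set_integrable lborel {0..t} (\<lambda>s. \<rho> (X s \<omega>))" "0
      \<le> (LBINT s:{0..t}. \<rho> (X s \<omega>))" "(LBINT s:{0..t}. \<rho> (X s \<omega>)) \<le> c * t"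
proof -
  have "(\<lambda>s. (s, \<omega>)) \<in> restrict_space borel {0..t} \<rightarrow>\<^sub>M restrict_space borel {0..t} \<Otimes>\<^sub>M N"
    using \<omega> by (intro measurable_Pair measurable_const) auto
  from measurable_compose[OF this jointly_measurable_interval[OF X \<rho>]]
  have "(\<lambda>s. \<rho> (X s \<omega>)) \<in> borel_measurable (restrict_space borel {0..t})" by simp
  then have m: "set_borel_measurable lborel {0..t} (\<lambda>s. \<rho> (X s \<omega>))"
    using borel_measurable_restrict_space_iff[of "{0..t}" borel "\<lambda>s. \<rho> (X s \<omega>)"]
    by (simp add: set_borel_measurable_def)
  have ci: "set_integrable lborel {0..t} (\<lambda>_. c)"
    unfolding set_integrable_def
    by (intro integrable_scaleR_left integrable_real_indicator) (auto simp: emeasure_lborel_Icc_eq)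
  show i: "set_integrable lborel {0..t} (\<lambda>s. \<rho> (X s \<omega>))"
    by (rule set_integrable_bound[OF ci m]) (use b in \<open>auto intro!: AE_I2 order_trans[OF _
        abs_ge_self]\<close>)
  show "0 \<le> (LBINT s:{0..t}. \<rho> (X s \<omega>))"
    unfolding set_lebesgue_integral_def using b by (intro Bochner_Integration.integral_nonneg) auto
  have "(LBINT s:{0..t}. \<rho> (X s \<omega>)) \<le> (LBINT s:{0..t}. c)"
    by (rule set_integral_mono[OF i ci]) (use b in auto)
  also have "\<dots> = c * t" using t by (simp add: set_lebesgue_integral_def)
  finally show "(LBINT s:{0..t}. \<rho> (X s \<omega>)) \<le> c * t" .
qed

lemma penalization_bounds:
  assumes I: "I = {0..} \<or> I = \<nat>" and t: "t \<in> I" and X: "jointly_measurable I t N X"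
    and \<rho>: "\<rho> \<in> borel_measurable borel"
    and b: "\<And>x. 0 \<le> \<rho> x" "\<And>x. \<rho> x \<le> (c::real)" and \<omega>: "\<omega> \<in> space N"
  shows "exp (- c * t) \<le> penalization I \<rho> X t \<omega>" "penalization I \<rho> X t \<omega> \<le> 1"
proof -
  have t0: "0 \<le> t" using time_setI(1)[OF I t t] .
  have "exp (- c * t) \<le> penalization I \<rho> X t \<omega> \<and> penalization I \<rho> X t \<omega> \<le> 1"
  proof (cases "I = {0..}")
    case True
    then show ?thesis
      using killing_integral_bounds[of t N X \<rho> c, OF _ \<rho> b t0 \<omega>] X by (simp add: penalization_def)
  next
    case False
    then obtain n where n: "t = real n" using I t by (auto elim: Nats_cases)
    have "(\<Prod>k<n. exp (- c)) \<le> (\<Prod>k<n. exp (- \<rho> (X (real k) \<omega>)))" using b by (intro prod_mono) auto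
    moreover have "(\<Prod>k<n. exp (- \<rho> (X (real k) \<omega>))) \<le> (\<Prod>k<n. 1)" using b by (intro prod_mono) auto
    moreover have "(\<Prod>k<n. exp (- c)) = exp (- c * t)"
      by (simp add: n exp_of_nat_mult[symmetric] mult.commute)
    ultimately show ?thesis using False by (simp add: penalization_def n)
  qed
  then show "exp (- c * t) \<le> penalization I \<rho> X t \<omega>" "penalization I \<rho> X t \<omega> \<le> 1" by auto
qed

section \<open>Finite-dimensional laws determine penalized expectations\<close>

text \<open>
One factor of the power is written as an integral over \<open>s\<close>, exchanged with the expectation, and
becomes one more factor \<open>\<rho> (X s)\<close> of the cylinder function.
\<close>
lemma moment_step:
  fixes X :: "real \<Rightarrow> 'w \<Rightarrow> 'a::topological_space"
  assumes Q: "finite_measure Q" and X: "jointly_measurable {0..} t Q X" and t: "0 \<le> t"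
    and \<rho>: "\<rho> \<in> borel_measurable borel" "\<And>x. 0 \<le> \<rho> x" "\<And>x. \<rho> x \<le> (c::real)"
      and K: "test_list {0..t} K"
  defines "J \<equiv> \<lambda>\<omega>. LBINT s:{0..t}. \<rho> (X s \<omega>)"
  shows "(\<integral>\<omega>. J \<omega> ^ Suc k * cylinder K X \<omega> \<partial>Q)
    = (\<integral>s. (\<integral>\<omega>. J \<omega> ^ k * cylinder ((s, \<rho>) # K) X \<omega> \<partial>Q) \<partial>restrict_space lborel {0..t})"
proof -
  let ?L = "restrict_space lborel {0..t}"
  interpret Q: finite_measure Q by fact
  have L: "finite_measure ?L"
    by (rule finite_measureI) (simp add: space_restrict_space emeasure_restrict_space
      emeasure_lborel_Icc_eq)
  interpret L: finite_measure ?L by fact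
  interpret pair_sigma_finite ?L Q ..
  have sL: "sets ?L = sets (restrict_space borel {0..t})" by (rule sets_restrict_space_cong) simp
  have J_eq: "J \<omega> = (\<integral>s. \<rho> (X s \<omega>) \<partial>?L)" for \<omega>
    unfolding J_def by (simp add: set_lebesgue_integral_def integral_restrict_space)
  have Jm[measurable]: "J \<in> borel_measurable Q"
    unfolding J_def by (intro set_integral_measurable jointly_measurable_interval X \<rho>)
  have Jb: "0 \<le> J \<omega>" "J \<omega> \<le> c * t" if "\<omega> \<in> space Q" for \<omega>
    unfolding J_def using killing_integral_bounds[OF X \<rho> t that] by auto
  have Km[measurable]: "cylinder K X \<in> borel_measurable Q"
    by (rule cylinder_measurable[OF K]) (auto intro: jointly_measurable_section[OF X])
  obtain B where B: "B \<ge> 0" "\<And>\<omega>. \<bar>cylinder K X \<omega>\<bar> \<le> B" using cylinder_bounded[OF K, where 'w = 'w]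
    by auto
  have \<rho>m: "(\<lambda>(s, \<omega>). \<rho> (X s \<omega>)) \<in> borel_measurable (?L \<Otimes>\<^sub>M Q)"
    using jointly_measurable_interval[OF X \<rho>(1)] sL
      by (simp cong: measurable_cong_sets sets_pair_measure_cong)
  have F: "integrable (?L \<Otimes>\<^sub>M Q) (\<lambda>(s, \<omega>). J \<omega> ^ k * cylinder ((s, \<rho>) # K) X \<omega>)"
  proof (rule integrable_bounded_measurable)
    show "finite_measure (?L \<Otimes>\<^sub>M Q)"
      by (rule finite_measure_pair_measure[OF Q L])
    have "(\<lambda>p. J (snd p) ^ k * ((case p of (s, \<omega>) \<Rightarrow> \<rho> (X s \<omega>)) * cylinder K X (snd p)))
        \<in> borel_measurable (?L \<Otimes>\<^sub>M Q)"
      using \<rho>m by measurable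
    then show "(\<lambda>(s, \<omega>). J \<omega> ^ k * cylinder ((s, \<rho>) # K) X \<omega>) \<in> borel_measurable (?L \<Otimes>\<^sub>M Q)"
      by (simp add: cylinder_simps split_beta')
    fix p assume "p \<in> space (?L \<Otimes>\<^sub>M Q)"
    then obtain s \<omega> where p: "p = (s, \<omega>)" "\<omega> \<in> space Q" by (auto simp: space_pair_measure)
    have c0: "0 \<le> c" using \<rho>(2,3) order_trans by blast
    have "\<bar>J \<omega> ^ k * (\<rho> (X s \<omega>) * cylinder K X \<omega>)\<bar> \<le> (c * t) ^ k * (c * B)"
      unfolding abs_mult power_abs
      using Jb[OF p(2)] \<rho>(2,3) B c0 t by (intro mult_mono power_mono) auto
    then show "\<bar>case p of (s, \<omega>) \<Rightarrow> J \<omega> ^ k * cylinder ((s, \<rho>) # K) X \<omega>\<bar> \<le> (c * t) ^ k * (c * B)"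
      by (simp add: p cylinder_simps)
  qed
  have "(\<integral>\<omega>. J \<omega> ^ Suc k * cylinder K X \<omega> \<partial>Q)
      = (\<integral>\<omega>. (\<integral>s. J \<omega> ^ k * cylinder ((s, \<rho>) # K) X \<omega> \<partial>?L) \<partial>Q)"
    by (simp add: cylinder_simps J_eq mult.assoc mult.left_commute mult.commute)
  also have "\<dots> = (\<integral>s. (\<integral>\<omega>. J \<omega> ^ k * cylinder ((s, \<rho>) # K) X \<omega> \<partial>Q) \<partial>?L)"
    by (rule Fubini_integral[OF F])
  finally show ?thesis .
qed

text \<open>
The integral of \<open>\<rho>\<close> along the path is not a function of countably many coordinates, but by
\<open>moment_step\<close> its moments are integrals of expectations of cylinder functions.
\<close>
lemma moments_cong:
  fixes X1 :: "real \<Rightarrow> 'v \<Rightarrow> 'a::topological_space" and X2 :: "real \<Rightarrow> 'w \<Rightarrow> 'a"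
  assumes Q1: "finite_measure Q1" "jointly_measurable {0..} t Q1 X1"
    and Q2: "finite_measure Q2" "jointly_measurable {0..} t Q2 X2"
    and t: "0 \<le> t" and \<rho>: "\<rho> \<in> borel_measurable borel" "\<And>x. 0 \<le> \<rho> x" "\<And>x. \<rho> x \<le> (c::real)"
    and cyl: "\<And>K. test_list {0..t} K \<Longrightarrow> (\<integral>\<omega>. cylinder K X1 \<omega> \<partial>Q1) = (\<integral>\<omega>. cylinder K X2 \<omega> \<partial>Q2)"
    and K: "test_list {0..t} K"
  shows "(\<integral>\<omega>. (LBINT s:{0..t}. \<rho> (X1 s \<omega>)) ^ k * cylinder K X1 \<omega> \<partial>Q1)
    = (\<integral>\<omega>. (LBINT s:{0..t}. \<rho> (X2 s \<omega>)) ^ k * cylinder K X2 \<omega> \<partial>Q2)"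
  using K
proof (induction k arbitrary: K)
  case 0 then show ?case using cyl by simp
next
  case (Suc k)
  have b: "bounded (range \<rho>)" using \<rho>(2,3) by (auto simp: bounded_iff intro!: exI[of _ c])
  show ?case
    unfolding moment_step[OF Q1 t \<rho> Suc.prems] moment_step[OF Q2 t \<rho> Suc.prems]
    using Suc b \<rho>(1)
      by (intro Bochner_Integration.integral_cong refl Suc.IH)
        (auto simp: test_list_simps space_restrict_space)
qed

lemma integral_exp_series:
  fixes J G :: "'w \<Rightarrow> real"
  assumes Q: "finite_measure Q" and m[measurable]: "J \<in> borel_measurable Q" "G \<in> borel_measurable Q"
    and J: "\<And>\<omega>. \<omega> \<in> space Q \<Longrightarrow> \<bar>J \<omega>\<bar> \<le> A" and G: "\<And>\<omega>. \<omega> \<in> space Q \<Longrightarrow> \<bar>G \<omega>\<bar> \<le> B"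
  shows "(\<lambda>k. (- 1) ^ k / fact k * (\<integral>\<omega>. J \<omega> ^ k * G \<omega> \<partial>Q)) sums (\<integral>\<omega>. exp (- J \<omega>) * G \<omega> \<partial>Q)"
proof -
  interpret finite_measure Q by fact
  define S where "S n \<omega> = (\<Sum>k<n. (- J \<omega>) ^ k / fact k) * G \<omega>" for n \<omega>
  have Sb: "\<bar>S n \<omega>\<bar> \<le> exp A * B" if \<omega>: "\<omega> \<in> space Q" for n \<omega>
  proof -
    have A0: "0 \<le> A" using J[OF \<omega>] by linarith
    have "\<bar>\<Sum>k<n. (- J \<omega>) ^ k / fact k\<bar> \<le> (\<Sum>k<n. \<bar>(- J \<omega>) ^ k / fact k\<bar>)" by (rule sum_abs)
    also have "\<dots> \<le> (\<Sum>k<n. A ^ k / fact k)"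
      using J[OF \<omega>] by (intro sum_mono) (auto simp: power_abs intro!: divide_right_mono power_mono)
    also have "\<dots> \<le> exp A"
      using A0 exp_converges[of A] sum_le_suminf[of "\<lambda>k. A ^ k / fact k" "{..<n}"]
      by (simp add: sums_iff scaleR_conv_of_real field_simps)
    finally show ?thesis unfolding S_def abs_mult using G[OF \<omega>] A0 by (intro mult_mono) auto
  qed
  have Sm: "S n \<in> borel_measurable Q" for n unfolding S_def by measurable
  have "(\<lambda>n. \<integral>\<omega>. S n \<omega> \<partial>Q) \<longlonglongrightarrow> (\<integral>\<omega>. exp (- J \<omega>) * G \<omega> \<partial>Q)"
  proof (rule integral_dominated_convergence[where w = "\<lambda>_. exp A * B"])
    show "AE \<omega> in Q. (\<lambda>n. S n \<omega>) \<longlonglongrightarrow> exp (- J \<omega>) * G \<omega>"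
      unfolding S_def using exp_converges[of "- J _"]
      by (intro AE_I2 tendsto_mult tendsto_const)
          (simp add: sums_def scaleR_conv_of_real field_simps)
  qed (use Sb Sm in auto)
  moreover have "(\<integral>\<omega>. S n \<omega> \<partial>Q) = (\<Sum>k<n. (- 1) ^ k / fact k * (\<integral>\<omega>. J \<omega> ^ k * G \<omega> \<partial>Q))" for n
  proof -
    have i: "integrable Q (\<lambda>\<omega>. J \<omega> ^ k * G \<omega>)" for k
    proof (rule integrable_bounded_measurable[OF Q, of _ "A ^ k * B"])
      fix \<omega> assume \<omega>: "\<omega> \<in> space Q"
      have "0 \<le> A" using J[OF \<omega>] by linarith
      then show "\<bar>J \<omega> ^ k * G \<omega>\<bar> \<le> A ^ k * B"
        unfolding abs_mult power_abs using J[OF \<omega>] G[OF \<omega>] by (intro mult_mono power_mono) auto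
    qed measurable
    have "(\<integral>\<omega>. S n \<omega> \<partial>Q) = (\<integral>\<omega>. (\<Sum>k<n. (- 1) ^ k / fact k * (J \<omega> ^ k * G \<omega>)) \<partial>Q)"
      unfolding S_def sum_distrib_right
      by (intro Bochner_Integration.integral_cong sum.cong refl) (simp add: power_minus[of "J _"])
    also have "\<dots> = (\<Sum>k<n. (- 1) ^ k / fact k * (\<integral>\<omega>. J \<omega> ^ k * G \<omega> \<partial>Q))"
      using i by (subst Bochner_Integration.integral_sum) auto
    finally show ?thesis .
  qed
  ultimately show ?thesis by (simp add: sums_def)
qed

lemma penalization_exp_series:
  fixes X :: "real \<Rightarrow> 'w \<Rightarrow> 'a::topological_space"
  assumes t: "0 \<le> t" and Q: "finite_measure Q" "jointly_measurable {0..} t Q X"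
    and \<rho>: "\<rho> \<in> borel_measurable borel" "\<And>x. 0 \<le> \<rho> x" "\<And>x. \<rho> x \<le> (c::real)"
    and f: "f \<in> borel_measurable borel" "bounded (range f)"
  shows "(\<lambda>k. (- 1) ^ k / fact k * (\<integral>\<omega>. (LBINT s:{0..t}. \<rho> (X s \<omega>)) ^ k * cylinder [(t, f)] X \<omega> \<partial>Q))
    sums (\<integral>\<omega>. penalization {0..} \<rho> X t \<omega> * f (X t \<omega>) \<partial>Q)"
proof -
  obtain B where B: "\<And>x. \<bar>f x\<bar> \<le> B" using f(2) by (auto simp: bounded_iff)
  have "(\<lambda>\<omega>. LBINT s:{0..t}. \<rho> (X s \<omega>)) \<in> borel_measurable Q"
    by (intro set_integral_measurable jointly_measurable_interval Q \<rho>)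
  moreover have "(\<lambda>\<omega>. f (X t \<omega>)) \<in> borel_measurable Q"
    using measurable_compose[OF jointly_measurable_section[OF Q(2), of t] f(1)] t by simp
  moreover have "\<bar>LBINT s:{0..t}. \<rho> (X s \<omega>)\<bar> \<le> c * t" if "\<omega> \<in> space Q" for \<omega>
    using killing_integral_bounds[OF Q(2) \<rho> t that] by auto
  ultimately show ?thesis
    using integral_exp_series[OF Q(1), of "\<lambda>\<omega>. LBINT s:{0..t}. \<rho> (X s \<omega>)" "\<lambda>\<omega>. f (X t \<omega>)" "c * t" B]
        B
    by (simp add: penalization_def cylinder_simps)
qed

lemma penalization_cylinder:
  "cylinder (map (\<lambda>k. (real k, \<lambda>x. exp (- \<rho> x))) [0..<n] @ [(real n, f)]) X \<omega>
    = penalization \<nat> \<rho> X (real n) \<omega> * f (X (real n) \<omega>)"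
proof -
  have "prod_list (map (\<lambda>k. exp (- \<rho> (X (real k) \<omega>))) [0..<n]) = (\<Prod>k<n. exp (- \<rho> (X (real k) \<omega>)))"
    by (subst prod.distinct_set_conv_list[symmetric]) (auto simp: atLeast0LessThan)
  then show ?thesis by (simp add: cylinder_def penalization_def nats_not_atLeast comp_def)
qed

text \<open>
In continuous time the exponential is expanded into moments; in discrete time the penalization is
itself a cylinder function.
\<close>
lemma penalized_expectation_cong:
  fixes X1 :: "real \<Rightarrow> 'v \<Rightarrow> 'a::topological_space" and X2 :: "real \<Rightarrow> 'w \<Rightarrow> 'a"
  assumes I: "I = {0..} \<or> I = \<nat>" and t: "t \<in> I"
    and Q1: "finite_measure Q1" "jointly_measurable I t Q1 X1"
      and Q2: "finite_measure Q2" "jointly_measurable I t Q2 X2"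
    and \<rho>: "\<rho> \<in> borel_measurable borel" "\<And>x. 0 \<le> \<rho> x" "\<And>x. \<rho> x \<le> (c::real)"
    and cyl: "\<And>K. test_list (I \<inter> {0..t}) K \<Longrightarrow> (\<integral>\<omega>. cylinder K X1 \<omega> \<partial>Q1) = (\<integral>\<omega>. cylinder K X2 \<omega> \<partial>Q2)"
    and f: "f \<in> borel_measurable borel" "bounded (range f)"
  shows "(\<integral>\<omega>. penalization I \<rho> X1 t \<omega> * f (X1 t \<omega>) \<partial>Q1)
      = (\<integral>\<omega>. penalization I \<rho> X2 t \<omega> * f (X2 t \<omega>) \<partial>Q2)"
proof (cases "I = {0..}")
  case True
  have t0: "0 \<le> t" using t True by simp
  have I0: "I \<inter> {0..t} = {0..t}" using True by auto
  have K: "test_list {0..t} [(t, f)]" using f t0 by (simp add: test_list_simps)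
  have Q1': "jointly_measurable {0..} t Q1 X1" and Q2': "jointly_measurable {0..} t Q2 X2"
    using Q1 Q2 True by auto
  have "(\<integral>\<omega>. (LBINT s:{0..t}. \<rho> (X1 s \<omega>)) ^ k * cylinder [(t, f)] X1 \<omega> \<partial>Q1)
    = (\<integral>\<omega>. (LBINT s:{0..t}. \<rho> (X2 s \<omega>)) ^ k * cylinder [(t, f)] X2 \<omega> \<partial>Q2)" for k
    by (rule moments_cong[OF Q1(1) Q1' Q2(1) Q2' t0 \<rho> cyl[unfolded I0] K])
  then show ?thesis
    using penalization_exp_series[OF t0 Q1(1) Q1' \<rho> f] penalization_exp_series[OF t0 Q2(1) Q2' \<rho> f]
    unfolding True by (simp only: sums_unique2)
next
  case False
  then have N: "I = \<nat>" using I by simp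
  then obtain n where n: "t = real n" using t by (auto elim: Nats_cases)
  let ?K = "map (\<lambda>k. (real k, \<lambda>x. exp (- \<rho> x))) [0..<n] @ [(real n, f)]"
  have "test_list (I \<inter> {0..t}) ?K"
    using N n f \<rho> unfolding test_list_def by (auto simp: bounded_iff intro!: exI[of _ 1])
  from cyl[OF this] show ?thesis unfolding penalization_cylinder N n .
qed

section \<open>The penalized semigroup of a Markov process\<close>

lemma jointly_measurable_mono:
  assumes X: "jointly_measurable I t N X" and sub: "sets N \<subseteq> sets N'" "space N' = space N"
    and le: "t' \<le> t"
  shows "jointly_measurable I t' N' X"
proof -
  let ?R = "restrict_space borel (I \<inter> {..t})" and ?R' = "restrict_space borel (I \<inter> {..t'})"
  have "(\<lambda>x. x) \<in> N' \<rightarrow>\<^sub>M N" using sub by (auto simp: measurable_def)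
  moreover have "(\<lambda>x. x) \<in> ?R' \<rightarrow>\<^sub>M ?R"
    using le by (intro measurable_restrict_space3) auto
  ultimately have "(\<lambda>p. (fst p, snd p)) \<in> ?R' \<Otimes>\<^sub>M N' \<rightarrow>\<^sub>M ?R \<Otimes>\<^sub>M N"
    by (intro measurable_Pair measurable_compose[OF measurable_fst] measurable_compose[OF
        measurable_snd])
  from measurable_compose[OF this X[unfolded jointly_measurable_def]] show ?thesis
    by (simp add: jointly_measurable_def split_beta')
qed

lemma jointly_measurable_shift:
  assumes X: "jointly_measurable I (s + t) N X" and I: "\<And>u. u \<in> I \<Longrightarrow> s + u \<in> I"
  shows "jointly_measurable I t N (\<lambda>u. X (s + u))"
proof -
  let ?R = "restrict_space borel (I \<inter> {..s + t})" and ?R' = "restrict_space borel (I \<inter> {..t})"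
  have "(\<lambda>u. s + u) \<in> ?R' \<rightarrow>\<^sub>M ?R"
    using I by (intro measurable_restrict_space3) auto
  then have "(\<lambda>p. (s + fst p, snd p)) \<in> ?R' \<Otimes>\<^sub>M N \<rightarrow>\<^sub>M ?R \<Otimes>\<^sub>M N"
    by (intro measurable_Pair measurable_compose[OF measurable_fst]) auto
  from measurable_compose[OF this X[unfolded jointly_measurable_def]] show ?thesis
    by (simp add: jointly_measurable_def split_beta')
qed

text \<open>
The Markov property handles the times in increasing order.
\<close>
lemma cylinder_sort: "cylinder (sort_key fst K) X \<omega> = cylinder K X \<omega>"
proof -
  have "mset (map f (sort_key fst K)) = mset (map f K)" for f :: "_ \<Rightarrow> real" by simp
  then show ?thesis unfolding cylinder_def by (metis prod_mset_prod_list)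
qed

locale penalized_markov_process = markov_process I \<Omega> F P X
  for I :: "real set" and \<Omega> :: "'w measure" and F :: "real \<Rightarrow> 'w measure"
    and P :: "'a::polish_space \<Rightarrow> 'w measure" and X :: "real \<Rightarrow> 'w \<Rightarrow> 'a" +
  fixes \<rho> :: "'a \<Rightarrow> real" and c :: real
  assumes \<rho>_measurable: "\<rho> \<in> borel_measurable borel" and \<rho>_nonneg: "\<And>x. 0 \<le> \<rho> x"
    and \<rho>_le: "\<And>x. \<rho> x \<le> c"
begin

lemmas \<rho>_bounds = \<rho>_measurable \<rho>_nonneg \<rho>_le

abbreviation Z :: "real \<Rightarrow> 'w \<Rightarrow> real" where "Z \<equiv> penalization I \<rho> X"

abbreviation T :: "real \<Rightarrow> ('a \<Rightarrow> real) \<Rightarrow> 'a \<Rightarrow> real" where "T \<equiv> penalized_semigroup I \<rho> P X"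

lemma c_nonneg: "0 \<le> c" using \<rho>_nonneg \<rho>_le order_trans by blast

lemma P_in: "P x \<in> space (prob_algebra \<Omega>)"
  using measurable_space[OF kernel] by simp

lemma prob_P: "prob_space (P x)" and sets_P: "sets (P x) = sets \<Omega>"
  and space_P: "space (P x) = space \<Omega>"
  using P_in[of x] sets_eq_imp_space_eq[of "P x" \<Omega>] by (auto simp: space_prob_algebra)

lemma finite_P: "finite_measure (P x)"
  using prob_P prob_space.finite_measure by blast

lemma I_add: "s \<in> I \<Longrightarrow> t \<in> I \<Longrightarrow> s + t \<in> I"
  using time_setI(2)[OF time_set] .

lemma I_diff: "s \<in> I \<Longrightarrow> t \<in> I \<Longrightarrow> s \<le> t \<Longrightarrow> t - s \<in> I"
  using time_setI(3)[OF time_set] .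

lemma I_nonneg: "t \<in> I \<Longrightarrow> 0 \<le> t"
  using time_setI(1)[OF time_set] .

lemma I_nat: "real n \<in> I"
  using time_set by auto

lemma I_0: "0 \<in> I" using I_nat[of 0] by simp

lemma X_jointly_measurable_F: "t \<in> I \<Longrightarrow> jointly_measurable I t (F t) X"
  unfolding jointly_measurable_def by (rule progressive)

lemma X_jointly_measurable: "t \<in> I \<Longrightarrow> jointly_measurable I t \<Omega> X"
  using jointly_measurable_mono[OF X_jointly_measurable_F] filtration_subalgebra
    unfolding subalgebra_def by auto

lemma X_jointly_measurable_P: "t \<in> I \<Longrightarrow> jointly_measurable I t (P x) X"
  using jointly_measurable_mono[OF X_jointly_measurable] sets_P space_P by auto

lemma X_measurable_F: "t \<in> I \<Longrightarrow> X t \<in> F t \<rightarrow>\<^sub>M borel"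
  using jointly_measurable_section[OF X_jointly_measurable_F] by blast

lemma X_measurable: "t \<in> I \<Longrightarrow> X t \<in> \<Omega> \<rightarrow>\<^sub>M borel"
  using jointly_measurable_section[OF X_jointly_measurable] by blast

lemma Z_measurable_F: "t \<in> I \<Longrightarrow> Z t \<in> borel_measurable (F t)"
  by (intro penalization_measurable time_set X_jointly_measurable_F \<rho>_measurable)

lemma Z_measurable: "t \<in> I \<Longrightarrow> Z t \<in> borel_measurable \<Omega>"
  by (intro penalization_measurable time_set X_jointly_measurable \<rho>_measurable)

lemma Z_bounds:
  assumes "t \<in> I" "\<omega> \<in> space \<Omega>" shows "exp (- c * t) \<le> Z t \<omega>" "Z t \<omega> \<le> 1" "0 \<le> Z t \<omega>" "\<bar>Z t \<omega>\<bar> \<le> 1"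
proof -
  show 1: "exp (- c * t) \<le> Z t \<omega>" and 2: "Z t \<omega> \<le> 1"
    using penalization_bounds[OF time_set assms(1) X_jointly_measurable[OF assms(1)] \<rho>_bounds
        assms(2)] by auto
  show "0 \<le> Z t \<omega>" using 1 exp_ge_zero order_trans by blast
  then show "\<bar>Z t \<omega>\<bar> \<le> 1" using 2 by simp
qed

lemma measurable_P: "P x \<rightarrow>\<^sub>M N = \<Omega> \<rightarrow>\<^sub>M N"
  by (rule measurable_cong_sets[OF sets_P refl])

lemma integrable_P:
  assumes "g \<in> borel_measurable \<Omega>" "\<And>\<omega>. \<omega> \<in> space \<Omega> \<Longrightarrow> \<bar>g \<omega> :: real\<bar> \<le> B"
  shows "integrable (P x) g"
  using assms by (intro integrable_bounded_measurable[OF finite_P, of _ _ B])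
      (auto simp: measurable_P space_P)

lemma integral_P_measurable:
  assumes "g \<in> borel_measurable \<Omega>" shows "(\<lambda>x. \<integral>\<omega>. g \<omega> \<partial>P x :: real) \<in> borel_measurable borel"
  using measurable_compose[OF measurable_prob_algebraD[OF kernel]
      integral_measurable_subprob_algebra[OF assms]] .

lemma integral_P_bounded:
  assumes g: "g \<in> borel_measurable \<Omega>" and B: "\<And>\<omega>. \<omega> \<in> space \<Omega> \<Longrightarrow> \<bar>g \<omega> :: real\<bar> \<le> B"
  shows "\<bar>\<integral>\<omega>. g \<omega> \<partial>P x\<bar> \<le> B"
proof -
  interpret prob_space "P x" by (rule prob_P)
  have "\<bar>\<integral>\<omega>. g \<omega> \<partial>P x\<bar> \<le> (\<integral>\<omega>. \<bar>g \<omega>\<bar> \<partial>P x)" by (rule integral_abs_bound)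
  also have "\<dots> \<le> B"
    using integrable_P[OF g B] B by (intro integral_le_const) (auto simp: space_P)
  finally show ?thesis .
qed

lemma markov_integral:
  fixes f :: "'a \<Rightarrow> real"
  assumes s: "s \<in> I" and t: "t \<in> I"
    and H: "H \<in> borel_measurable (F s)" "\<And>\<omega>. \<omega> \<in> space \<Omega> \<Longrightarrow> \<bar>H \<omega>\<bar> \<le> B"
    and f: "f \<in> borel_measurable borel" "bounded (range f)"
  shows "(\<integral>\<omega>. H \<omega> * f (X (s + t) \<omega>) \<partial>P x) = (\<integral>\<omega>. H \<omega> * (\<integral>\<omega>'. f (X t \<omega>') \<partial>P (X s \<omega>)) \<partial>P x)"
proof -
  have sub: "subalgebra (P x) (F s)" using filtration_subalgebra[OF s]
    by (simp add: subalgebra_def sets_P space_P)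
  interpret finite_measure "P x" by (rule finite_P)
  interpret finite_measure_subalgebra "P x" "F s" by unfold_locales (rule sub)
  obtain A where A: "\<And>x. \<bar>f x\<bar> \<le> A" using f(2) by (auto simp: bounded_iff)
  have H\<Omega>: "H \<in> borel_measurable \<Omega>"
    by (rule measurable_from_subalg[OF filtration_subalgebra[OF s] H(1)])
  have fX: "(\<lambda>\<omega>. f (X (s + t) \<omega>)) \<in> borel_measurable \<Omega>"
    by (rule measurable_compose[OF X_measurable[OF I_add[OF s t]] f(1)])
  have "\<bar>H \<omega> * f (X (s + t) \<omega>)\<bar> \<le> B * A" if "\<omega> \<in> space \<Omega>" for \<omega>
    unfolding abs_mult using H(2)[OF that] A by (intro mult_mono) auto
  then have int: "integrable (P x) (\<lambda>\<omega>. H \<omega> * f (X (s + t) \<omega>))"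
    using H\<Omega> fX by (intro integrable_P) auto
  have "(\<integral>\<omega>. H \<omega> * f (X (s + t) \<omega>) \<partial>P x)
      = (\<integral>\<omega>. H \<omega> * real_cond_exp (P x) (F s) (\<lambda>\<omega>'. f (X (s + t) \<omega>')) \<omega> \<partial>P x)"
    using fX by (intro real_cond_exp_intg(2)[OF int H(1), symmetric]) (simp add: measurable_P)
  also have "\<dots> = (\<integral>\<omega>. H \<omega> * (\<integral>\<omega>'. f (X t \<omega>') \<partial>P (X s \<omega>)) \<partial>P x)"
  proof (rule integral_cong_AE)
    show "(\<lambda>\<omega>. H \<omega> * real_cond_exp (P x) (F s) (\<lambda>\<omega>'. f (X (s + t) \<omega>')) \<omega>) \<in> borel_measurable (P x)"
      using H\<Omega> by (intro borel_measurable_times borel_measurable_cond_exp2) (simp add: measurable_P)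
    have "(\<lambda>\<omega>. \<integral>\<omega>'. f (X t \<omega>') \<partial>P (X s \<omega>)) \<in> borel_measurable \<Omega>"
      by (rule measurable_compose[OF X_measurable[OF s] integral_P_measurable[OF
          measurable_compose[OF X_measurable[OF t] f(1)]]])
    then show "(\<lambda>\<omega>. H \<omega> * (\<integral>\<omega>'. f (X t \<omega>') \<partial>P (X s \<omega>))) \<in> borel_measurable (P x)"
      using H\<Omega> by (simp add: measurable_P)
    show "AE \<omega> in P x. H \<omega> * real_cond_exp (P x) (F s) (\<lambda>\<omega>'. f (X (s + t) \<omega>')) \<omega>
        = H \<omega> * (\<integral>\<omega>'. f (X t \<omega>') \<partial>P (X s \<omega>))"
      using markov[OF s t f, of x] by eventually_elim simp
  qed
  finally show ?thesis .
qed

lemma cylinder_X_measurable: "test_list I K \<Longrightarrow> cylinder K X \<in> borel_measurable \<Omega>"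
  by (rule cylinder_measurable) (auto intro: X_measurable)

lemma cylinder_kernel:
  assumes "test_list I K"
  shows "(\<lambda>z. \<integral>\<omega>. cylinder K X \<omega> \<partial>P z)
      \<in> borel_measurable borel" "bounded (range (\<lambda>z. \<integral>\<omega>. cylinder K X \<omega> \<partial>P z))"
proof -
  obtain B where "\<And>\<omega>. \<bar>cylinder K X \<omega>\<bar> \<le> B" using cylinder_bounded[OF assms, where 'w = 'w] by auto
  then have "\<bar>\<integral>\<omega>. cylinder K X \<omega> \<partial>P z\<bar> \<le> B" for z
    by (intro integral_P_bounded cylinder_X_measurable assms)
  then show "bounded (range (\<lambda>z. \<integral>\<omega>. cylinder K X \<omega> \<partial>P z))" by (auto simp: bounded_iff)
qed (intro integral_P_measurable cylinder_X_measurable assms)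

text \<open>
The first factor is absorbed into the weight \<open>H\<close>, and the remaining factors are handled from the
first time on by the induction hypothesis.
\<close>
lemma markov_sorted_cylinder:
  assumes "sorted (map fst K)" "test_list I K" "s \<in> I" "H \<in> borel_measurable (F s)" "\<And>\<omega>. \<omega> \<in> space \<Omega>
      \<Longrightarrow> \<bar>H \<omega>\<bar> \<le> B"
  shows "(\<integral>\<omega>. H \<omega> * cylinder K (\<lambda>u. X (s + u)) \<omega> \<partial>P x)
      = (\<integral>\<omega>. H \<omega> * (\<integral>\<omega>'. cylinder K X \<omega>' \<partial>P (X s \<omega>)) \<partial>P x)"
  using assms
proof (induction "length K" arbitrary: K s H B x)
  case 0
  have "(\<integral>\<omega>'. 1 \<partial>P z) = (1::real)" for z using prob_space.prob_space[OF prob_P] by simp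
  with 0 show ?case by (simp add: cylinder_simps)
next
  case (Suc n)
  then obtain u g K0 where K: "K = (u, g) # K0" by (metis length_Suc_conv surj_pair)
  define K' where "K' = map (\<lambda>(v, k). (v - u, k)) K0"
  have u: "u \<in> I" and g: "g \<in> borel_measurable borel" "bounded (range g)" and K0: "test_list I K0"
    using Suc.prems(2) by (auto simp: K test_list_simps)
  have ge: "u \<le> v" if "(v, k) \<in> set K0" for v k using Suc.prems(1) that by (force simp: K)
  have map_K': "map fst K' = map (\<lambda>v. v - u) (map fst K0)"
    by (simp add: K'_def split_beta' comp_def)
  have "sorted (map fst K0)" using Suc.prems(1) unfolding K list.map sorted_wrt.simps by blast
  moreover have "sorted (map (\<lambda>v. v - u) vs)" if "sorted vs" for vs :: "real list"
    using that by (simp add: sorted_map)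
  ultimately have "sorted (map fst K')" unfolding map_K' by blast
  moreover have "test_list I K'"
    using K0 ge u I_diff unfolding test_list_def K'_def by fastforce
  moreover have "length K' = n" using Suc.hyps(2) by (simp add: K'_def K)
  ultimately have K': "test_list I K'" "sorted (map fst K')" "length K' = n" by auto
  have shift: "cylinder K' (\<lambda>v. Y (u + v)) \<omega> = cylinder K0 Y \<omega>" for Y :: "real \<Rightarrow> 'w \<Rightarrow> 'a" and \<omega>
    by (simp add: cylinder_def K'_def comp_def split_beta')
  define \<phi> where "\<phi> z = (\<integral>\<omega>. cylinder K' X \<omega> \<partial>P z)" for z
  have \<phi>: "\<phi> \<in> borel_measurable borel" "bounded (range \<phi>)" using cylinder_kernel[OF K'(1)]
    by (auto simp: \<phi>_def[abs_def])
  obtain A where A: "\<And>x. \<bar>g x\<bar> \<le> A" using g(2) by (auto simp: bounded_iff)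
  obtain A' where A': "\<And>x. \<bar>\<phi> x\<bar> \<le> A'" using \<phi>(2) by (auto simp: bounded_iff)
  have su: "s + u \<in> I" by (rule I_add[OF Suc.prems(3) u])
  have "subalgebra (F (s + u)) (F s)" using filtration_mono[OF Suc.prems(3) su] I_nonneg[OF u]
    by simp
  then have H': "(\<lambda>\<omega>. H \<omega> * g (X (s + u) \<omega>)) \<in> borel_measurable (F (s + u))"
    using measurable_from_subalg[OF _ Suc.prems(4)]
        measurable_compose[OF X_measurable_F[OF su] g(1)] by simp
  have H'b: "\<bar>H \<omega> * g (X (s + u) \<omega>)\<bar> \<le> B * A" if "\<omega> \<in> space \<Omega>" for \<omega>
    unfolding abs_mult using Suc.prems(5)[OF that] A by (intro mult_mono) auto
  have g': "(\<lambda>\<omega>. g (X u \<omega>)) \<in> borel_measurable (F u)"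
    by (rule measurable_compose[OF X_measurable_F[OF u] g(1)])
  have "(\<integral>\<omega>. H \<omega> * cylinder K (\<lambda>u. X (s + u)) \<omega> \<partial>P x)
    = (\<integral>\<omega>. (H \<omega> * g (X (s + u) \<omega>)) * cylinder K' (\<lambda>v. X ((s + u) + v)) \<omega> \<partial>P x)"
    using shift[of "\<lambda>v. X (s + v)"] by (simp add: K cylinder_simps mult.assoc add.assoc)
  also have "\<dots> = (\<integral>\<omega>. (H \<omega> * g (X (s + u) \<omega>)) * \<phi> (X (s + u) \<omega>) \<partial>P x)"
    unfolding \<phi>_def using K' by (intro Suc.hyps(1)[where B = "B * A"] su H' H'b) auto
  also have "\<dots> = (\<integral>\<omega>. H \<omega> * (\<lambda>z. g z * \<phi> z) (X (s + u) \<omega>) \<partial>P x)" by (simp add: mult.assoc)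
  also have "\<dots> = (\<integral>\<omega>. H \<omega> * (\<integral>\<omega>'. g (X u \<omega>') * \<phi> (X u \<omega>') \<partial>P (X s \<omega>)) \<partial>P x)"
  proof (rule markov_integral[OF Suc.prems(3) u Suc.prems(4,5)])
    show "(\<lambda>z. g z * \<phi> z) \<in> borel_measurable borel" using g \<phi> by simp
    have "\<bar>g z * \<phi> z\<bar> \<le> A * A'" for z
      unfolding abs_mult using A A' by (intro mult_mono) (auto intro: order_trans[OF abs_ge_zero])
    then show "bounded (range (\<lambda>z. g z * \<phi> z))" by (auto simp: bounded_iff)
  qed
  also have "(\<lambda>z. \<integral>\<omega>'. g (X u \<omega>') * \<phi> (X u \<omega>') \<partial>P z) = (\<lambda>z. \<integral>\<omega>'. cylinder K X \<omega>' \<partial>P z)"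
  proof
    fix z
    have "(\<integral>\<omega>'. g (X u \<omega>') * \<phi> (X u \<omega>') \<partial>P z)
        = (\<integral>\<omega>'. g (X u \<omega>') * cylinder K' (\<lambda>v. X (u + v)) \<omega>' \<partial>P z)"
      unfolding \<phi>_def using K' A by (intro Suc.hyps(1)[symmetric] u g') auto
    also have "\<dots> = (\<integral>\<omega>'. cylinder K X \<omega>' \<partial>P z)" using shift[of X] by (simp add: K cylinder_simps)
    finally show "(\<integral>\<omega>'. g (X u \<omega>') * \<phi> (X u \<omega>') \<partial>P z) = (\<integral>\<omega>'. cylinder K X \<omega>' \<partial>P z)" .
  qed
  finally show ?case .
qed

lemma markov_cylinder:
  assumes K: "test_list I K" and s: "s \<in> I"
    and H: "H \<in> borel_measurable (F s)" "\<And>\<omega>. \<omega> \<in> space \<Omega> \<Longrightarrow> \<bar>H \<omega>\<bar> \<le> B"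
  shows "(\<integral>\<omega>. H \<omega> * cylinder K (\<lambda>u. X (s + u)) \<omega> \<partial>P x)
      = (\<integral>\<omega>. H \<omega> * (\<integral>\<omega>'. cylinder K X \<omega>' \<partial>P (X s \<omega>)) \<partial>P x)"
proof -
  have "test_list I (sort_key fst K)" using K by (simp add: test_list_def)
  from markov_sorted_cylinder[OF _ this s H] show ?thesis by (simp add: cylinder_sort)
qed

lemma penalization_add:
  assumes s: "s \<in> I" and t: "t \<in> I" and \<omega>: "\<omega> \<in> space \<Omega>"
  shows "Z (s + t) \<omega> = Z s \<omega> * penalization I \<rho> (\<lambda>u. X (s + u)) t \<omega>"
proof (cases "I = {0..}")
  case True
  have s0: "0 \<le> s" "0 \<le> t" using I_nonneg s t by auto
  let ?g = "\<lambda>u. \<rho> (X u \<omega>)"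
  have int: "set_integrable lborel {0..s + t} ?g"
    using killing_integral_bounds(1)[of "s + t" \<Omega> X \<rho> c \<omega>] X_jointly_measurable[OF I_add[OF s t]]
        \<rho>_bounds s0 \<omega> True by simp
  have "(LBINT u:{0..s + t}. ?g u) = (LBINT u:{0..s}. ?g u) + (LBINT u:{s<..s + t}. ?g u)"
  proof -
    have "{0..s + t} = {0..s} \<union> {s<..s + t}" using s0 by auto
    moreover have "set_integrable lborel {0..s} ?g" "set_integrable lborel {s<..s + t} ?g"
      using s0 by (auto intro!: set_integrable_subset[OF int])
    ultimately show ?thesis by (subst set_integral_Un[symmetric]) auto
  qed
  also have "(LBINT u:{s<..s + t}. ?g u) = (LBINT u:{s..s + t}. ?g u)"
  proof -
    have "AE u in lborel. u \<noteq> s" by (rule AE_lborel_singleton)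
    then show ?thesis unfolding set_lebesgue_integral_def
    proof (intro integral_cong_AE)
      have m: "set_integrable lborel {s..s + t} ?g" "set_integrable lborel {s<..s + t} ?g"
        using s0 by (auto intro!: set_integrable_subset[OF int])
      show "(\<lambda>u. indicat_real {s<..s + t} u *\<^sub>R ?g u) \<in> borel_measurable lborel"
        "(\<lambda>u. indicat_real {s..s + t} u *\<^sub>R ?g u) \<in> borel_measurable lborel"
        using m by (auto simp: set_integrable_def)
    qed (auto elim!: eventually_mono simp: indicator_def)
  qed
  also have "\<dots> = (LBINT u:{0..t}. ?g (s + u))"
    unfolding set_lebesgue_integral_def
    using lborel_integral_real_affine[of 1 "\<lambda>u. indicat_real {s..s + t} u *\<^sub>R ?g u" s]
    by (simp add: indicator_def)
  finally show ?thesis using True by (simp add: penalization_def exp_add[symmetric])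
next
  case False
  then have "I = \<nat>" using time_set by simp
  then obtain m n where mn: "s = real m" "t = real n" using s t by (auto elim!: Nats_cases)
  have "(\<Prod>k<m + n. exp (- \<rho> (X (real k) \<omega>)))
      = (\<Prod>k<m. exp (- \<rho> (X (real k) \<omega>))) * (\<Prod>k<n. exp (- \<rho> (X (real (m + k)) \<omega>)))"
    by (induction n) (simp_all add: mult.assoc)
  moreover have "nat \<lfloor>real m + real n\<rfloor> = m + n" by (metis floor_of_nat nat_int of_nat_add)
  ultimately show ?thesis using False by (simp add: penalization_def mn)
qed

lemma T_measurable:
  assumes t: "t \<in> I" and f: "f \<in> borel_measurable borel"
  shows "T t f \<in> borel_measurable borel"
  unfolding penalized_semigroup_def[abs_def]
  using Z_measurable[OF t] measurable_compose[OF X_measurable[OF t] f]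
    by (intro integral_P_measurable) simp

lemma ZfX_bound:
  assumes "t \<in> I" "\<And>x. \<bar>f x\<bar> \<le> B" "\<omega> \<in> space \<Omega>"
  shows "\<bar>Z t \<omega> * f (X t \<omega>)\<bar> \<le> B"
proof -
  have "\<bar>Z t \<omega> * f (X t \<omega>)\<bar> \<le> 1 * B"
    unfolding abs_mult using Z_bounds[OF assms(1,3)] assms(2) by (intro mult_mono) auto
  then show ?thesis by simp
qed

lemma ZfX_integrable:
  assumes "t \<in> I" "f \<in> borel_measurable borel" "bounded (range f)"
  shows "integrable (P x) (\<lambda>\<omega>. Z t \<omega> * f (X t \<omega>))"
proof -
  obtain B where "\<And>x. \<bar>f x\<bar> \<le> B" using assms(3) by (auto simp: bounded_iff)
  then show ?thesis
    using Z_measurable[OF assms(1)] measurable_compose[OF X_measurable[OF assms(1)] assms(2)]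
    by (intro integrable_P ZfX_bound) (auto simp: assms(1))
qed

lemma T_bounded:
  assumes "t \<in> I" "f \<in> borel_measurable borel" "\<And>x. \<bar>f x\<bar> \<le> B"
  shows "\<bar>T t f x\<bar> \<le> B"
  unfolding penalized_semigroup_def
  using Z_measurable[OF assms(1)] measurable_compose[OF X_measurable[OF assms(1)] assms(2)]
  by (intro integral_P_bounded ZfX_bound) (auto simp: assms)

text \<open>
Let \<open>Q1\<close> be the measure with density \<open>Z s\<close> with respect to \<open>P x\<close>, and \<open>Q2\<close> the mixture of the \<open>P
(X s \<omega>)\<close> under \<open>Q1\<close>. By the Markov property the shifted process under \<open>Q1\<close> and \<open>X\<close> under \<open>Q2\<close> have
the same finite-dimensional laws, hence the same penalized expectations.
\<close>
lemma T_semigroup: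
  assumes s: "s \<in> I" and t: "t \<in> I" and f: "f \<in> borel_measurable borel" "bounded (range f)"
  shows "T (s + t) f x = T s (T t f) x"
proof -
  define Q1 where "Q1 = density (P x) (\<lambda>\<omega>. ennreal (Z s \<omega>))"
  define Q2 where "Q2 = Q1 \<bind> (\<lambda>\<omega>. P (X s \<omega>))"
  have Zm: "Z s \<in> borel_measurable (P x)" using Z_measurable[OF s] by (simp add: measurable_P)
  have sets1: "sets Q1 = sets \<Omega>" and space1: "space Q1 = space \<Omega>"
    by (simp_all add: Q1_def sets_P space_P)
  have int1: "(\<integral>\<omega>. g \<omega> \<partial>Q1) = (\<integral>\<omega>. Z s \<omega> * g \<omega> \<partial>P x)" if "g \<in> borel_measurable \<Omega>"
    for g :: "'w \<Rightarrow> real"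
    unfolding Q1_def using that Zm Z_bounds[OF s]
      by (subst integral_density) (auto simp: measurable_P space_P)
  have fin1: "finite_measure Q1"
  proof (rule finite_measureI)
    have "emeasure Q1 (space Q1) = (\<integral>\<^sup>+\<omega>. ennreal (Z s \<omega>) * indicator (space \<Omega>) \<omega> \<partial>P x)"
      unfolding Q1_def using Zm by (subst emeasure_density) (auto simp: space_P sets_P)
    also have "\<dots> \<le> (\<integral>\<^sup>+\<omega>. 1 \<partial>P x)"
      using Z_bounds[OF s] by (intro nn_integral_mono) (auto simp: space_P)
    also have "\<dots> = 1" using prob_space.emeasure_space_1[OF prob_P] by simp
    finally show "emeasure Q1 (space Q1) \<noteq> \<infinity>" by (auto simp: top_unique)
  qed
  have ne: "space Q1 \<noteq> {}" using prob_space.not_empty[OF prob_P, of x] by (simp add: space1 space_P)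
  have ker: "(\<lambda>\<omega>. P (X s \<omega>)) \<in> Q1 \<rightarrow>\<^sub>M prob_algebra \<Omega>"
    using measurable_compose[OF X_measurable[OF s] kernel]
      by (simp cong: measurable_cong_sets add: sets1)
  have sets2: "sets Q2 = sets \<Omega>" unfolding Q2_def
    by (rule sets_bind[OF _ ne]) (simp add: sets_P)
  have space2: "space Q2 = space \<Omega>" by (rule sets_eq_imp_space_eq[OF sets2])
  have fin2: "finite_measure Q2"
  proof (rule finite_measureI)
    have "emeasure Q2 (space Q2) = (\<integral>\<^sup>+\<omega>. emeasure (P (X s \<omega>)) (space \<Omega>) \<partial>Q1)"
      unfolding space2 unfolding Q2_def
        by (rule emeasure_bind[OF ne measurable_prob_algebraD[OF ker]]) auto
    also have "\<dots> = emeasure Q1 (space Q1)"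
      using prob_space.emeasure_space_1[OF prob_P] by (simp add: space_P)
    finally show "emeasure Q2 (space Q2) \<noteq> \<infinity>" using finite_measure.finite_emeasure_space[OF fin1]
      by simp
  qed
  have int2: "(\<integral>\<omega>. g \<omega> \<partial>Q2) = (\<integral>\<omega>. Z s \<omega> * (\<integral>\<omega>'. g \<omega>' \<partial>P (X s \<omega>)) \<partial>P x)"
    if g: "g \<in> borel_measurable \<Omega>" "\<And>\<omega>. \<omega> \<in> space \<Omega> \<Longrightarrow> \<bar>g \<omega>\<bar> \<le> B" for g :: "'w \<Rightarrow> real" and B
    using integral_bind_kernel[OF fin1 ne ker g]
      int1[OF measurable_compose[OF X_measurable[OF s] integral_P_measurable[OF g(1)]]]
    by (simp add: Q2_def)
  have st: "s + t \<in> I" by (rule I_add[OF s t])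
  have jm1: "jointly_measurable I t Q1 (\<lambda>u. X (s + u))"
    using jointly_measurable_mono[OF jointly_measurable_shift[OF X_jointly_measurable[OF st]
        I_add[OF s]]] sets1 space1 by auto
  have jm2: "jointly_measurable I t Q2 X"
    using jointly_measurable_mono[OF X_jointly_measurable[OF t]] sets2 space2 by auto
  have cyl: "(\<integral>\<omega>. cylinder K (\<lambda>u. X (s + u)) \<omega> \<partial>Q1) = (\<integral>\<omega>. cylinder K X \<omega> \<partial>Q2)"
    if K: "test_list (I \<inter> {0..t}) K" for K
  proof -
    have K': "test_list I K" using K by (auto simp: test_list_def)
    obtain B where B: "\<And>\<omega>. \<bar>cylinder K X \<omega>\<bar> \<le> B" using cylinder_bounded[OF K', where 'w = 'w]
      by auto
    have "cylinder K (\<lambda>u. X (s + u)) \<in> borel_measurable \<Omega>"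
      by (rule cylinder_measurable[OF K']) (auto intro: X_measurable I_add s)
    from int1[OF this] int2[OF cylinder_X_measurable[OF K'] B]
        markov_cylinder[OF K' s Z_measurable_F[OF s] Z_bounds(4)[OF s]]
    show ?thesis by simp
  qed
  obtain B where B: "\<And>x. \<bar>f x\<bar> \<le> B" using f(2) by (auto simp: bounded_iff)
  have m1: "(\<lambda>\<omega>. penalization I \<rho> (\<lambda>u. X (s + u)) t \<omega> * f (X (s + t) \<omega>)) \<in> borel_measurable \<Omega>"
    using penalization_measurable[OF time_set t jointly_measurable_shift[OF X_jointly_measurable[OF
        st] I_add[OF s]] \<rho>_measurable]
      measurable_compose[OF X_measurable[OF st] f(1)] by simp
  have m2: "(\<lambda>\<omega>. Z t \<omega> * f (X t \<omega>)) \<in> borel_measurable \<Omega>"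
    using Z_measurable[OF t] measurable_compose[OF X_measurable[OF t] f(1)] by simp
  have "T (s + t) f x = (\<integral>\<omega>. Z s \<omega> * (penalization I \<rho> (\<lambda>u. X (s + u)) t \<omega> * f (X (s + t) \<omega>)) \<partial>P x)"
    unfolding penalized_semigroup_def
    by (intro Bochner_Integration.integral_cong refl)
        (simp add: space_P penalization_add[OF s t] mult.assoc)
  also have "\<dots> = (\<integral>\<omega>. penalization I \<rho> (\<lambda>u. X (s + u)) t \<omega> * f (X (s + t) \<omega>) \<partial>Q1)"
    by (rule int1[OF m1, symmetric])
  also have "\<dots> = (\<integral>\<omega>. Z t \<omega> * f (X t \<omega>) \<partial>Q2)"
    by (rule penalized_expectation_cong[OF time_set t fin1 jm1 fin2 jm2 \<rho>_bounds cyl f])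
  also have "\<dots> = T s (T t f) x"
    using int2[OF m2 ZfX_bound[where f = f and B = B, OF t B]]
      by (simp add: penalized_semigroup_def)
  finally show ?thesis .
qed

end

section \<open>Estimates from couplings\<close>

lemma abs_exp_minus_diff_le:
  fixes a b :: real
  assumes "0 \<le> a" "0 \<le> b" shows "\<bar>exp (- a) - exp (- b)\<bar> \<le> \<bar>a - b\<bar>"
proof -
  have *: "exp (- u) - exp (- v) \<le> v - u" if "0 \<le> u" "u \<le> v" for u v :: real
  proof -
    have "1 - (v - u) \<le> exp (- (v - u))" using exp_ge_add_one_self[of "u - v"]
      by (simp add: algebra_simps)
    then have "exp (- u) * (1 - exp (- (v - u))) \<le> 1 * (v - u)"
      using that by (intro mult_mono) auto
    moreover have "exp (- u) * (1 - exp (- (v - u))) = exp (- u) - exp (- v)"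
      by (simp add: right_diff_distrib exp_add[symmetric])
    ultimately show ?thesis by simp
  qed
  show ?thesis using *[of a b] *[of b a] assms by (cases "a \<le> b") auto
qed

text \<open>
The map \<open>a \<mapsto> exp (- a)\<close> is 1-Lipschitz on nonnegative reals, and the integrals of \<open>\<rho>\<close> along the
two paths differ by at most \<open>L\<close> times the integral of their distance.
\<close>
lemma expected_penalization_diff:
  fixes X Y :: "real \<Rightarrow> 'w \<Rightarrow> 'a::polish_space"
  assumes I: "I = {0..} \<or> I = \<nat>" and t: "t \<in> I" and Q: "prob_space Q"
    and X: "jointly_measurable I t Q X" and Y: "jointly_measurable I t Q Y"
    and \<rho>: "\<rho> \<in> borel_measurable borel" "\<And>x. 0 \<le> \<rho> x" "\<And>x. \<rho> x \<le> (c::real)"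
    and lip: "L-lipschitz_on UNIV \<rho>" and D: "\<And>x y::'a. dist x y \<le> D"
    and e: "\<And>u. u \<in> I \<Longrightarrow> u \<le> t \<Longrightarrow> (\<integral>\<omega>. dist (X u \<omega>) (Y u \<omega>) \<partial>Q) \<le> e"
  shows "(\<integral>\<omega>. \<bar>penalization I \<rho> X t \<omega> - penalization I \<rho> Y t \<omega>\<bar> \<partial>Q) \<le> L * t * e"
proof -
  interpret Q: prob_space Q by fact
  have t0: "0 \<le> t" using time_setI(1)[OF I t t] .
  have L0: "0 \<le> L" using lip by (rule lipschitz_on_nonneg)
  have D0: "0 \<le> D" using D[of undefined undefined] by simp
  have lipd: "\<bar>\<rho> x - \<rho> y\<bar> \<le> L * dist x y" for x y using lipschitz_onD[OF lip, of x y]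
    by (simp add: dist_real_def)
  have Zint: "integrable Q (\<lambda>\<omega>. \<bar>penalization I \<rho> X t \<omega> - penalization I \<rho> Y t \<omega>\<bar>)"
  proof (rule integrable_bounded_measurable[of _ _ 1])
    show "(\<lambda>\<omega>. \<bar>penalization I \<rho> X t \<omega> - penalization I \<rho> Y t \<omega>\<bar>) \<in> borel_measurable Q"
      using penalization_measurable[OF I t X \<rho>(1)] penalization_measurable[OF I t Y \<rho>(1)]
        by measurable
    fix \<omega> assume \<omega>: "\<omega> \<in> space Q"
    have "0 \<le> exp (- c * t)" by simp
    then show "\<bar>\<bar>penalization I \<rho> X t \<omega> - penalization I \<rho> Y t \<omega>\<bar>\<bar> \<le> 1"
      using penalization_bounds[OF I t X \<rho> \<omega>] penalization_bounds[OF I t Y \<rho> \<omega>] by linarith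
  qed unfold_locales
  show ?thesis
  proof (cases "I = {0..}")
    case True
    let ?R = "restrict_space lborel {0..t}"
    have RF: "finite_measure ?R"
      by (rule finite_measureI) (simp add: space_restrict_space emeasure_restrict_space
        emeasure_lborel_Icc_eq)
    interpret R: finite_measure ?R by fact
    interpret pair_sigma_finite ?R Q ..
    have sR: "sets ?R = sets (restrict_space borel {0..t})" by (rule sets_restrict_space_cong) simp
    have cap: "{0..} \<inter> {..t} = {0..t}" by auto
    have X': "(\<lambda>p. X (fst p) (snd p)) \<in> ?R \<Otimes>\<^sub>M Q \<rightarrow>\<^sub>M borel"
      and Y': "(\<lambda>p. Y (fst p) (snd p)) \<in> ?R \<Otimes>\<^sub>M Q \<rightarrow>\<^sub>M borel"
      using X Y sR True unfolding jointly_measurable_def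
      by (simp_all add: cap split_beta' cong: measurable_cong_sets sets_pair_measure_cong)
    have dm: "(\<lambda>(u, \<omega>). dist (X u \<omega>) (Y u \<omega>)) \<in> borel_measurable (?R \<Otimes>\<^sub>M Q)"
      using borel_measurable_dist[OF X' Y'] by (simp add: split_beta')
    have dint: "integrable (?R \<Otimes>\<^sub>M Q) (\<lambda>(u, \<omega>). dist (X u \<omega>) (Y u \<omega>))"
      by (rule integrable_bounded_measurable[OF finite_measure_pair_measure[OF
          Q.finite_measure_axioms RF] dm, of D])
         (use D in auto)
    have X0: "jointly_measurable {0..} t Q X" and Y0: "jointly_measurable {0..} t Q Y"
      using X Y True by auto
    have pointwise: "\<bar>penalization I \<rho> X t \<omega> - penalization I \<rho> Y t \<omega>\<bar>
        \<le> L * (\<integral>u. dist (X u \<omega>) (Y u \<omega>) \<partial>?R)"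
      if \<omega>: "\<omega> \<in> space Q" for \<omega>
    proof -
      note kX = killing_integral_bounds[OF X0 \<rho> t0 \<omega>] and kY = killing_integral_bounds[OF Y0 \<rho> t0 \<omega>]
      have iX: "integrable ?R (\<lambda>u. \<rho> (X u \<omega>))" and iY: "integrable ?R (\<lambda>u. \<rho> (Y u \<omega>))"
        using kX(1) kY(1) by (simp_all add: integrable_restrict_space set_integrable_def)
      have "(\<lambda>u. (u, \<omega>)) \<in> ?R \<rightarrow>\<^sub>M ?R \<Otimes>\<^sub>M Q" using \<omega> by simp
      from measurable_compose[OF this dm] have "(\<lambda>u. dist (X u \<omega>) (Y u \<omega>)) \<in> borel_measurable ?R"
        by simp
      then have id: "integrable ?R (\<lambda>u. dist (X u \<omega>) (Y u \<omega>))"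
        by (rule integrable_bounded_measurable[OF RF, of _ D]) (use D in auto)
      have "\<bar>penalization I \<rho> X t \<omega> - penalization I \<rho> Y t \<omega>\<bar>
        \<le> \<bar>(LBINT s:{0..t}. \<rho> (X s \<omega>)) - (LBINT s:{0..t}. \<rho> (Y s \<omega>))\<bar>"
        using True kX(2) kY(2) by (simp add: penalization_def abs_exp_minus_diff_le)
      also have "\<dots> = \<bar>(\<integral>u. \<rho> (X u \<omega>) \<partial>?R) - (\<integral>u. \<rho> (Y u \<omega>) \<partial>?R)\<bar>"
        by (simp add: set_lebesgue_integral_def integral_restrict_space)
      also have "\<dots> = \<bar>\<integral>u. \<rho> (X u \<omega>) - \<rho> (Y u \<omega>) \<partial>?R\<bar>" using iX iY by simp
      also have "\<dots> \<le> (\<integral>u. \<bar>\<rho> (X u \<omega>) - \<rho> (Y u \<omega>)\<bar> \<partial>?R)" by (rule integral_abs_bound)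
      also have "\<dots> \<le> (\<integral>u. L * dist (X u \<omega>) (Y u \<omega>) \<partial>?R)"
        using iX iY id lipd by (intro integral_mono) auto
      finally show ?thesis by simp
    qed
    have inner: "integrable Q (\<lambda>\<omega>. \<integral>u. dist (X u \<omega>) (Y u \<omega>) \<partial>?R)"
      using integrable_snd[OF dint] by simp
    have outer: "integrable ?R (\<lambda>u. \<integral>\<omega>. dist (X u \<omega>) (Y u \<omega>) \<partial>Q)"
      using integrable_fst[OF dint] by simp
    have "(\<integral>\<omega>. \<bar>penalization I \<rho> X t \<omega> - penalization I \<rho> Y t \<omega>\<bar> \<partial>Q)
        \<le> (\<integral>\<omega>. L * (\<integral>u. dist (X u \<omega>) (Y u \<omega>) \<partial>?R) \<partial>Q)"
      using Zint inner pointwise by (intro integral_mono) auto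
    also have "\<dots> = L * (\<integral>u. (\<integral>\<omega>. dist (X u \<omega>) (Y u \<omega>) \<partial>Q) \<partial>?R)"
      using Fubini_integral[OF dint] by simp
    also have "\<dots> \<le> L * (\<integral>u. e \<partial>?R)"
      using outer e True L0
        by (intro mult_left_mono integral_mono) (auto simp: space_restrict_space)
    also have "(\<integral>u. e \<partial>?R) = t * e"
      using t0 by (simp add: measure_restrict_space space_restrict_space)
    finally show ?thesis by (simp add: mult.assoc)
  next
    case False
    then have N: "I = \<nat>" using I by simp
    then obtain n where n: "t = real n" using t by (auto elim: Nats_cases)
    have meas: "X (real k) \<in> Q \<rightarrow>\<^sub>M borel" "Y (real k) \<in> Q \<rightarrow>\<^sub>M borel" if "k < n" for k
      using that n N by (auto intro!: jointly_measurable_section[OF X] jointly_measurable_section[OF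
          Y])
    have di: "integrable Q (\<lambda>\<omega>. dist (X (real k) \<omega>) (Y (real k) \<omega>))" if "k < n" for k
      using meas[OF that] D
        by (intro integrable_bounded_measurable[OF Q.finite_measure_axioms, of _ D]) auto
    have pointwise: "\<bar>penalization I \<rho> X t \<omega> - penalization I \<rho> Y t \<omega>\<bar>
        \<le> (\<Sum>k<n. L * dist (X (real k) \<omega>) (Y (real k) \<omega>))" for \<omega>
    proof -
      have pen: "penalization I \<rho> U t \<omega> = exp (- (\<Sum>k<n. \<rho> (U (real k) \<omega>)))" for U
        using False n by (simp add: penalization_def exp_sum sum_negf[symmetric])
      have "\<bar>penalization I \<rho> X t \<omega> - penalization I \<rho> Y t \<omega>\<bar>
          \<le> \<bar>(\<Sum>k<n. \<rho> (X (real k) \<omega>)) - (\<Sum>k<n. \<rho> (Y (real k) \<omega>))\<bar>"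
        unfolding pen using \<rho>(2) by (intro abs_exp_minus_diff_le sum_nonneg) auto
      also have "\<dots> \<le> (\<Sum>k<n. \<bar>\<rho> (X (real k) \<omega>) - \<rho> (Y (real k) \<omega>)\<bar>)"
        unfolding sum_subtractf[symmetric] by (rule sum_abs)
      also have "\<dots> \<le> (\<Sum>k<n. L * dist (X (real k) \<omega>) (Y (real k) \<omega>))" by (intro sum_mono lipd)
      finally show ?thesis .
    qed
    have "(\<integral>\<omega>. \<bar>penalization I \<rho> X t \<omega> - penalization I \<rho> Y t \<omega>\<bar> \<partial>Q)
        \<le> (\<integral>\<omega>. (\<Sum>k<n. L * dist (X (real k) \<omega>) (Y (real k) \<omega>)) \<partial>Q)"
      using Zint di pointwise by (intro integral_mono Bochner_Integration.integrable_sum) auto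
    also have "\<dots> = (\<Sum>k<n. L * (\<integral>\<omega>. dist (X (real k) \<omega>) (Y (real k) \<omega>) \<partial>Q))"
      using di by (subst Bochner_Integration.integral_sum) auto
    also have "\<dots> \<le> (\<Sum>k<n. L * e)" using L0 e N n by (intro sum_mono mult_left_mono) auto
    finally show ?thesis by (simp add: n mult.assoc mult.left_commute)
  qed
qed

text \<open>
Cylinder functions are measurable for the product \<open>\<sigma>\<close>-algebra on paths, so their expectations are
read off the path law.
\<close>
lemma path_law_cylinder:
  fixes X :: "real \<Rightarrow> 'w \<Rightarrow> 'a::topological_space"
  assumes K: "test_list I K" and X: "\<And>u. u \<in> I \<Longrightarrow> X u \<in> Q \<rightarrow>\<^sub>M borel"
  shows "(\<integral>\<omega>. cylinder K X \<omega> \<partial>Q) = (\<integral>p. cylinder K (\<lambda>u p. p u) p \<partial>path_law I Q X)"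
proof -
  have "(\<lambda>\<omega>. \<lambda>t\<in>I. X t \<omega>) \<in> Q \<rightarrow>\<^sub>M PiM I (\<lambda>_. borel)" using X by (intro measurable_restrict)
  moreover have "cylinder K (\<lambda>u p. p u) \<in> borel_measurable (PiM I (\<lambda>_. borel))"
    by (rule cylinder_measurable[OF K]) (rule measurable_component_singleton)
  ultimately have "(\<integral>p. cylinder K (\<lambda>u p. p u) p \<partial>path_law I Q X)
      = (\<integral>\<omega>. cylinder K (\<lambda>u p. p u) (\<lambda>t\<in>I. X t \<omega>) \<partial>Q)"
    unfolding path_law_def by (rule integral_distr)
  moreover have "cylinder K (\<lambda>u p. p u) (\<lambda>t\<in>I. X t \<omega>) = cylinder K X \<omega>" for \<omega>
    using K by (induction K) (auto simp: cylinder_def test_list_def)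
  ultimately show ?thesis by simp
qed

context penalized_markov_process
begin

lemma coupled_expectation:
  fixes X' :: "real \<Rightarrow> 'c \<Rightarrow> 'a"
  assumes Q: "prob_space Q" and X': "(\<lambda>(s, \<omega>). X' s \<omega>) \<in> restrict_space borel I \<Otimes>\<^sub>M Q \<rightarrow>\<^sub>M borel"
    and law: "path_law I Q X' = path_law I (P x) X" and t: "t \<in> I"
    and f: "f \<in> borel_measurable borel" "bounded (range f)"
  shows "jointly_measurable I t Q X'" "(\<integral>\<omega>. penalization I \<rho> X' t \<omega> * f (X' t \<omega>) \<partial>Q) = T t f x"
proof -
  have jm: "jointly_measurable I t Q X'" if "t \<in> I" for t
  proof -
    have "(\<lambda>p. (fst p, snd p)) \<in> restrict_space borel (I \<inter> {..t}) \<Otimes>\<^sub>M Q \<rightarrow>\<^sub>M restrict_space borel I \<Otimes>\<^sub>M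
        Q"
      by (intro measurable_Pair measurable_compose[OF measurable_fst] measurable_compose[OF
          measurable_snd] measurable_restrict_space3) auto
    from measurable_compose[OF this X'] show ?thesis
      by (simp add: jointly_measurable_def split_beta')
  qed
  then show "jointly_measurable I t Q X'" using t by blast
  have "(\<integral>\<omega>. cylinder K X' \<omega> \<partial>Q) = (\<integral>\<omega>. cylinder K X \<omega> \<partial>P x)" if "test_list (I \<inter> {0..t}) K" for K
  proof -
    have K: "test_list I K" using that by (auto simp: test_list_def)
    have "X' u \<in> Q \<rightarrow>\<^sub>M borel" if "u \<in> I" for u using jointly_measurable_section[OF jm[OF that] that]
      by simp
    moreover have "X u \<in> P x \<rightarrow>\<^sub>M borel" if "u \<in> I" for u using X_measurable[OF that]
      by (simp add: measurable_P)
    ultimately show ?thesis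
      using path_law_cylinder[OF K, of X' Q] path_law_cylinder[OF K, of X "P x"] law by simp
  qed
  then show "(\<integral>\<omega>. penalization I \<rho> X' t \<omega> * f (X' t \<omega>) \<partial>Q) = T t f x"
    unfolding penalized_semigroup_def
    by (rule penalized_expectation_cong[OF time_set t prob_space.finite_measure[OF Q] jm[OF t]
        finite_P X_jointly_measurable_P[OF t] \<rho>_bounds _ f])
qed

lemma mass_bounds:
  assumes t: "t \<in> I" shows "exp (- c * t) \<le> T t (\<lambda>_. 1) x" "T t (\<lambda>_. 1) x \<le> 1" "0 < T t (\<lambda>_. 1) x"
proof -
  interpret prob_space "P x" by (rule prob_P)
  have i: "integrable (P x) (Z t)" using Z_bounds[OF t]
    by (intro integrable_P[of _ 1] Z_measurable t) auto
  have T1: "T t (\<lambda>_. 1) x = (\<integral>\<omega>. Z t \<omega> \<partial>P x)" by (simp add: penalized_semigroup_def)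
  show ge: "exp (- c * t) \<le> T t (\<lambda>_. 1) x" unfolding T1
    using Z_bounds[OF t] by (intro integral_ge_const i) (auto simp: space_P)
  show "T t (\<lambda>_. 1) x \<le> 1" unfolding T1
    using Z_bounds[OF t] by (intro integral_le_const i) (auto simp: space_P)
  show "0 < T t (\<lambda>_. 1) x" using ge exp_gt_zero less_le_trans by blast
qed

text \<open>
Both inequalities go through \<open>\<integral>\<omega>. penalization I \<rho> X' t \<omega> * f (Y' t \<omega>) \<partial>Q\<close>. Replacing \<open>Y'\<close> by \<open>X'\<close>
in the argument of \<open>f\<close> costs the coupled distance under the weight of the first path, which
condition (A) controls. For the first inequality, this weight is replaced by that of the second
path: the unweighted distance is at most \<open>e\<^sup>c\<^sup>u\<close> times the weighted one at each time \<open>u \<le> t\<close>. For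
the second inequality, \<open>f \<ge> 0\<close> and the two weights lie between \<open>e\<^sup>-\<^sup>c\<^sup>t\<close> and 1.
\<close>
lemma coupling_estimates:
  fixes Q :: "'c measure"
  assumes cpl: "markovian_coupling I P X x y Q X' Y'"
    and A: "\<And>t. t \<in> I \<Longrightarrow> (\<integral>\<omega>. penalization I \<rho> X' t \<omega> / T t (\<lambda>_. 1) x * dist (X' t \<omega>) (Y' t \<omega>) \<partial>Q)
        \<le> C * exp (- \<gamma> * t) * dist x y"
    and C: "0 < C" and \<gamma>: "0 < \<gamma>" and lip: "L-lipschitz_on UNIV \<rho>" and D: "\<And>x y::'a. dist x y \<le> D"
    and t: "t \<in> I" and f: "l-lipschitz_on UNIV f" and B: "\<And>x. \<bar>f x\<bar> \<le> B"
  shows "\<bar>T t f x - T t f y\<bar> \<le> (l * C * exp (- \<gamma> * t) * T t (\<lambda>_. 1) x + B * (L * t * (C * exp (c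
      * t)))) * dist x y"
    and "(\<And>x. 0 \<le> f x) \<Longrightarrow> exp (- c * t) * (T t f x - l * C * exp (- \<gamma> * t) * T t (\<lambda>_. 1) x * D)
        \<le> T t f y"
proof -
  have Q: "prob_space Q" and X': "(\<lambda>(s, \<omega>). X' s \<omega>) \<in> restrict_space borel I \<Otimes>\<^sub>M Q \<rightarrow>\<^sub>M borel"
    and Y': "(\<lambda>(s, \<omega>). Y' s \<omega>) \<in> restrict_space borel I \<Otimes>\<^sub>M Q \<rightarrow>\<^sub>M borel"
    and lX: "path_law I Q X' = path_law I (P x) X" and lY: "path_law I Q Y' = path_law I (P y) X"
    using cpl by (auto simp: markovian_coupling_def)
  interpret Q: prob_space Q by (rule Q)
  have l0: "0 \<le> l" using f by (rule lipschitz_on_nonneg)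
  have B0: "0 \<le> B" using B[of undefined] by simp
  have f_meas[measurable]: "f \<in> borel_measurable borel"
    by (intro borel_measurable_continuous_onI lipschitz_on_continuous_on[OF f])
  have f_bdd: "bounded (range f)" using B by (auto simp: bounded_iff)
  have jmX: "jointly_measurable I u Q X'" and jmY: "jointly_measurable I u Q Y'" if "u \<in> I" for u
    using coupled_expectation(1)[OF Q X' lX that f_meas f_bdd]
        coupled_expectation(1)[OF Q Y' lY that f_meas f_bdd] by auto
  have Xm[measurable]: "X' u \<in> Q \<rightarrow>\<^sub>M borel" and Ym[measurable]: "Y' u \<in> Q \<rightarrow>\<^sub>M borel" if "u \<in> I" for u
    using jointly_measurable_section[OF jmX[OF that] that]
        jointly_measurable_section[OF jmY[OF that] that] by auto
  let ?Z = "penalization I \<rho> X'" and ?W = "penalization I \<rho> Y'"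
  have Zm[measurable]: "?Z u \<in> borel_measurable Q" and Wm[measurable]: "?W u \<in> borel_measurable Q"
    if "u \<in> I" for u
    using penalization_measurable[OF time_set that jmX[OF that] \<rho>_measurable]
        penalization_measurable[OF time_set that jmY[OF that] \<rho>_measurable] by auto
  have Zb: "exp (- c * u) \<le> ?Z u \<omega>" "?Z u \<omega> \<le> 1" and Wb: "exp (- c * u) \<le> ?W u \<omega>" "?W u \<omega> \<le> 1"
    if "u \<in> I" "\<omega> \<in> space Q" for u \<omega>
    using penalization_bounds[OF time_set that(1) jmX[OF that(1)] \<rho>_bounds that(2)]
      penalization_bounds[OF time_set that(1) jmY[OF that(1)] \<rho>_bounds that(2)] by auto
  have Zn: "0 \<le> ?Z u \<omega>" and Wn: "0 \<le> ?W u \<omega>" if "u \<in> I" "\<omega> \<in> space Q" for u \<omega>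
    using Zb(1)[OF that] Wb(1)[OF that] exp_ge_zero order_trans by blast+
  have D0: "0 \<le> D" using D[of undefined undefined] by simp
  have di: "integrable Q (\<lambda>\<omega>. dist (X' u \<omega>) (Y' u \<omega>))"
    and Zdi: "integrable Q (\<lambda>\<omega>. ?Z u \<omega> * dist (X' u \<omega>) (Y' u \<omega>))"
    if u: "u \<in> I" for u
  proof -
    note [measurable] = Xm[OF u] Ym[OF u] Zm[OF u]
    show "integrable Q (\<lambda>\<omega>. dist (X' u \<omega>) (Y' u \<omega>))"
      by (rule integrable_bounded_measurable[OF Q.finite_measure_axioms, of _ D]) (use D in auto)
    show "integrable Q (\<lambda>\<omega>. ?Z u \<omega> * dist (X' u \<omega>) (Y' u \<omega>))"
    proof (rule integrable_bounded_measurable[OF Q.finite_measure_axioms, of _ "1 * D"])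
      fix \<omega> assume \<omega>: "\<omega> \<in> space Q"
      show "\<bar>?Z u \<omega> * dist (X' u \<omega>) (Y' u \<omega>)\<bar> \<le> 1 * D"
        unfolding abs_mult using Zb[OF u \<omega>] Zn[OF u \<omega>] D by (intro mult_mono) auto
    qed measurable
  qed
  have Zd: "(\<integral>\<omega>. ?Z u \<omega> * dist (X' u \<omega>) (Y' u \<omega>) \<partial>Q) \<le> C * exp (- \<gamma> * u) * T u (\<lambda>_. 1) x * dist x y"
    if u: "u \<in> I" for u
  proof -
    have "(\<integral>\<omega>. ?Z u \<omega> / T u (\<lambda>_. 1) x * dist (X' u \<omega>) (Y' u \<omega>) \<partial>Q)
        = (\<integral>\<omega>. ?Z u \<omega> * dist (X' u \<omega>) (Y' u \<omega>) \<partial>Q) / T u (\<lambda>_. 1) x"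
      by (simp add: times_divide_eq_left)
    then show ?thesis using A[OF u] mass_bounds(3)[OF u, of x] by (simp add: field_simps)
  qed
  have Ed: "(\<integral>\<omega>. dist (X' u \<omega>) (Y' u \<omega>) \<partial>Q) \<le> C * exp (c * t) * dist x y" if u: "u \<in> I" "u \<le> t"
    for u
  proof -
    have u0: "0 \<le> u" by (rule I_nonneg[OF u(1)])
    have "exp (- c * u) * (\<integral>\<omega>. dist (X' u \<omega>) (Y' u \<omega>) \<partial>Q)
        = (\<integral>\<omega>. exp (- c * u) * dist (X' u \<omega>) (Y' u \<omega>) \<partial>Q)" by simp
    also have "\<dots> \<le> (\<integral>\<omega>. ?Z u \<omega> * dist (X' u \<omega>) (Y' u \<omega>) \<partial>Q)"
      using di[OF u(1)] Zdi[OF u(1)] Zb[OF u(1)] by (intro integral_mono mult_right_mono) auto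
    also have "\<dots> \<le> C * exp (- \<gamma> * u) * T u (\<lambda>_. 1) x * dist x y" by (rule Zd[OF u(1)])
    also have "\<dots> \<le> C * 1 * 1 * dist x y"
      using C \<gamma> u0 mass_bounds[OF u(1), of x] by (intro mult_right_mono mult_mono) auto
    finally have "(\<integral>\<omega>. dist (X' u \<omega>) (Y' u \<omega>) \<partial>Q) \<le> exp (c * u) * (C * dist x y)"
      by (simp add: exp_minus field_simps)
    also have "\<dots> \<le> exp (c * t) * (C * dist x y)"
      using u C c_nonneg by (intro mult_right_mono) (auto intro: mult_left_mono)
    finally show ?thesis by (simp add: mult.assoc mult.left_commute)
  qed
  have Tx: "T t f x = (\<integral>\<omega>. ?Z t \<omega> * f (X' t \<omega>) \<partial>Q)" and Ty: "T t f y = (\<integral>\<omega>. ?W t \<omega> * f (Y' t \<omega>) \<partial>Q)"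
    using coupled_expectation(2)[OF Q X' lX t f_meas f_bdd]
        coupled_expectation(2)[OF Q Y' lY t f_meas f_bdd] by auto
  note [measurable] = Xm[OF t] Ym[OF t] Zm[OF t] Wm[OF t]
  have pb: "\<bar>p * f z\<bar> \<le> B" if "0 \<le> p" "p \<le> 1" for p z
  proof -
    have "\<bar>p * f z\<bar> \<le> 1 * B" unfolding abs_mult using that B B0 by (intro mult_mono) auto
    then show ?thesis by simp
  qed
  have i: "integrable Q (\<lambda>\<omega>. ?Z t \<omega> * f (X' t \<omega>))" "integrable Q (\<lambda>\<omega>. ?Z t \<omega> * f (Y' t \<omega>))"
      "integrable Q (\<lambda>\<omega>. ?W t \<omega> * f (Y' t \<omega>))"
    using Zb[OF t] Zn[OF t] Wb[OF t] Wn[OF t]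
    by (auto intro!: integrable_bounded_measurable[OF Q.finite_measure_axioms, of _ B] pb)
  have close: "\<bar>(\<integral>\<omega>. ?Z t \<omega> * f (X' t \<omega>) \<partial>Q) - (\<integral>\<omega>. ?Z t \<omega> * f (Y' t \<omega>) \<partial>Q)\<bar>
      \<le> l * (C * exp (- \<gamma> * t) * T t (\<lambda>_. 1) x * dist x y)"
  proof -
    have "\<bar>(\<integral>\<omega>. ?Z t \<omega> * f (X' t \<omega>) \<partial>Q) - (\<integral>\<omega>. ?Z t \<omega> * f (Y' t \<omega>) \<partial>Q)\<bar>
        = \<bar>\<integral>\<omega>. ?Z t \<omega> * f (X' t \<omega>) - ?Z t \<omega> * f (Y' t \<omega>) \<partial>Q\<bar>"
      using i by simp
    also have "\<dots> \<le> (\<integral>\<omega>. \<bar>?Z t \<omega> * f (X' t \<omega>) - ?Z t \<omega> * f (Y' t \<omega>)\<bar> \<partial>Q)"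
      by (rule integral_abs_bound)
    also have "\<dots> \<le> (\<integral>\<omega>. l * (?Z t \<omega> * dist (X' t \<omega>) (Y' t \<omega>)) \<partial>Q)"
    proof (rule integral_mono)
      fix \<omega> assume \<omega>: "\<omega> \<in> space Q"
      have "\<bar>?Z t \<omega> * f (X' t \<omega>) - ?Z t \<omega> * f (Y' t \<omega>)\<bar> = ?Z t \<omega> * \<bar>f (X' t \<omega>) - f (Y' t \<omega>)\<bar>"
        using Zn[OF t \<omega>] by (simp add: right_diff_distrib[symmetric] abs_mult)
      also have "\<dots> \<le> ?Z t \<omega> * (l * dist (X' t \<omega>) (Y' t \<omega>))"
        using lipschitz_onD[OF f, of "X' t \<omega>" "Y' t \<omega>"] Zn[OF t \<omega>]
          by (intro mult_left_mono) (auto simp: dist_real_def)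
      finally show "\<bar>?Z t \<omega> * f (X' t \<omega>) - ?Z t \<omega> * f (Y' t \<omega>)\<bar>
          \<le> l * (?Z t \<omega> * dist (X' t \<omega>) (Y' t \<omega>))"
        by (simp add: mult.left_commute)
    qed (use i Zdi[OF t] in auto)
    also have "\<dots> = l * (\<integral>\<omega>. ?Z t \<omega> * dist (X' t \<omega>) (Y' t \<omega>) \<partial>Q)" by simp
    also have "\<dots> \<le> l * (C * exp (- \<gamma> * t) * T t (\<lambda>_. 1) x * dist x y)" using Zd[OF t] l0
      by (rule mult_left_mono)
    finally show ?thesis .
  qed
  show "\<bar>T t f x - T t f y\<bar> \<le> (l * C * exp (- \<gamma> * t) * T t (\<lambda>_. 1) x + B * (L * t * (C * exp (c
      * t)))) * dist x y"
  proof -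
    have ZWi: "integrable Q (\<lambda>\<omega>. \<bar>?Z t \<omega> - ?W t \<omega>\<bar>)"
    proof (rule integrable_bounded_measurable[OF Q.finite_measure_axioms, of _ 1])
      fix \<omega> assume "\<omega> \<in> space Q"
      with Zb[OF t this] Zn[OF t this] Wb[OF t this] Wn[OF t this]
      show "\<bar>\<bar>?Z t \<omega> - ?W t \<omega>\<bar>\<bar> \<le> 1" by linarith
    qed measurable
    have "\<bar>(\<integral>\<omega>. ?Z t \<omega> * f (Y' t \<omega>) \<partial>Q) - (\<integral>\<omega>. ?W t \<omega> * f (Y' t \<omega>) \<partial>Q)\<bar>
        = \<bar>\<integral>\<omega>. ?Z t \<omega> * f (Y' t \<omega>) - ?W t \<omega> * f (Y' t \<omega>) \<partial>Q\<bar>"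
      using i by simp
    also have "\<dots> \<le> (\<integral>\<omega>. \<bar>?Z t \<omega> * f (Y' t \<omega>) - ?W t \<omega> * f (Y' t \<omega>)\<bar> \<partial>Q)"
      by (rule integral_abs_bound)
    also have "\<dots> \<le> (\<integral>\<omega>. B * \<bar>?Z t \<omega> - ?W t \<omega>\<bar> \<partial>Q)"
    proof (rule integral_mono)
      fix \<omega>
      have "\<bar>?Z t \<omega> * f (Y' t \<omega>) - ?W t \<omega> * f (Y' t \<omega>)\<bar> = \<bar>f (Y' t \<omega>)\<bar> * \<bar>?Z t \<omega> - ?W t \<omega>\<bar>"
        by (simp add: abs_mult[symmetric] right_diff_distrib mult.commute)
      also have "\<dots> \<le> B * \<bar>?Z t \<omega> - ?W t \<omega>\<bar>" by (intro mult_right_mono B) auto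
      finally show "\<bar>?Z t \<omega> * f (Y' t \<omega>) - ?W t \<omega> * f (Y' t \<omega>)\<bar> \<le> B * \<bar>?Z t \<omega> - ?W t \<omega>\<bar>" .
    qed (use i ZWi in auto)
    also have "\<dots> = B * (\<integral>\<omega>. \<bar>?Z t \<omega> - ?W t \<omega>\<bar> \<partial>Q)" by simp
    also have "\<dots> \<le> B * (L * t * (C * exp (c * t) * dist x y))"
      using B0 Ed by (intro mult_left_mono expected_penalization_diff[OF time_set t Q jmX[OF t]
          jmY[OF t] \<rho>_bounds lip D]) auto
    finally have "\<bar>(\<integral>\<omega>. ?Z t \<omega> * f (Y' t \<omega>) \<partial>Q) - (\<integral>\<omega>. ?W t \<omega> * f (Y' t \<omega>) \<partial>Q)\<bar>
        \<le> B * (L * t * (C * exp (c * t) * dist x y))" .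
    with close have "\<bar>T t f x - T t f y\<bar>
        \<le> l * (C * exp (- \<gamma> * t) * T t (\<lambda>_. 1) x * dist x y) + B *
        (L * t * (C * exp (c * t) * dist x y))"
      unfolding Tx Ty by linarith
    then show ?thesis by (simp add: algebra_simps)
  qed
  show "exp (- c * t) * (T t f x - l * C * exp (- \<gamma> * t) * T t (\<lambda>_. 1) x * D) \<le> T t f y"
    if f0: "\<And>x. 0 \<le> f x"
  proof -
    have "l * (C * exp (- \<gamma> * t) * T t (\<lambda>_. 1) x * dist x y)
        \<le> l * (C * exp (- \<gamma> * t) * T t (\<lambda>_. 1) x * D)"
      using l0 C mass_bounds(3)[OF t, of x] D by (intro mult_left_mono) auto
    then have "T t f x - l * C * exp (- \<gamma> * t) * T t (\<lambda>_. 1) x * D \<le> (\<integral>\<omega>. ?Z t \<omega> * f (Y' t \<omega>) \<partial>Q)"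
      using close unfolding Tx by (simp add: mult.assoc abs_le_iff)
    then have "exp (- c * t) * (T t f x - l * C * exp (- \<gamma> * t) * T t (\<lambda>_. 1) x * D)
        \<le> exp (- c * t) * (\<integral>\<omega>. ?Z t \<omega> * f (Y' t \<omega>) \<partial>Q)"
      by (rule mult_left_mono) simp
    also have "\<dots> = (\<integral>\<omega>. exp (- c * t) * (?Z t \<omega> * f (Y' t \<omega>)) \<partial>Q)" by simp
    also have "\<dots> \<le> (\<integral>\<omega>. ?W t \<omega> * f (Y' t \<omega>) \<partial>Q)"
    proof (rule integral_mono)
      fix \<omega> assume \<omega>: "\<omega> \<in> space Q"
      have "exp (- c * t) * (?Z t \<omega> * f (Y' t \<omega>)) \<le> ?W t \<omega> * (1 * f (Y' t \<omega>))"
        using Zb[OF t \<omega>] Wb[OF t \<omega>] Zn[OF t \<omega>] Wn[OF t \<omega>] f0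
          by (intro mult_mono mult_right_mono) auto
      then show "exp (- c * t) * (?Z t \<omega> * f (Y' t \<omega>)) \<le> ?W t \<omega> * f (Y' t \<omega>)" by simp
    qed (use i in auto)
    finally show ?thesis unfolding Ty .
  qed
qed

end

section \<open>Conditional laws and quasi-stationary distributions\<close>

context penalized_markov_process
begin

text \<open>
The set function that defines the conditional law is countably additive because it is the law of
\<open>X t\<close> under the mixture of the \<open>P x\<close> over \<open>\<mu>\<close>, reweighted by \<open>Z t\<close>.
\<close>
lemma conditional_law:
  assumes \<mu>: "\<mu> \<in> space (prob_algebra borel)" and t: "t \<in> I"
  shows "conditional_law I \<rho> P X t \<mu> \<in> space (prob_algebra borel)"
    and "f \<in> borel_measurable borel \<Longrightarrow> bounded (range f) \<Longrightarrow>
      (\<integral>x. f x \<partial>conditional_law I \<rho> P X t \<mu>) = (\<integral>x. T t f x \<partial>\<mu>) / (\<integral>x. T t (\<lambda>_. 1) x \<partial>\<mu>)"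
proof -
  interpret \<mu>: prob_space \<mu> by (rule prob_algebraD[OF \<mu>])
  note s\<mu>[measurable_cong] = prob_algebraD(2)[OF \<mu>]
  have ne: "space \<mu> \<noteq> {}" by (rule \<mu>.not_empty)
  have ker: "P \<in> \<mu> \<rightarrow>\<^sub>M prob_algebra \<Omega>" using kernel by (simp cong: measurable_cong_sets add: s\<mu>)
  define Q where "Q = \<mu> \<bind> P"
  have sQ: "sets Q = sets \<Omega>" unfolding Q_def by (rule sets_bind[OF _ ne]) (rule sets_P)
  have spQ: "space Q = space \<Omega>" by (rule sets_eq_imp_space_eq[OF sQ])
  have mQ: "measurable Q N = measurable \<Omega> N" for N :: "'z measure"
    by (rule measurable_cong_sets[OF sQ refl])
  have intQ: "(\<integral>\<omega>. g \<omega> \<partial>Q) = (\<integral>x. (\<integral>\<omega>. g \<omega> \<partial>P x) \<partial>\<mu>)"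
    if "g \<in> borel_measurable \<Omega>" "\<And>\<omega>. \<omega> \<in> space \<Omega> \<Longrightarrow> \<bar>g \<omega>\<bar> \<le> B" for g :: "'w \<Rightarrow> real" and B
    unfolding Q_def by (rule integral_bind_kernel[OF \<mu>.finite_measure_axioms ne ker that])
  have finQ: "finite_measure Q"
  proof (rule finite_measureI)
    have "emeasure Q (space Q) = (\<integral>\<^sup>+x. emeasure (P x) (space \<Omega>) \<partial>\<mu>)"
      unfolding spQ unfolding Q_def
        by (rule emeasure_bind[OF ne measurable_prob_algebraD[OF ker]]) auto
    also have "\<dots> = 1"
      using prob_space.emeasure_space_1[OF prob_P] \<mu>.emeasure_space_1 by (simp add: space_P)
    finally show "emeasure Q (space Q) \<noteq> \<infinity>" by simp
  qed
  define m where "m = (\<integral>x. T t (\<lambda>_. 1) x \<partial>\<mu>)"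
  have m: "0 < m"
  proof -
    have "integrable \<mu> (T t (\<lambda>_. 1))"
      by (rule integrable_bounded_borel[OF \<mu>, of _ 1]) (auto intro!: T_measurable T_bounded t)
    then have "exp (- c * t) \<le> m"
      unfolding m_def by (intro \<mu>.integral_ge_const AE_I2 mass_bounds(1)[OF t])
    then show ?thesis using exp_gt_zero less_le_trans by blast
  qed
  have Zm: "Z t \<in> borel_measurable \<Omega>" by (rule Z_measurable[OF t])
  have Xm: "X t \<in> \<Omega> \<rightarrow>\<^sub>M borel" by (rule X_measurable[OF t])
  define N where "N = distr (density Q (\<lambda>\<omega>. ennreal (Z t \<omega> / m))) borel (X t)"
  have base: "(\<integral>\<omega>. Z t \<omega> / m * f (X t \<omega>) \<partial>Q)
      = (\<integral>x. T t f x \<partial>\<mu>) / m" "integrable Q (\<lambda>\<omega>. Z t \<omega> / m * f (X t \<omega>))"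
    if f: "f \<in> borel_measurable borel" "bounded (range f)" for f
  proof -
    obtain B where B: "\<And>x. \<bar>f x\<bar> \<le> B" using f(2) by (auto simp: bounded_iff)
    have meas: "(\<lambda>\<omega>. Z t \<omega> * f (X t \<omega>)) \<in> borel_measurable \<Omega>"
      using Zm measurable_compose[OF Xm f(1)] by simp
    have bnd: "\<bar>Z t \<omega> * f (X t \<omega>)\<bar> \<le> B" if "\<omega> \<in> space \<Omega>" for \<omega> using ZfX_bound[OF t, of f B] B that
      by blast
    have "(\<integral>\<omega>. Z t \<omega> / m * f (X t \<omega>) \<partial>Q) = (\<integral>\<omega>. Z t \<omega> * f (X t \<omega>) \<partial>Q) / m"
      by (simp add: times_divide_eq_left)
    also have "\<dots> = (\<integral>x. T t f x \<partial>\<mu>) / m" using intQ[OF meas bnd]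
      by (simp add: penalized_semigroup_def)
    finally show "(\<integral>\<omega>. Z t \<omega> / m * f (X t \<omega>) \<partial>Q) = (\<integral>x. T t f x \<partial>\<mu>) / m" .
    have "integrable Q (\<lambda>\<omega>. Z t \<omega> * f (X t \<omega>))"
      using meas bnd by (intro integrable_bounded_measurable[OF finQ, of _ B]) (auto simp: mQ spQ)
    then show "integrable Q (\<lambda>\<omega>. Z t \<omega> / m * f (X t \<omega>))" by (simp add: times_divide_eq_left)
  qed
  have emN: "emeasure N A = ennreal ((\<integral>x. T t (indicator A) x \<partial>\<mu>) / m)" if A: "A \<in> sets borel" for A
  proof -
    have A': "X t -` A \<inter> space \<Omega> \<in> sets \<Omega>" using Xm A by (rule measurable_sets)
    have bA: "bounded (range (indicator A :: 'a \<Rightarrow> real))"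
      by (auto simp: bounded_iff indicator_def intro!: exI[of _ 1])
    have "emeasure N A = emeasure (density Q (\<lambda>\<omega>. ennreal (Z t \<omega> / m))) (X t -` A \<inter> space \<Omega>)"
      unfolding N_def using Xm A by (subst emeasure_distr) (auto simp: mQ spQ)
    also have "\<dots> = (\<integral>\<^sup>+\<omega>. ennreal (Z t \<omega> / m) * indicator (X t -` A \<inter> space \<Omega>) \<omega> \<partial>Q)"
      using Zm A' by (subst emeasure_density) (auto simp: mQ sQ)
    also have "\<dots> = (\<integral>\<^sup>+\<omega>. ennreal (Z t \<omega> / m * indicator A (X t \<omega>)) \<partial>Q)"
      by (intro nn_integral_cong) (auto simp: spQ indicator_def)
    also have "\<dots> = ennreal (\<integral>\<omega>. Z t \<omega> / m * indicator A (X t \<omega>) \<partial>Q)"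
      using base(2)[of "indicator A"] A bA m Z_bounds(3)[OF t]
      by (intro nn_integral_eq_integral AE_I2) (auto simp: spQ)
    also have "(\<integral>\<omega>. Z t \<omega> / m * indicator A (X t \<omega>) \<partial>Q) = (\<integral>x. T t (indicator A) x \<partial>\<mu>) / m"
      using A bA by (intro base(1)) auto
    finally show ?thesis .
  qed
  have N_eq: "conditional_law I \<rho> P X t \<mu> = N"
  proof -
    have "conditional_law I \<rho> P X t \<mu> = measure_of UNIV (sets borel) (emeasure N)"
      unfolding conditional_law_def m_def[symmetric]
      using emN sets.sigma_sets_eq[of "borel :: 'a measure"] by (intro measure_of_eq) auto
    also have "\<dots> = measure_of (space N) (sets N) (emeasure N)" by (simp add: N_def)
    finally show ?thesis by (simp only: measure_of_of_measure)
  qed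
  have "emeasure N (space N) = 1"
  proof -
    have "(indicator UNIV :: 'a \<Rightarrow> real) = (\<lambda>_. 1)" by auto
    then show ?thesis using emN[of UNIV] m by (simp add: m_def N_def)
  qed
  then have "prob_space N" by (rule prob_spaceI)
  then show "conditional_law I \<rho> P X t \<mu> \<in> space (prob_algebra borel)"
    unfolding N_eq by (simp add: space_prob_algebra N_def)
  assume f: "f \<in> borel_measurable borel" "bounded (range f)"
  have "(\<integral>x. f x \<partial>N) = (\<integral>\<omega>. f (X t \<omega>) \<partial>density Q (\<lambda>\<omega>. ennreal (Z t \<omega> / m)))"
    unfolding N_def using Xm f by (intro integral_distr) (auto simp: mQ)
  also have "\<dots> = (\<integral>\<omega>. Z t \<omega> / m * f (X t \<omega>) \<partial>Q)"
    using Zm measurable_compose[OF Xm f(1)] m Z_bounds(3)[OF t]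
    by (subst integral_density) (auto simp: mQ spQ intro!: AE_I2)
  finally show "(\<integral>x. f x \<partial>conditional_law I \<rho> P X t \<mu>) = (\<integral>x. T t f x \<partial>\<mu>) / (\<integral>x. T t (\<lambda>_. 1) x \<partial>\<mu>)"
    using base(1)[OF f] by (simp add: N_eq m_def)
qed

lemma T_zero: "f \<in> borel_measurable borel \<Longrightarrow> T 0 f x = f x"
proof -
  assume f: "f \<in> borel_measurable borel"
  interpret prob_space "P x" by (rule prob_P)
  have Z0: "Z 0 \<omega> = 1" for \<omega>
  proof -
    have "AE s in lborel. indicat_real {0..0::real} s *\<^sub>R \<rho> (X s \<omega>) = 0"
      using AE_lborel_singleton[of 0] by eventually_elim (auto simp: indicator_def)
    then have "(LBINT s:{0..0}. \<rho> (X s \<omega>)) = 0"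
      unfolding set_lebesgue_integral_def by (rule integral_eq_zero_AE)
    then show ?thesis by (simp add: penalization_def)
  qed
  have "T 0 f x = (\<integral>\<omega>. f (X 0 \<omega>) \<partial>P x)" by (simp add: penalized_semigroup_def Z0)
  also have "\<dots> = (\<integral>\<omega>. f x \<partial>P x)"
    using initial[of x] measurable_compose[OF X_measurable[OF I_0] f]
    by (intro integral_cong_AE) (auto simp: measurable_P elim: eventually_mono)
  finally show ?thesis by (simp add: prob_space)
qed

lemma penalized_operatorsI:
  assumes A: "condition_A TYPE('c) I \<rho> P X" and lip: "L-lipschitz_on UNIV \<rho>"
    and D: "\<And>x y::'a. dist x y \<le> D"
  obtains C \<gamma> where "penalized_operators I T C \<gamma> c D (\<lambda>t. L * t * (C * exp (c * t)))"
proof -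
  obtain C \<gamma> where C: "0 < C" and \<gamma>: "0 < \<gamma>" and cpl: "\<forall>x y. \<exists>(Q :: 'c measure) X' Y'.
        markovian_coupling I P X x y Q X' Y' \<and>
        (\<forall>t\<in>I. (\<integral>\<omega>. penalization I \<rho> X' t \<omega> / T t (\<lambda>_. 1) x * dist (X' t \<omega>) (Y' t \<omega>) \<partial>Q) \<le> C * exp
            (- \<gamma> * t) * dist x y)"
    using A unfolding condition_A_def by (elim exE conjE) (rule that)
  have L0: "0 \<le> L" using lip by (rule lipschitz_on_nonneg)
  have fm: "f \<in> borel_measurable borel" and fb: "bounded (range f)" if "l-lipschitz_on UNIV f"
    for f :: "'a \<Rightarrow> real" and l
    using lipschitz_borel_measurable[OF that] lipschitz_bounded[OF D that]
      by (auto simp: bounded_iff)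
  have fi: "integrable (P x) (\<lambda>\<omega>. Z t \<omega> * f (X t \<omega>))" if "t \<in> I" "l-lipschitz_on UNIV f"
    for f :: "'a \<Rightarrow> real" and l t x
    by (rule ZfX_integrable[OF that(1) fm[OF that(2)] fb[OF that(2)]])
  have "penalized_operators I T C \<gamma> c D (\<lambda>t. L * t * (C * exp (c * t)))"
  proof
    show "0 \<le> L * t * (C * exp (c * t))" if "0 \<le> t" for t using L0 C that by simp
    show "L * s * (C * exp (c * s)) \<le> L * t * (C * exp (c * t))" if "0 \<le> s" "s \<le> t" for s t
      using L0 C c_nonneg that by (intro mult_mono mult_left_mono) (auto intro: mult_left_mono)
    show "T t (\<lambda>x. f x + g x) x = T t f x + T t g x"
      if "t \<in> I" "l-lipschitz_on UNIV f" "m-lipschitz_on UNIV g" for t f g l m x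
      using fi[OF that(1,2)] fi[OF that(1,3)] by (simp add: penalized_semigroup_def distrib_left)
    show "T t (\<lambda>x. a * f x) x = a * T t f x" for t a f x
      by (simp add: penalized_semigroup_def mult.left_commute)
    show "T t f x \<le> T t g x"
      if "t \<in> I" "l-lipschitz_on UNIV f" "m-lipschitz_on UNIV g" "\<And>x. f x \<le> g x" for t f g l m x
      unfolding penalized_semigroup_def
        using fi[OF that(1,2)] fi[OF that(1,3)] that Z_bounds[OF that(1)]
      by (intro integral_mono mult_left_mono) (auto simp: space_P)
    show "T (s + t) f x = T s (T t f) x" if "s \<in> I" "t \<in> I" "l-lipschitz_on UNIV f" for s t f l x
      by (rule T_semigroup[OF that(1,2) fm[OF that(3)] fb[OF that(3)]])
    show "\<bar>T t f x - T t f y\<bar> \<le> (l * C * exp (- \<gamma> * t) * T t (\<lambda>_. 1) x + B * (L * t * (C * exp (c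
        * t)))) * dist x y"
      if "t \<in> I" "l-lipschitz_on UNIV f" "\<And>x. \<bar>f x\<bar> \<le> B" for t f l B x y
    proof -
      obtain Q :: "'c measure" and X' Y' where Q: "markovian_coupling I P X x y Q X' Y'"
        "\<And>t. t \<in> I \<Longrightarrow> (\<integral>\<omega>. penalization I \<rho> X' t \<omega> / T t (\<lambda>_. 1) x * dist (X' t \<omega>) (Y' t \<omega>) \<partial>Q)
            \<le> C * exp (- \<gamma> * t) * dist x y"
        using cpl[rule_format, of x y] by (elim exE conjE) (rule that, auto)
      show ?thesis by (rule coupling_estimates(1)[OF Q C \<gamma> lip D that])
    qed
    show "exp (- c * t) * (T t f x - l * C * exp (- \<gamma> * t) * T t (\<lambda>_. 1) x * D) \<le> T t f y"
      if "t \<in> I" "l-lipschitz_on UNIV f" "\<And>x. 0 \<le> f x" for t f l x y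
    proof -
      obtain Q :: "'c measure" and X' Y' where Q: "markovian_coupling I P X x y Q X' Y'"
        "\<And>t. t \<in> I \<Longrightarrow> (\<integral>\<omega>. penalization I \<rho> X' t \<omega> / T t (\<lambda>_. 1) x * dist (X' t \<omega>) (Y' t \<omega>) \<partial>Q)
            \<le> C * exp (- \<gamma> * t) * dist x y"
        using cpl[rule_format, of x y] by (elim exE conjE) (rule that, auto)
      show ?thesis by (rule coupling_estimates(2)[OF Q C \<gamma> lip D that(1,2) lipschitz_bounded[OF D
          that(2)] that(3)])
    qed
    show "T 0 f x = f x" if "l-lipschitz_on UNIV f" for f l x by (rule T_zero[OF fm[OF that]])
  qed (use D I_nat I_add I_diff I_nonneg C \<gamma> c_nonneg mass_bounds in auto)
  then show ?thesis using that by blast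
qed

text \<open>
Both sides integrate a function \<open>f\<close> to the same quotient, because \<open>T t (T s f) = T (t + s) f\<close>.
\<close>
lemma conditional_law_compose:
  assumes ops: "penalized_operators I T C \<gamma> c D K"
    and \<mu>: "\<mu> \<in> space (prob_algebra borel)" and s: "s \<in> I" and t: "t \<in> I"
  shows "conditional_law I \<rho> P X s (conditional_law I \<rho> P X t \<mu>)
      = conditional_law I \<rho> P X (t + s) \<mu>"
proof -
  interpret ops: penalized_operators I T C \<gamma> c D K by (rule ops)
  let ?\<nu> = "conditional_law I \<rho> P X t \<mu>"
  have \<nu>: "?\<nu> \<in> space (prob_algebra borel)" by (rule conditional_law(1)[OF \<mu> t])
  interpret \<mu>: prob_space \<mu> by (rule prob_algebraD[OF \<mu>])
  have fm: "f \<in> borel_measurable borel" and fb: "bounded (range f)" if "l-lipschitz_on UNIV f"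
    for f :: "'a \<Rightarrow> real" and l
    using lipschitz_borel_measurable[OF that] lipschitz_bounded[OF ops.dist_le that]
      by (auto simp: bounded_iff)
  have step: "(\<integral>x. T s f x \<partial>?\<nu>) = (\<integral>x. T (t + s) f x \<partial>\<mu>) / (\<integral>x. T t (\<lambda>_. 1) x \<partial>\<mu>)"
    if f: "l-lipschitz_on UNIV f" for f l
  proof -
    obtain m where m: "m-lipschitz_on UNIV (T s f)" using ops.T_lip[OF s f] .
    show ?thesis using conditional_law(2)[OF \<mu> t fm[OF m] fb[OF m]] ops.semigroup[OF t s f] by simp
  qed
  have pos: "0 < (\<integral>x. T t (\<lambda>_. 1) x \<partial>\<mu>)"
  proof -
    obtain m where m: "m-lipschitz_on UNIV (T t (\<lambda>_. 1))" using ops.h_lip[OF t] .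
    have "exp (- c * t) \<le> (\<integral>x. T t (\<lambda>_. 1) x \<partial>\<mu>)"
      by (rule \<mu>.integral_ge_const[OF lipschitz_integrable[OF ops.dist_le m \<mu>]])
          (use mass_bounds(1)[OF t] in auto)
    then show ?thesis using exp_gt_zero less_le_trans by blast
  qed
  show ?thesis
  proof (rule measure_eqI_lipschitz[OF conditional_law(1)[OF \<nu> s] conditional_law(1)[OF \<mu> I_add[OF t
      s]]])
    fix f :: "'a \<Rightarrow> real" and l assume f: "l-lipschitz_on UNIV f"
    show "(\<integral>x. f x \<partial>conditional_law I \<rho> P X s ?\<nu>) = (\<integral>x. f x \<partial>conditional_law I \<rho> P X (t + s) \<mu>)"
      using conditional_law(2)[OF \<nu> s fm[OF f] fb[OF f]]
          conditional_law(2)[OF \<mu> I_add[OF t s] fm[OF f] fb[OF f]]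
        step[OF f] step[OF ops.lip_const[of 1]] pos by simp
  qed
qed

text \<open>
By duality it suffices to compare the two conditional laws on a 1-Lipschitz \<open>f\<close>. Writing \<open>T t f =
h (g + a)\<close> with \<open>g\<close> small and of small Lipschitz constant, both integrals are averages of \<open>g + a\<close>
with weights \<open>h / m\<close> and \<open>h / n\<close>. The difference of these weights is controlled by the Harnack
inequality, and each error term carries a factor that decays exponentially.
\<close>
lemma wasserstein_contraction:
  assumes ops: "penalized_operators I T C \<gamma> c D K"
  obtains C1 \<alpha> where "0 < C1" "0 < \<alpha>"
    "\<And>\<mu> \<nu> t. \<mu> \<in> space (prob_algebra borel) \<Longrightarrow> \<nu> \<in> space (prob_algebra borel) \<Longrightarrow> t \<in> I \<Longrightarrow>
       wasserstein (conditional_law I \<rho> P X t \<mu>) (conditional_law I \<rho> P X t \<nu>) \<le> C1 * exp (- \<alpha> * t)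
           * wasserstein \<mu> \<nu>"
proof -
  interpret ops: penalized_operators I T C \<gamma> c D K by (rule ops)
  obtain R where R: "1 \<le> R" "\<And>t x y. t \<in> I \<Longrightarrow> T t (\<lambda>_. 1) x \<le> R * T t (\<lambda>_. 1) y"
    "\<And>t x y z. t \<in> I \<Longrightarrow> \<bar>T t (\<lambda>_. 1) x - T t (\<lambda>_. 1) y\<bar> \<le> R * T t (\<lambda>_. 1) z * dist x y"
    using ops.harnack by blast
  interpret har: harnack_operators I T C \<gamma> c D K R
    using R by unfold_locales auto
  obtain C0 \<alpha> where C0: "0 < C0" and \<alpha>: "0 < \<alpha>"
    and contr: "\<And>t f x y. t \<in> I \<Longrightarrow> 1-lipschitz_on UNIV f \<Longrightarrow>
     \<bar>T t f x / T t (\<lambda>_. 1) x - T t f y / T t (\<lambda>_. 1) y\<bar> \<le> C0 * exp (- \<alpha> * t) * dist x y"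
    using har.contraction by blast
  define k where "k = R + D * (R * R) + D * (R * (R * R))"
  have D0: "0 \<le> D" by (rule ops.D_nonneg)
  have k: "0 < k" unfolding k_def using R(1) D0 by (intro add_pos_nonneg mult_nonneg_nonneg) auto
  have "wasserstein (conditional_law I \<rho> P X t \<mu>) (conditional_law I \<rho> P X t \<nu>)
      \<le> (C0 * k) * exp (- \<alpha> * t) * wasserstein \<mu> \<nu>"
    if \<mu>: "\<mu> \<in> space (prob_algebra borel)" and \<nu>: "\<nu> \<in> space (prob_algebra borel)" and t: "t \<in> I"
      for \<mu> \<nu> t
  proof (rule wasserstein_le[OF conditional_law(1)[OF \<mu> t] conditional_law(1)[OF \<nu> t] ops.dist_le])
    define W where "W = wasserstein \<mu> \<nu>"
    have W0: "0 \<le> W" unfolding W_def by (rule wasserstein_nonneg[OF \<mu> \<nu>])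
    show "0 \<le> (C0 * k) * exp (- \<alpha> * t) * wasserstein \<mu> \<nu>" using C0 k W0 by (simp add: W_def)
    fix f :: "'a \<Rightarrow> real" assume f: "1-lipschitz_on UNIV f"
    interpret \<mu>: prob_space \<mu> by (rule prob_algebraD[OF \<mu>])
    interpret \<nu>: prob_space \<nu> by (rule prob_algebraD[OF \<nu>])
    define h where "h = T t (\<lambda>_. 1)"
    define \<epsilon> where "\<epsilon> = C0 * exp (- \<alpha> * t)"
    \<comment> \<open>Centring at an arbitrary point; it does not affect differences of averages.\<close>
    define a where "a = T t f undefined / h undefined"
    define m where "m = (\<integral>x. h x \<partial>\<mu>)"
    define n where "n = (\<integral>x. h x \<partial>\<nu>)"
    define g where "g x = T t f x / h x - a" for x
    have \<epsilon>: "0 < \<epsilon>" using C0 by (simp add: \<epsilon>_def)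
    have hpos: "0 < h x" for x unfolding h_def by (rule ops.h_pos[OF t])
    have hg: "h x * g x = T t f x - a * h x" for x using hpos[of x] by (simp add: g_def field_simps)
    obtain lh where lh: "lh-lipschitz_on UNIV h" using ops.h_lip[OF t] unfolding h_def .
    obtain lF where lF: "lF-lipschitz_on UNIV (T t f)" using ops.T_lip[OF t f] .
    have g_lip: "\<bar>g x - g y\<bar> \<le> \<epsilon> * dist x y" for x y
      using contr[OF t f, of x y] by (simp add: g_def h_def \<epsilon>_def)
    have g_bound: "\<bar>g x\<bar> \<le> \<epsilon> * D" for x
    proof -
      have "\<bar>g x\<bar> \<le> \<epsilon> * dist x undefined" using g_lip[of x undefined] by (simp add: g_def a_def)
      also have "\<dots> \<le> \<epsilon> * D" using \<epsilon> ops.dist_le by (intro mult_left_mono) auto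
      finally show ?thesis .
    qed
    have ih: "integrable \<mu> h" "integrable \<nu> h"
      using lipschitz_integrable[OF ops.dist_le lh] \<mu> \<nu> by auto
    have hR: "h x \<le> R * h y" for x y unfolding h_def by (rule R(2)[OF t])
    have h_m: "h x \<le> R * m" and h_n: "h x \<le> R * n" for x
    proof -
      have "h x / R \<le> h y" for y using hR[of x y] R(1) by (simp add: field_simps)
      then have "h x / R \<le> m" "h x / R \<le> n"
        unfolding m_def n_def using ih by (auto intro!: \<mu>.integral_ge_const \<nu>.integral_ge_const)
      then show "h x \<le> R * m" "h x \<le> R * n" using R(1) by (auto simp: field_simps)
    qed
    have mn: "0 < m" "0 < n"
      using less_le_trans[OF hpos h_m] less_le_trans[OF hpos h_n] R(1)
      by (auto simp: zero_less_mult_iff)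
    have h_diff: "\<bar>h x - h y\<bar> \<le> R * R * m * dist x y" for x y
    proof -
      have "\<bar>h x - h y\<bar> \<le> R * h x * dist x y" unfolding h_def by (rule R(3)[OF t])
      also have "\<dots> \<le> R * (R * m) * dist x y"
        using R(1) h_m by (intro mult_right_mono mult_left_mono) auto
      finally show ?thesis by (simp add: mult.assoc)
    qed
    have hl: "(R * R * m)-lipschitz_on UNIV h"
      using h_diff R(1) mn by (intro lipschitz_onI) (auto simp: dist_real_def)
    have nm: "\<bar>m - n\<bar> \<le> R * R * m * W"
      unfolding W_def using lipschitz_integral_diff_le[OF \<mu> \<nu> ops.dist_le hl]
        by (simp add: m_def n_def)
    have lip_hg: "\<exists>l. l-lipschitz_on UNIV (\<lambda>x. h x * g x / q)" for q
    proof -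
      have "\<exists>l. l-lipschitz_on UNIV (\<lambda>x. (1 / q) * (T t f x - a * h x))"
        using lipschitz_on_cmult_real[OF lipschitz_on_diff[OF lF lipschitz_on_cmult_real[OF lh]]]
          by blast
      then show ?thesis by (simp add: hg)
    qed
    obtain l1 l2 where l1: "l1-lipschitz_on UNIV (\<lambda>x. h x * g x / m)"
      and l2: "l2-lipschitz_on UNIV (\<lambda>x. h x * g x / n)"
      using lip_hg by blast
    have "(\<integral>x. f x \<partial>conditional_law I \<rho> P X t M) = (\<integral>x. h x * g x / q \<partial>M) + a"
      if M: "M \<in> space (prob_algebra borel)" and q: "q = (\<integral>x. h x \<partial>M)" "0 < q" "integrable M h"
        for M q
    proof -
      have i: "integrable M (T t f)" by (rule lipschitz_integrable[OF ops.dist_le lF M])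
      have "(\<integral>x. f x \<partial>conditional_law I \<rho> P X t M) = (\<integral>x. T t f x \<partial>M) / q"
        using conditional_law(2)[OF M t lipschitz_borel_measurable[OF f]]
            lipschitz_bounded[OF ops.dist_le f] q
        by (auto simp: h_def bounded_iff)
      moreover have "(\<integral>x. h x * g x / q \<partial>M) = (\<integral>x. T t f x \<partial>M) / q - a"
        using i q by (simp add: hg diff_divide_distrib)
      ultimately show ?thesis by simp
    qed
    then have "(\<integral>x. f x \<partial>conditional_law I \<rho> P X t \<mu>) - (\<integral>x. f x \<partial>conditional_law I \<rho> P X t \<nu>)
      = (\<integral>x. h x * g x / m \<partial>\<mu>) - (\<integral>x. h x * g x / n \<partial>\<nu>)"
      using \<mu> \<nu> mn ih by (simp add: m_def n_def)
    also have "\<dots> \<le> (\<epsilon> * (R + D * (R * R))) * wasserstein \<mu> \<nu> + \<epsilon> * (D * (R * (R * R))) * W"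
    proof (rule integral_coupling_diff_le[OF \<mu> \<nu> ops.dist_le l1 l2])
      show "0 \<le> \<epsilon> * (R + D * (R * R))" using \<epsilon> R(1) D0 by simp
      fix x y
      have "h x * g x / m - h y * g y / n
          = (h x / m) * (g x - g y) + g y * ((h x - h y) / m) + g y * (h y / n * ((n - m) / m))"
        using mn by (simp add: field_simps)
      also have "\<dots> \<le> R * (\<epsilon> * dist x y) + (\<epsilon> * D) * (R * R * dist x y)
          + (\<epsilon> * D) * (R * (R * R * W))"
      proof (intro add_mono)
        have hm: "0 \<le> h x / m" "h x / m \<le> R" using h_m[of x] hpos[of x] mn
          by (auto simp: field_simps)
        have "(h x / m) * (g x - g y) \<le> (h x / m) * (\<epsilon> * dist x y)"
          using g_lip[of x y] hm by (intro mult_left_mono) auto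
        also have "\<dots> \<le> R * (\<epsilon> * dist x y)" using \<epsilon> hm by (intro mult_right_mono) auto
        finally show "(h x / m) * (g x - g y) \<le> R * (\<epsilon> * dist x y)" .
        have "g y * ((h x - h y) / m) \<le> \<bar>g y\<bar> * \<bar>(h x - h y) / m\<bar>" by (metis abs_ge_self abs_mult)
        also have "\<dots> \<le> (\<epsilon> * D) * (R * R * dist x y)"
          using g_bound[of y] h_diff[of x y] mn \<epsilon> D0 by (intro mult_mono) (auto simp: field_simps)
        finally show "g y * ((h x - h y) / m) \<le> (\<epsilon> * D) * (R * R * dist x y)" .
        have hn: "\<bar>h y / n\<bar> \<le> R" using h_n[of y] hpos[of y] mn by (auto simp: field_simps)
        have nm': "\<bar>(n - m) / m\<bar> \<le> R * R * W" using nm mn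
          by (simp add: abs_minus_commute field_simps)
        have "g y * (h y / n * ((n - m) / m)) \<le> \<bar>g y\<bar> * (\<bar>h y / n\<bar> * \<bar>(n - m) / m\<bar>)"
          by (metis abs_ge_self abs_mult)
        also have "\<dots> \<le> (\<epsilon> * D) * (R * (R * R * W))"
          using g_bound[of y] hn nm' \<epsilon> D0 R(1)
            by (intro mult_mono mult_nonneg_nonneg abs_ge_zero) auto
        finally show "g y * (h y / n * ((n - m) / m)) \<le> (\<epsilon> * D) * (R * (R * R * W))" .
      qed
      also have "\<dots> = (\<epsilon> * (R + D * (R * R))) * dist x y + \<epsilon> * (D * (R * (R * R))) * W"
        by (simp add: algebra_simps)
      finally show "h x * g x / m - h y * g y / n
          \<le> (\<epsilon> * (R + D * (R * R))) * dist x y + \<epsilon> * (D * (R * (R * R))) * W" .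
    qed
    also have "\<dots> = (C0 * k) * exp (- \<alpha> * t) * wasserstein \<mu> \<nu>"
      by (simp add: W_def k_def \<epsilon>_def algebra_simps)
    finally show "(\<integral>x. f x \<partial>conditional_law I \<rho> P X t \<mu>) - (\<integral>x. f x \<partial>conditional_law I \<rho> P X t \<nu>)
      \<le> (C0 * k) * exp (- \<alpha> * t) * wasserstein \<mu> \<nu>" .
  qed
  moreover have "0 < C0 * k" using C0 k by simp
  ultimately show ?thesis using \<alpha> that by blast
qed

text \<open>
The conditional laws \<open>\<Phi> n \<mu>0\<close> at integer times form a Cauchy sequence, because \<open>\<Phi> (n + 1) \<mu>0\<close> is
\<open>\<Phi> n\<close> applied to \<open>\<Phi> 1 \<mu>0\<close>. Their limit is invariant, since \<open>\<Phi> t (\<Phi> n \<mu>0) = \<Phi> n (\<Phi> t \<mu>0)\<close> has the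
same limit.
\<close>
lemma quasi_stationary_exists:
  assumes ops: "penalized_operators I T C \<gamma> c D K" and C1: "0 < C1" and \<alpha>: "0 < \<alpha>"
    and contr: "\<And>\<mu> \<nu> t. \<mu> \<in> space (prob_algebra borel) \<Longrightarrow> \<nu> \<in> space (prob_algebra borel) \<Longrightarrow> t \<in> I \<Longrightarrow>
       wasserstein (conditional_law I \<rho> P X t \<mu>) (conditional_law I \<rho> P X t \<nu>) \<le> C1 * exp (- \<alpha> * t)
           * wasserstein \<mu> \<nu>"
  obtains \<nu> where "quasi_stationary I \<rho> P X \<nu>"
proof -
  interpret ops: penalized_operators I T C \<gamma> c D K by (rule ops)
  have D0: "0 \<le> D" by (rule ops.D_nonneg)
  define \<mu>0 :: "'a measure" where "\<mu>0 = return borel undefined"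
  have \<mu>0: "\<mu>0 \<in> space (prob_algebra borel)"
    by (simp add: \<mu>0_def space_prob_algebra prob_space_return)
  define \<Phi> where "\<Phi> t = conditional_law I \<rho> P X t" for t
  have \<Phi>: "\<Phi> t \<mu> \<in> space (prob_algebra borel)" if "t \<in> I" "\<mu> \<in> space (prob_algebra borel)" for t \<mu>
    unfolding \<Phi>_def by (rule conditional_law(1)[OF that(2,1)])
  have bound: "\<bar>(\<integral>x. f x \<partial>\<Phi> (real n) \<mu>0) - (\<integral>x. f x \<partial>\<Phi> (real n) (\<Phi> t \<mu>0))\<bar>
      \<le> l * (C1 * D) * exp (- \<alpha>) ^ n"
    if t: "t \<in> I" and f: "l-lipschitz_on UNIV f" for t n l and f :: "'a \<Rightarrow> real"
  proof -
    have l0: "0 \<le> l" using f by (rule lipschitz_on_nonneg)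
    have "\<bar>(\<integral>x. f x \<partial>\<Phi> (real n) \<mu>0) - (\<integral>x. f x \<partial>\<Phi> (real n) (\<Phi> t \<mu>0))\<bar>
        \<le> l * wasserstein (\<Phi> (real n) \<mu>0) (\<Phi> (real n) (\<Phi> t \<mu>0))"
      by (intro lipschitz_integral_diff_le[OF _ _ ops.dist_le f] \<Phi> I_nat t \<mu>0)
    also have "\<dots> \<le> l * (C1 * exp (- \<alpha> * real n) * wasserstein \<mu>0 (\<Phi> t \<mu>0))"
      using l0 contr[OF \<mu>0 \<Phi>[OF t \<mu>0] I_nat[of n]] by (intro mult_left_mono) (auto simp: \<Phi>_def)
    also have "\<dots> \<le> l * (C1 * exp (- \<alpha> * real n) * D)"
      using l0 C1 wasserstein_le_bound[OF \<mu>0 \<Phi>[OF t \<mu>0] ops.dist_le] by (intro mult_left_mono) auto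
    also have "exp (- \<alpha> * real n) = exp (- \<alpha>) ^ n"
      by (simp add: exp_of_nat_mult[symmetric] mult.commute)
    finally show ?thesis by (simp add: mult.assoc mult.left_commute mult.commute)
  qed
  have q: "exp (- \<alpha>) < 1" using \<alpha> by simp
  have summ: "summable (\<lambda>n. C1 * D * exp (- \<alpha>) ^ n)" using q
    by (intro summable_mult summable_geometric) auto
  have cauchy: "(\<integral>x. f x \<partial>\<Phi> (real n) \<mu>0) - (\<integral>x. f x \<partial>\<Phi> (real (Suc n)) \<mu>0) \<le> C1 * D * exp (- \<alpha>) ^ n"
    if f: "1-lipschitz_on UNIV f" for n and f :: "'a \<Rightarrow> real"
  proof -
    have "\<Phi> (real n) (\<Phi> 1 \<mu>0) = \<Phi> (real (Suc n)) \<mu>0"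
      using conditional_law_compose[OF ops \<mu>0 I_nat[of n] I_nat[of 1]]
        by (simp add: \<Phi>_def add.commute)
    then show ?thesis using bound[OF _ f, of 1 n] I_nat[of 1] by simp
  qed
  obtain \<nu> where \<nu>: "\<nu> \<in> space (prob_algebra borel)"
    and lim: "\<And>f l. l-lipschitz_on UNIV f \<Longrightarrow> (\<lambda>n. \<integral>x. f x \<partial>\<Phi> (real n) \<mu>0) \<longlonglongrightarrow> (\<integral>x. f x \<partial>\<nu> :: real)"
  proof (rule wasserstein_complete[where \<mu> = "\<lambda>n. \<Phi> (real n) \<mu>0" and D = D and b =
      "\<lambda>n. C1 * D * exp (- \<alpha>) ^ n"])
    show "\<Phi> (real n) \<mu>0 \<in> space (prob_algebra borel)" for n by (rule \<Phi>[OF I_nat \<mu>0])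
  qed (use ops.dist_le cauchy summ C1 D0 in auto)
  have "\<Phi> t \<nu> = \<nu>" if t: "t \<in> I" for t
  proof (rule measure_eqI_lipschitz[OF \<Phi>[OF t \<nu>] \<nu>])
    fix f :: "'a \<Rightarrow> real" and l assume f: "l-lipschitz_on UNIV f"
    have fm: "f \<in> borel_measurable borel" and fb: "bounded (range f)"
      using lipschitz_borel_measurable[OF f] lipschitz_bounded[OF ops.dist_le f]
        by (auto simp: bounded_iff)
    obtain lF where lF: "lF-lipschitz_on UNIV (T t f)" using ops.T_lip[OF t f] .
    obtain lh where lh: "lh-lipschitz_on UNIV (T t (\<lambda>_. 1))" using ops.h_lip[OF t] .
    interpret \<nu>: prob_space \<nu> by (rule prob_algebraD[OF \<nu>])
    have "exp (- c * t) \<le> (\<integral>x. T t (\<lambda>_. 1) x \<partial>\<nu>)"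
      by (rule \<nu>.integral_ge_const[OF lipschitz_integrable[OF ops.dist_le lh \<nu>]])
          (use mass_bounds(1)[OF t] in auto)
    then have pos: "(\<integral>x. T t (\<lambda>_. 1) x \<partial>\<nu>) \<noteq> 0" using exp_gt_zero[of "- c * t"] by linarith
    have "(\<lambda>n. (\<integral>x. T t f x \<partial>\<Phi> (real n) \<mu>0) / (\<integral>x. T t (\<lambda>_. 1) x \<partial>\<Phi> (real n) \<mu>0))
      \<longlonglongrightarrow> (\<integral>x. T t f x \<partial>\<nu>) / (\<integral>x. T t (\<lambda>_. 1) x \<partial>\<nu>)"
      by (intro tendsto_divide lim[OF lF] lim[OF lh] pos)
    then have 1: "(\<lambda>n. \<integral>x. f x \<partial>\<Phi> t (\<Phi> (real n) \<mu>0)) \<longlonglongrightarrow> (\<integral>x. f x \<partial>\<Phi> t \<nu>)"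
      using conditional_law(2)[OF \<nu> t fm fb] conditional_law(2)[OF \<Phi>[OF I_nat \<mu>0] t fm fb]
      by (simp add: \<Phi>_def)
    have comm: "\<Phi> t (\<Phi> (real n) \<mu>0) = \<Phi> (real n) (\<Phi> t \<mu>0)" for n
      using conditional_law_compose[OF ops \<mu>0 I_nat[of n] t]
          conditional_law_compose[OF ops \<mu>0 t I_nat[of n]]
      by (simp add: \<Phi>_def add.commute)
    have "(\<lambda>n. (\<integral>x. f x \<partial>\<Phi> (real n) \<mu>0) - (\<integral>x. f x \<partial>\<Phi> t (\<Phi> (real n) \<mu>0))) \<longlonglongrightarrow> 0"
    proof (rule tendsto_rabs_zero_cancel, rule tendsto_sandwich[of "\<lambda>_. 0"])
      have "(\<lambda>n. l * (C1 * D) * exp (- \<alpha>) ^ n) \<longlonglongrightarrow> l * (C1 * D) * 0"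
        using q by (intro tendsto_intros LIMSEQ_realpow_zero) auto
      then show "(\<lambda>n. l * (C1 * D) * exp (- \<alpha>) ^ n) \<longlonglongrightarrow> 0" by simp
    qed (use bound[OF t f] in \<open>auto simp: comm\<close>)
    moreover have "(\<lambda>n. (\<integral>x. f x \<partial>\<Phi> (real n) \<mu>0) - (\<integral>x. f x \<partial>\<Phi> t (\<Phi> (real n) \<mu>0)))
        \<longlonglongrightarrow> (\<integral>x. f x \<partial>\<nu>) - (\<integral>x. f x \<partial>\<Phi> t \<nu>)"
      by (intro tendsto_diff lim[OF f] 1)
    ultimately show "(\<integral>x. f x \<partial>\<Phi> t \<nu>) = (\<integral>x. f x \<partial>\<nu>)" using LIMSEQ_unique by fastforce
  qed
  then have "quasi_stationary I \<rho> P X \<nu>" using \<nu> by (simp add: quasi_stationary_def \<Phi>_def)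
  then show ?thesis by (rule that)
qed

end

theorem theorem2p1:
  fixes I :: "real set"
    and \<Omega> :: "'w measure"
    and F :: "real \<Rightarrow> 'w measure"
    and P :: "'a::polish_space \<Rightarrow> 'w measure"
    and X :: "real \<Rightarrow> 'w \<Rightarrow> 'a"
    and \<rho> :: "'a \<Rightarrow> real"
    and dbar L :: real
  assumes bounded_dist: "\<And>x y::'a. dist x y \<le> dbar"
    and markov: "markov_process I \<Omega> F P X"
    and rho_nonneg: "\<And>x. 0 \<le> \<rho> x"
    and rho_lipschitz: "L-lipschitz_on UNIV \<rho>"
    and A: "condition_A TYPE('c) I \<rho> P X"
  shows "\<exists>C1>0. \<exists>\<alpha>>0.
    (\<forall>\<mu>\<in>space (prob_algebra borel). \<forall>\<nu>\<in>space (prob_algebra borel). \<forall>t\<in>I.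
       wasserstein (conditional_law I \<rho> P X t \<mu>) (conditional_law I \<rho> P X t \<nu>)
         \<le> C1 * exp (- \<alpha> * t) * wasserstein \<mu> \<nu>) \<and>
    (\<exists>\<nu>QS. quasi_stationary I \<rho> P X \<nu>QS \<and>
       (\<forall>\<nu>. quasi_stationary I \<rho> P X \<nu> \<longrightarrow> \<nu> = \<nu>QS) \<and>
       (\<forall>\<mu>\<in>space (prob_algebra borel). \<forall>t\<in>I.
          wasserstein (conditional_law I \<rho> P X t \<mu>) \<nu>QS
            \<le> C1 * exp (- \<alpha> * t) * wasserstein \<mu> \<nu>QS))"
proof -
  define c where "c = \<bar>\<rho> undefined\<bar> + L * dbar"
  have rho_measurable: "\<rho> \<in> borel_measurable borel" by (rule lipschitz_borel_measurable[OF rho_lipschitz])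
  have rho_le: "\<rho> x \<le> c" for x using lipschitz_bounded[OF bounded_dist rho_lipschitz, of x] by (simp add: c_def)
  interpret penalized_markov_process I \<Omega> F P X \<rho> c
    using markov rho_measurable rho_nonneg rho_le
    by (simp add: penalized_markov_process_def penalized_markov_process_axioms_def)
  obtain C \<gamma> where ops: "penalized_operators I T C \<gamma> c dbar (\<lambda>t. L * t * (C * exp (c * t)))"
    by (rule penalized_operatorsI[OF A rho_lipschitz bounded_dist])
  obtain C1 \<alpha> where C1: "0 < C1" and \<alpha>: "0 < \<alpha>"
    and contr: "\<And>\<mu> \<nu> t. \<mu> \<in> space (prob_algebra borel) \<Longrightarrow> \<nu> \<in> space (prob_algebra borel) \<Longrightarrow> t \<in> I \<Longrightarrow>
       wasserstein (conditional_law I \<rho> P X t \<mu>) (conditional_law I \<rho> P X t \<nu>) \<le> C1 * exp (- \<alpha> * t) * wasserstein \<mu> \<nu>"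
    by (rule wasserstein_contraction[OF ops]) blast
  obtain \<nu>QS where QS: "quasi_stationary I \<rho> P X \<nu>QS"
    by (rule quasi_stationary_exists[OF ops C1 \<alpha> contr])
  have fixed: "conditional_law I \<rho> P X t \<nu> = \<nu>" and prob: "\<nu> \<in> space (prob_algebra borel)"
    if "quasi_stationary I \<rho> P X \<nu>" "t \<in> I" for \<nu> t
    using that by (auto simp: quasi_stationary_def)
  have "\<nu> = \<nu>QS" if \<nu>: "quasi_stationary I \<rho> P X \<nu>" for \<nu>
  proof (rule wasserstein_eq_0D[OF prob[OF \<nu> I_0] prob[OF QS I_0] bounded_dist])
    have "(\<lambda>n. C1 * exp (- \<alpha>) ^ n * wasserstein \<nu> \<nu>QS) \<longlonglongrightarrow> C1 * 0 * wasserstein \<nu> \<nu>QS"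
      using \<alpha> by (intro tendsto_intros LIMSEQ_realpow_zero) auto
    moreover have "wasserstein \<nu> \<nu>QS \<le> C1 * exp (- \<alpha>) ^ n * wasserstein \<nu> \<nu>QS" for n
    proof -
      have "exp (- \<alpha> * real n) = exp (- \<alpha>) ^ n" by (simp add: exp_of_nat_mult[symmetric] mult.commute)
      then show ?thesis
        using contr[OF prob[OF \<nu> I_0] prob[OF QS I_0] I_nat[of n]] fixed[OF \<nu> I_nat[of n]] fixed[OF QS I_nat[of n]] by simp
    qed
    ultimately show "wasserstein \<nu> \<nu>QS \<le> 0" by (intro LIMSEQ_le_const) auto
  qed
  moreover have "wasserstein (conditional_law I \<rho> P X t \<mu>) \<nu>QS \<le> C1 * exp (- \<alpha> * t) * wasserstein \<mu> \<nu>QS"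
    if "\<mu> \<in> space (prob_algebra borel)" "t \<in> I" for \<mu> t
    using contr[OF that(1) prob[OF QS I_0] that(2)] fixed[OF QS that(2)] by simp
  ultimately show ?thesis using C1 \<alpha> contr QS by blast
qed

end
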